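(* Let $(X,* )$ be a pointed fibrant bisimplicial set and let $m\ge 1$, $n\ge 1$. Then the Aeppli product $\diamond$ turns the Aeppli homotopy set $\pi^{\mathrm{A}}_{m,n}(X,* )$ into a group.
   Context: **Notation.** A bisimplicial set $X$ has face and degeneracy maps $d_i,s_i$ in the first index and $\overline d_j,\overline s_j$ in the second. For simplicial sets $A,B$, the bisimplicial set $A\boxtimes B$ is $(A\boxtimes B)_{m,n}=A_m\times B_n$. $\Delta^{m,n}=\Delta^m\boxtimes\Delta^n$; elements of $X_{m,n}$ are identified with maps $\Delta^{m,n}\to X$, so for $\theta:\Delta^{m,n}\to X$ the faces $d_i\theta:\Delta^{m-1,n}\to X$, $\overline d_j\theta:\Delta^{m,n-1}\to X$ (and degeneracies) make sense. $d_i\Delta^m\subset\Delta^m$ is the $i$-th face and $\Lambda^m_k=\bigcup_{i\ne k}d_i\Delta^m$. $\delta_{\mathrm A}\Delta^{m,n}=\Lambda^m_m\boxtimes\Delta^n\cup\Delta^m\boxtimes\Lambda^n_n\cup\partial\Delta^m\boxtimes\partial\Delta^n$; so $\alpha$ is constant on it iff $d_i\alpha=*$ for $i<m$, $\overline d_j\alpha=*$ for $j<n$ and $d_m\overline d_n\alpha=*$. **Fibrancy.** Anodyne extensions are the monomorphisms in the saturated class generated by $\Lambda^m_k\boxtimes\Delta^n\cup\Delta^m\boxtimes\Lambda^n_l\to\Delta^m\boxtimes\Delta^n$ ($m,n\ge1$, $0\le k\le m$, $0\le l\le n$). A map is a fibration if it has the right lifting property against all anodyne extensions; $X$ is fibrant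 if $X\to\Delta^{0,0}$ is a fibration. A pointed bisimplicial set has a chosen vertex $*:\Delta^{0,0}\to X$; any constant map $K\to\Delta^{0,0}\to X$ is also written $*$. **Homotopy.** For $h:K\times\Delta^{1,1}\to X$, face and degeneracy operators in the $\Delta^{1,1}$-direction carry a hat. $h$ is a homotopy from $\alpha$ to $\beta$ ($\alpha,\beta:K\to X$) if $\hat d_0h=\hat{\overline s}_0\alpha$, $\hat{\overline d}_0h=\hat s_0\alpha$ (i.e. these restrictions are $\alpha$ composed with the projection to $K$) and $\hat d_1\hat{\overline d}_1h=\beta$. For $L\subset K$, a map $\alpha:K\to X$ rel $L$ is one with $\alpha|_L=*$; a homotopy rel $L$ between two such maps is a homotopy $h$ with $h|_{L\times\Delta^{1,1}}=*$. If $X$ is fibrant this is an equivalence relation. $\pi^{\mathrm A}_{m,n}(X,* )$ is the set of relative homotopy classes of maps $\Delta^{m,n}\to X$ rel $\delta_{\mathrm A}\Delta^{m,n}$. **Aeppli product** ($m,n\ge1$). Given $\alpha,\beta:\Delta^{m,n}\to X$ rel $\delta_{\mathrm A}\Delta^{m,n}$, choose (by fibrancy) $\theta:\Delta^{m+1,n+1}\to X$ with $d_i\theta=*$ for $0\le i<m-1$; $\overline d_j\theta=*$ for $0\le j<n-1$; $d_{m-1}\theta=\overline s_{n-1}\alpha$, $\overline d_{n-1}\theta=s_{m-1}\alpha$; and $d_{m+1}\overline d_{n+1}\theta=\beta$. Then $[\alpha]\diamond[\beta]:=[d_m\overline d_n\theta]$ (this is a map rel $\delta_{\mathrm A}\Delta^{m,n}$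 and its class depends only on $[\alpha],[\beta]$). *)

theory Defs
  imports
    "HOL-Algebra.Group"
    "HOL-Library.FuncSet"
    "HOL-Library.Infinite_Typeclass"
begin

section \<open>Simplicial sets\<close>

text \<open>
  The operators carry the dimension of their source: \<open>face A m i\<close> is
  $d_i : A_m \to A_{m-1}$ (for $m \geq 1$, $i \leq m$) and \<open>degen A m i\<close> is
  $s_i : A_m \to A_{m+1}$ (for $i \leq m$).  Their values elsewhere are irrelevant.
  The sets of simplices in different dimensions need not be disjoint.
\<close>

record 'a sset =
  simplices :: "nat \<Rightarrow> 'a set"
  face :: "nat \<Rightarrow> nat \<Rightarrow> 'a \<Rightarrow> 'a"
  degen :: "nat \<Rightarrow> nat \<Rightarrow> 'a \<Rightarrow> 'a"

locale simplicial_set =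
  fixes A :: "'a sset"
  assumes face_closed:
      "\<And>m i x. i \<le> Suc m \<Longrightarrow> x \<in> simplices A (Suc m) \<Longrightarrow> face A (Suc m) i x \<in> simplices A m"
    and degen_closed:
      "\<And>m i x. i \<le> m \<Longrightarrow> x \<in> simplices A m \<Longrightarrow> degen A m i x \<in> simplices A (Suc m)"
    and face_face:
      "\<And>m i j x. i < j \<Longrightarrow> j \<le> Suc (Suc m) \<Longrightarrow> x \<in> simplices A (Suc (Suc m)) \<Longrightarrow>
         face A (Suc m) i (face A (Suc (Suc m)) j x)
           = face A (Suc m) (j - 1) (face A (Suc (Suc m)) i x)"
    and face_degen_less:
      "\<And>m i j x. i < j \<Longrightarrow> j \<le> m \<Longrightarrow> x \<in> simplices A m \<Longrightarrow>
         face A (Suc m) i (degen A m j x) = degen A (m - 1) (j - 1) (face A m i x)"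
    and face_degen_same:
      "\<And>m i j x. i = j \<or> i = Suc j \<Longrightarrow> j \<le> m \<Longrightarrow> x \<in> simplices A m \<Longrightarrow>
         face A (Suc m) i (degen A m j x) = x"
    and face_degen_greater:
      "\<And>m i j x. Suc j < i \<Longrightarrow> i \<le> Suc m \<Longrightarrow> x \<in> simplices A m \<Longrightarrow>
         face A (Suc m) i (degen A m j x) = degen A (m - 1) j (face A m (i - 1) x)"
    and degen_degen:
      "\<And>m i j x. i \<le> j \<Longrightarrow> j \<le> m \<Longrightarrow> x \<in> simplices A m \<Longrightarrow>
         degen A (Suc m) i (degen A m j x) = degen A (Suc m) (Suc j) (degen A m i x)"

text \<open>
  A $k$-simplex of $\Delta^m$ is a monotone map $[k] \to [m]$, represented by the list of
  its $k + 1$ values.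
\<close>

definition Delta :: "nat \<Rightarrow> nat list sset" where
  "Delta m = \<lparr>
     simplices = (\<lambda>k. {xs. length xs = Suc k \<and> sorted xs \<and> set xs \<subseteq> {..m}}),
     face = (\<lambda>k i xs. take i xs @ drop (Suc i) xs),
     degen = (\<lambda>k i xs. take (Suc i) xs @ drop i xs)\<rparr>"

text \<open>
  The coface $\delta^i : [m-1] \to [m]$ omits the value $i$ and the codegeneracy
  $\sigma^i : [m+1] \to [m]$ takes the value $i$ twice.
\<close>

definition coface :: "nat \<Rightarrow> nat \<Rightarrow> nat" where
  "coface i v = (if v < i then v else Suc v)"

definition codegen :: "nat \<Rightarrow> nat \<Rightarrow> nat" where
  "codegen i v = (if v \<le> i then v else v - 1)"

text \<open>
  The face $d_i \Delta^m$ consists of the monotone maps into $[m]$ that omit the value $i$,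
  i.e. that factor through $\delta^i$.
\<close>

definition face_simplices :: "nat \<Rightarrow> nat \<Rightarrow> nat \<Rightarrow> nat list set" where
  "face_simplices m i k = {xs \<in> simplices (Delta m) k. i \<notin> set xs}"

definition Horn :: "nat \<Rightarrow> nat \<Rightarrow> nat list sset" where
  "Horn m k = (Delta m)\<lparr>simplices := (\<lambda>p. \<Union>i \<in> {..m} - {k}. face_simplices m i p)\<rparr>"

definition Boundary :: "nat \<Rightarrow> nat list sset" where
  "Boundary m = (Delta m)\<lparr>simplices := (\<lambda>p. \<Union>i \<in> {..m}. face_simplices m i p)\<rparr>"


section \<open>Bisimplicial sets\<close>

text \<open>
  \<open>hface X m n\<close>, \<open>hdegen X m n\<close> are the operators $d_i$, $s_i$ on $X_{m,n}$ in the first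
  index, \<open>vface X m n\<close>, \<open>vdegen X m n\<close> the operators $\overline d_j$, $\overline s_j$ in
  the second.
\<close>

record 'a bisset =
  cells :: "nat \<Rightarrow> nat \<Rightarrow> 'a set"
  hface :: "nat \<Rightarrow> nat \<Rightarrow> nat \<Rightarrow> 'a \<Rightarrow> 'a"
  hdegen :: "nat \<Rightarrow> nat \<Rightarrow> nat \<Rightarrow> 'a \<Rightarrow> 'a"
  vface :: "nat \<Rightarrow> nat \<Rightarrow> nat \<Rightarrow> 'a \<Rightarrow> 'a"
  vdegen :: "nat \<Rightarrow> nat \<Rightarrow> nat \<Rightarrow> 'a \<Rightarrow> 'a"

definition hrow :: "'a bisset \<Rightarrow> nat \<Rightarrow> 'a sset" where
  "hrow X n = \<lparr>simplices = (\<lambda>m. cells X m n), face = (\<lambda>m. hface X m n), degen = (\<lambda>m. hdegen X m n)\<rparr>"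

definition vcol :: "'a bisset \<Rightarrow> nat \<Rightarrow> 'a sset" where
  "vcol X m = \<lparr>simplices = cells X m, face = vface X m, degen = vdegen X m\<rparr>"

locale bisimplicial_set =
  fixes X :: "'a bisset"
  assumes row: "\<And>n. simplicial_set (hrow X n)"
    and col: "\<And>m. simplicial_set (vcol X m)"
    and hface_vface:
      "\<And>m n i j x. i \<le> Suc m \<Longrightarrow> j \<le> Suc n \<Longrightarrow> x \<in> cells X (Suc m) (Suc n) \<Longrightarrow>
         hface X (Suc m) n i (vface X (Suc m) (Suc n) j x)
           = vface X m (Suc n) j (hface X (Suc m) (Suc n) i x)"
    and hface_vdegen:
      "\<And>m n i j x. i \<le> Suc m \<Longrightarrow> j \<le> n \<Longrightarrow> x \<in> cells X (Suc m) n \<Longrightarrow>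
         hface X (Suc m) (Suc n) i (vdegen X (Suc m) n j x)
           = vdegen X m n j (hface X (Suc m) n i x)"
    and hdegen_vface:
      "\<And>m n i j x. i \<le> m \<Longrightarrow> j \<le> Suc n \<Longrightarrow> x \<in> cells X m (Suc n) \<Longrightarrow>
         hdegen X m n i (vface X m (Suc n) j x)
           = vface X (Suc m) (Suc n) j (hdegen X m (Suc n) i x)"
    and hdegen_vdegen:
      "\<And>m n i j x. i \<le> m \<Longrightarrow> j \<le> n \<Longrightarrow> x \<in> cells X m n \<Longrightarrow>
         hdegen X m (Suc n) i (vdegen X m n j x)
           = vdegen X (Suc m) n j (hdegen X m n i x)"

text \<open>
  Maps are extensional (\<open>undefined\<close> off the carriers), so that equality of maps is equality
  in HOL.
\<close>

type_synonym ('a, 'b) bmap = "nat \<Rightarrow> nat \<Rightarrow> 'a \<Rightarrow> 'b"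

definition bihom :: "'a bisset \<Rightarrow> 'b bisset \<Rightarrow> ('a, 'b) bmap set" where
  "bihom A B = {f.
     (\<forall>m n. f m n \<in> cells A m n \<rightarrow>\<^sub>E cells B m n) \<and>
     (\<forall>m n i. \<forall>x \<in> cells A (Suc m) n. i \<le> Suc m \<longrightarrow>
        f m n (hface A (Suc m) n i x) = hface B (Suc m) n i (f (Suc m) n x)) \<and>
     (\<forall>m n i. \<forall>x \<in> cells A m n. i \<le> m \<longrightarrow>
        f (Suc m) n (hdegen A m n i x) = hdegen B m n i (f m n x)) \<and>
     (\<forall>m n j. \<forall>x \<in> cells A m (Suc n). j \<le> Suc n \<longrightarrow>
        f m n (vface A m (Suc n) j x) = vface B m (Suc n) j (f m (Suc n) x)) \<and>
     (\<forall>m n j. \<forall>x \<in> cells A m n. j \<le> n \<longrightarrow>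
        f m (Suc n) (vdegen A m n j x) = vdegen B m n j (f m n x))}"

text \<open>\<open>bcomp A g f\<close> is $g \circ f$, where \<open>A\<close> is the source of \<open>f\<close>.\<close>

definition bcomp :: "'a bisset \<Rightarrow> ('b, 'c) bmap \<Rightarrow> ('a, 'b) bmap \<Rightarrow> ('a, 'c) bmap" where
  "bcomp A g f = (\<lambda>m n. compose (cells A m n) (g m n) (f m n))"

definition bid :: "'a bisset \<Rightarrow> ('a, 'a) bmap" where
  "bid A = (\<lambda>m n. \<lambda>x \<in> cells A m n. x)"

definition brestr :: "'a bisset \<Rightarrow> ('a, 'b) bmap \<Rightarrow> ('a, 'b) bmap" where
  "brestr L f = (\<lambda>m n. restrict (f m n) (cells L m n))"

definition biso :: "'a bisset \<Rightarrow> 'b bisset \<Rightarrow> ('a, 'b) bmap set" where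
  "biso A B = {f \<in> bihom A B. \<exists>g \<in> bihom B A. bcomp A g f = bid A \<and> bcomp B f g = bid B}"

text \<open>$A \boxtimes B$\<close>

definition boxtimes :: "'a sset \<Rightarrow> 'b sset \<Rightarrow> ('a \<times> 'b) bisset" where
  "boxtimes A B = \<lparr>
     cells = (\<lambda>m n. simplices A m \<times> simplices B n),
     hface = (\<lambda>m n i. apfst (face A m i)),
     hdegen = (\<lambda>m n i. apfst (degen A m i)),
     vface = (\<lambda>m n j. apsnd (face B n j)),
     vdegen = (\<lambda>m n j. apsnd (degen B n j))\<rparr>"

type_synonym bisimplex = "nat list \<times> nat list"

definition Delta2 :: "nat \<Rightarrow> nat \<Rightarrow> bisimplex bisset" where
  "Delta2 m n = boxtimes (Delta m) (Delta n)"

text \<open>Cartesian product\<close>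

definition bprod :: "'a bisset \<Rightarrow> 'b bisset \<Rightarrow> ('a \<times> 'b) bisset" where
  "bprod A B = \<lparr>
     cells = (\<lambda>m n. cells A m n \<times> cells B m n),
     hface = (\<lambda>m n i. map_prod (hface A m n i) (hface B m n i)),
     hdegen = (\<lambda>m n i. map_prod (hdegen A m n i) (hdegen B m n i)),
     vface = (\<lambda>m n j. map_prod (vface A m n j) (vface B m n j)),
     vdegen = (\<lambda>m n j. map_prod (vdegen A m n j) (vdegen B m n j))\<rparr>"

text \<open>
  Union of two bisimplicial subsets of a common bisimplicial set: both have the operators of
  the ambient one.
\<close>

definition bunion :: "'a bisset \<Rightarrow> 'a bisset \<Rightarrow> 'a bisset" where
  "bunion A B = A\<lparr>cells := (\<lambda>m n. cells A m n \<union> cells B m n)\<rparr>"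

definition Horn2 :: "nat \<Rightarrow> nat \<Rightarrow> nat \<Rightarrow> nat \<Rightarrow> bisimplex bisset" where
  "Horn2 m k n l = bunion (boxtimes (Horn m k) (Delta n)) (boxtimes (Delta m) (Horn n l))"

text \<open>$\delta_{\mathrm A} \Delta^{m,n}$\<close>

definition delta_A :: "nat \<Rightarrow> nat \<Rightarrow> bisimplex bisset" where
  "delta_A m n =
     bunion (bunion (boxtimes (Horn m m) (Delta n)) (boxtimes (Delta m) (Horn n n)))
            (boxtimes (Boundary m) (Boundary n))"

definition to_point :: "'a bisset \<Rightarrow> ('a, bisimplex) bmap" where
  "to_point K = (\<lambda>p q. \<lambda>x \<in> cells K p q. (replicate (Suc p) 0, replicate (Suc q) 0))"

text \<open>The constant map \<open>K \<rightarrow> Delta2 0 0 \<rightarrow> X\<close> at a vertex \<open>pt\<close>\<close>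

definition const_map :: "(bisimplex, 'a) bmap \<Rightarrow> 'k bisset \<Rightarrow> ('k, 'a) bmap" where
  "const_map pt K = bcomp K pt (to_point K)"


section \<open>Saturated classes, anodyne extensions, fibrations\<close>

text \<open>
  A class of maps is a predicate \<open>S A B f\<close> on maps \<open>f : A \<rightarrow> B\<close> between bisimplicial sets
  with cells in one fixed type \<open>'u\<close>, which plays the role of the universe.  Limiting
  properties are tested in the same universe; for infinite \<open>'u\<close> it is closed, up to
  isomorphism, under the colimits that occur.
\<close>

type_synonym 'u arrows = "'u bisset \<Rightarrow> 'u bisset \<Rightarrow> ('u, 'u) bmap \<Rightarrow> bool"

text \<open>
  Cocones and colimits of a diagram with objects \<open>D i\<close>, \<open>i \<in> I\<close>, and transition maps
  \<open>\<phi> i j : D i \<rightarrow> D j\<close> for \<open>(i, j) \<in> r\<close>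
\<close>

definition is_cocone ::
  "'i set \<Rightarrow> 'i rel \<Rightarrow> ('i \<Rightarrow> 'u bisset) \<Rightarrow> ('i \<Rightarrow> 'i \<Rightarrow> ('u, 'u) bmap) \<Rightarrow>
   'u bisset \<Rightarrow> ('i \<Rightarrow> ('u, 'u) bmap) \<Rightarrow> bool" where
  "is_cocone I r D \<phi> C c \<longleftrightarrow>
     bisimplicial_set C \<and>
     (\<forall>i \<in> I. c i \<in> bihom (D i) C) \<and>
     (\<forall>i \<in> I. \<forall>j \<in> I. (i, j) \<in> r \<longrightarrow> bcomp (D i) (c j) (\<phi> i j) = c i)"

definition is_colimit ::
  "'i set \<Rightarrow> 'i rel \<Rightarrow> ('i \<Rightarrow> 'u bisset) \<Rightarrow> ('i \<Rightarrow> 'i \<Rightarrow> ('u, 'u) bmap) \<Rightarrow>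
   'u bisset \<Rightarrow> ('i \<Rightarrow> ('u, 'u) bmap) \<Rightarrow> bool" where
  "is_colimit I r D \<phi> C c \<longleftrightarrow>
     is_cocone I r D \<phi> C c \<and>
     (\<forall>E e. is_cocone I r D \<phi> E e \<longrightarrow>
        (\<exists>!u. u \<in> bihom C E \<and> (\<forall>i \<in> I. bcomp (D i) u (c i) = e i)))"

definition closed_iso :: "'u arrows \<Rightarrow> bool" where
  "closed_iso S \<longleftrightarrow>
     (\<forall>A B f. bisimplicial_set A \<longrightarrow> bisimplicial_set B \<longrightarrow> f \<in> biso A B \<longrightarrow> S A B f)"

definition is_pushout ::
  "'u bisset \<Rightarrow> 'u bisset \<Rightarrow> 'u bisset \<Rightarrow> 'u bisset \<Rightarrow>
   ('u, 'u) bmap \<Rightarrow> ('u, 'u) bmap \<Rightarrow> ('u, 'u) bmap \<Rightarrow> ('u, 'u) bmap \<Rightarrow> bool" where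
  "is_pushout A B C D f g f' g' \<longleftrightarrow>
     f \<in> bihom A B \<and> g \<in> bihom A C \<and> f' \<in> bihom C D \<and> g' \<in> bihom B D \<and>
     bcomp A g' f = bcomp A f' g \<and>
     (\<forall>(E :: 'u bisset) b c. bisimplicial_set E \<longrightarrow> b \<in> bihom B E \<longrightarrow> c \<in> bihom C E \<longrightarrow>
        bcomp A b f = bcomp A c g \<longrightarrow>
        (\<exists>!u. u \<in> bihom D E \<and> bcomp B u g' = b \<and> bcomp C u f' = c))"

definition closed_pushout :: "'u arrows \<Rightarrow> bool" where
  "closed_pushout S \<longleftrightarrow>
     (\<forall>A B C D f g f' g'. S A B f \<longrightarrow> bisimplicial_set C \<longrightarrow> bisimplicial_set D \<longrightarrow>
        is_pushout A B C D f g f' g' \<longrightarrow> S C D f')"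

definition closed_retract :: "'u arrows \<Rightarrow> bool" where
  "closed_retract S \<longleftrightarrow>
     (\<forall>A B f A' B' f' i r j s.
        S A B f \<longrightarrow> bisimplicial_set A' \<longrightarrow> bisimplicial_set B' \<longrightarrow> f' \<in> bihom A' B' \<longrightarrow>
        i \<in> bihom A' A \<longrightarrow> r \<in> bihom A A' \<longrightarrow> j \<in> bihom B' B \<longrightarrow> s \<in> bihom B B' \<longrightarrow>
        bcomp A' r i = bid A' \<longrightarrow> bcomp B' s j = bid B' \<longrightarrow>
        bcomp A' f i = bcomp A' j f' \<longrightarrow> bcomp A f' r = bcomp A s f \<longrightarrow>
        S A' B' f')"

definition closed_coproduct :: "'u arrows \<Rightarrow> bool" where
  "closed_coproduct S \<longleftrightarrow>
     (\<forall>(I :: 'u set) A B f C c D d g.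
        (\<forall>i \<in> I. S (A i) (B i) (f i)) \<longrightarrow>
        is_colimit I {} A (\<lambda>_ _. undefined) C c \<longrightarrow> is_colimit I {} B (\<lambda>_ _. undefined) D d \<longrightarrow>
        g \<in> bihom C D \<longrightarrow> (\<forall>i \<in> I. bcomp (A i) g (c i) = bcomp (A i) (d i) (f i)) \<longrightarrow>
        S C D g)"

text \<open>
  \<open>transfinite_seq S r D \<phi>\<close>: a functor on the well-order \<open>r\<close> which is continuous at
  limit elements and whose successor steps belong to \<open>S\<close>.  An element with an immediate
  predecessor \<open>i\<close> is one whose set \<open>underS r j\<close> of strict predecessors has greatest
  element \<open>i\<close>.
\<close>

definition is_pred :: "'i rel \<Rightarrow> 'i \<Rightarrow> 'i \<Rightarrow> bool" where
  "is_pred r i j \<longleftrightarrow> i \<in> underS r j \<and> (\<forall>k \<in> underS r j. (k, i) \<in> r)"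

definition transfinite_seq ::
  "'u arrows \<Rightarrow> 'i rel \<Rightarrow> ('i \<Rightarrow> 'u bisset) \<Rightarrow> ('i \<Rightarrow> 'i \<Rightarrow> ('u, 'u) bmap) \<Rightarrow> bool" where
  "transfinite_seq S r D \<phi> \<longleftrightarrow>
     Well_order r \<and>
     (\<forall>i \<in> Field r. bisimplicial_set (D i) \<and> \<phi> i i = bid (D i)) \<and>
     (\<forall>i j. (i, j) \<in> r \<longrightarrow> \<phi> i j \<in> bihom (D i) (D j)) \<and>
     (\<forall>i j k. (i, j) \<in> r \<longrightarrow> (j, k) \<in> r \<longrightarrow> bcomp (D i) (\<phi> j k) (\<phi> i j) = \<phi> i k) \<and>
     (\<forall>i j. j \<in> Field r \<longrightarrow> is_pred r i j \<longrightarrow> S (D i) (D j) (\<phi> i j)) \<and>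
     (\<forall>j \<in> Field r. underS r j \<noteq> {} \<longrightarrow> (\<nexists>i. is_pred r i j) \<longrightarrow>
        is_colimit (underS r j) r D \<phi> (D j) (\<lambda>i. \<phi> i j))"

definition closed_transfinite :: "'u arrows \<Rightarrow> bool" where
  "closed_transfinite S \<longleftrightarrow>
     (\<forall>(r :: 'u rel) D \<phi> z C c.
        transfinite_seq S r D \<phi> \<longrightarrow> z \<in> Field r \<longrightarrow> underS r z = {} \<longrightarrow>
        is_colimit (Field r) r D \<phi> C c \<longrightarrow> S (D z) C (c z))"

definition saturated :: "'u arrows \<Rightarrow> bool" where
  "saturated S \<longleftrightarrow>
     (\<forall>A B f. S A B f \<longrightarrow> bisimplicial_set A \<and> bisimplicial_set B \<and> f \<in> bihom A B) \<and>
     closed_iso S \<and> closed_pushout S \<and> closed_retract S \<and>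
     closed_coproduct S \<and> closed_transfinite S"

text \<open>
  The generators, as maps in the universe \<open>'u\<close>: all isomorphic copies of the inclusions
  \<open>Horn2 m k n l \<rightarrow> Delta2 m n\<close>
\<close>

definition horn_map :: "'u arrows" where
  "horn_map A B f \<longleftrightarrow>
     bisimplicial_set A \<and> bisimplicial_set B \<and> f \<in> bihom A B \<and>
     (\<exists>m n k l. 1 \<le> m \<and> 1 \<le> n \<and> k \<le> m \<and> l \<le> n \<and>
        (\<exists>a \<in> biso (Horn2 m k n l) A. \<exists>b \<in> biso (Delta2 m n) B.
           bcomp (Horn2 m k n l) f a = brestr (Horn2 m k n l) b))"

text \<open>Monomorphisms of bisimplicial sets are the levelwise injective maps.\<close>

definition mono_bmap :: "'a bisset \<Rightarrow> ('a, 'b) bmap \<Rightarrow> bool" where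
  "mono_bmap A f \<longleftrightarrow> (\<forall>m n. inj_on (f m n) (cells A m n))"

definition anodyne :: "'u arrows" where
  "anodyne A B f \<longleftrightarrow>
     mono_bmap A f \<and>
     (\<forall>S. saturated S \<longrightarrow> (\<forall>A' B' f'. horn_map A' B' f' \<longrightarrow> S A' B' f') \<longrightarrow> S A B f)"

definition fibration :: "'u itself \<Rightarrow> 'a bisset \<Rightarrow> 'b bisset \<Rightarrow> ('a, 'b) bmap \<Rightarrow> bool" where
  "fibration U X Y p \<longleftrightarrow>
     p \<in> bihom X Y \<and>
     (\<forall>(A :: 'u bisset) B f u v.
        anodyne A B f \<longrightarrow> u \<in> bihom A X \<longrightarrow> v \<in> bihom B Y \<longrightarrow>
        bcomp A p u = bcomp A v f \<longrightarrow>
        (\<exists>w \<in> bihom B X. bcomp A w f = u \<and> bcomp B p w = v))"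

definition fibrant :: "'u itself \<Rightarrow> 'a bisset \<Rightarrow> bool" where
  "fibrant U X \<longleftrightarrow> fibration U X (Delta2 0 0) (to_point X)"


section \<open>Faces and degeneracies of bisimplices, and homotopies\<close>

text \<open>
  The maps of standard bisimplices induced by \<open>f : [m'] \<rightarrow> [m]\<close> and \<open>g : [n'] \<rightarrow> [n]\<close>;
  \<open>m'\<close> and \<open>n'\<close> are the arguments of \<open>std_map\<close>.
\<close>

definition std_map :: "nat \<Rightarrow> nat \<Rightarrow> (nat \<Rightarrow> nat) \<Rightarrow> (nat \<Rightarrow> nat) \<Rightarrow> (bisimplex, bisimplex) bmap" where
  "std_map m' n' f g = (\<lambda>p q. \<lambda>x \<in> cells (Delta2 m' n') p q. map_prod (map f) (map g) x)"

text \<open>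
  For \<open>\<theta> : Delta2 m n \<rightarrow> X\<close>, the maps $d_i\theta$, $s_i\theta$, $\overline d_j\theta$,
  $\overline s_j\theta$ correspond under the Yoneda identification to the operators of
  \<open>X\<close>; the faces are meaningful for $m \geq 1$, respectively $n \geq 1$.
\<close>

definition d_map :: "nat \<Rightarrow> nat \<Rightarrow> nat \<Rightarrow> (bisimplex, 'a) bmap \<Rightarrow> (bisimplex, 'a) bmap" where
  "d_map m n i \<theta> = bcomp (Delta2 (m - 1) n) \<theta> (std_map (m - 1) n (coface i) id)"

definition s_map :: "nat \<Rightarrow> nat \<Rightarrow> nat \<Rightarrow> (bisimplex, 'a) bmap \<Rightarrow> (bisimplex, 'a) bmap" where
  "s_map m n i \<theta> = bcomp (Delta2 (Suc m) n) \<theta> (std_map (Suc m) n (codegen i) id)"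

definition dbar_map :: "nat \<Rightarrow> nat \<Rightarrow> nat \<Rightarrow> (bisimplex, 'a) bmap \<Rightarrow> (bisimplex, 'a) bmap" where
  "dbar_map m n j \<theta> = bcomp (Delta2 m (n - 1)) \<theta> (std_map m (n - 1) id (coface j))"

definition sbar_map :: "nat \<Rightarrow> nat \<Rightarrow> nat \<Rightarrow> (bisimplex, 'a) bmap \<Rightarrow> (bisimplex, 'a) bmap" where
  "sbar_map m n j \<theta> = bcomp (Delta2 m (Suc n)) \<theta> (std_map m (Suc n) id (codegen j))"

text \<open>The hatted faces of a map \<open>h : bprod K (Delta2 p q) \<rightarrow> X\<close>\<close>

definition id_times :: "'k bisset \<Rightarrow> 'b bisset \<Rightarrow> ('b, 'c) bmap \<Rightarrow> ('k \<times> 'b, 'k \<times> 'c) bmap" where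
  "id_times K B f = (\<lambda>m n. \<lambda>x \<in> cells (bprod K B) m n. apsnd (f m n) x)"

definition hat_d ::
  "'k bisset \<Rightarrow> nat \<Rightarrow> nat \<Rightarrow> nat \<Rightarrow> ('k \<times> bisimplex, 'a) bmap \<Rightarrow> ('k \<times> bisimplex, 'a) bmap" where
  "hat_d K p q i h =
     bcomp (bprod K (Delta2 (p - 1) q)) h
       (id_times K (Delta2 (p - 1) q) (std_map (p - 1) q (coface i) id))"

definition hat_dbar ::
  "'k bisset \<Rightarrow> nat \<Rightarrow> nat \<Rightarrow> nat \<Rightarrow> ('k \<times> bisimplex, 'a) bmap \<Rightarrow> ('k \<times> bisimplex, 'a) bmap" where
  "hat_dbar K p q j h =
     bcomp (bprod K (Delta2 p (q - 1))) h
       (id_times K (Delta2 p (q - 1)) (std_map p (q - 1) id (coface j)))"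

text \<open>
  \<open>\<alpha> : K \<rightarrow> X\<close> composed with the projection of \<open>bprod K (Delta2 p q)\<close> to \<open>K\<close>.  For
  \<open>p = q = 0\<close> the projection is the canonical isomorphism by which these two objects are
  identified.
\<close>

definition on_cylinder ::
  "'k bisset \<Rightarrow> nat \<Rightarrow> nat \<Rightarrow> ('k, 'a) bmap \<Rightarrow> ('k \<times> bisimplex, 'a) bmap" where
  "on_cylinder K p q \<alpha> =
     bcomp (bprod K (Delta2 p q)) \<alpha> (\<lambda>m n. \<lambda>x \<in> cells (bprod K (Delta2 p q)) m n. fst x)"

definition is_homotopy ::
  "'a bisset \<Rightarrow> 'k bisset \<Rightarrow> ('k, 'a) bmap \<Rightarrow> ('k, 'a) bmap \<Rightarrow> ('k \<times> bisimplex, 'a) bmap \<Rightarrow> bool" where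
  "is_homotopy X K \<alpha> \<beta> h \<longleftrightarrow>
     h \<in> bihom (bprod K (Delta2 1 1)) X \<and>
     hat_d K 1 1 0 h = on_cylinder K 0 1 \<alpha> \<and>
     hat_dbar K 1 1 0 h = on_cylinder K 1 0 \<alpha> \<and>
     hat_d K 1 0 1 (hat_dbar K 1 1 1 h) = on_cylinder K 0 0 \<beta>"

definition rel_maps ::
  "'a bisset \<Rightarrow> (bisimplex, 'a) bmap \<Rightarrow> 'k bisset \<Rightarrow> 'k bisset \<Rightarrow> ('k, 'a) bmap set" where
  "rel_maps X pt K L = {\<alpha> \<in> bihom K X. brestr L \<alpha> = const_map pt L}"

definition homotopy_rel ::
  "'a bisset \<Rightarrow> (bisimplex, 'a) bmap \<Rightarrow> 'k bisset \<Rightarrow> 'k bisset \<Rightarrow> ('k, 'a) bmap rel" where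
  "homotopy_rel X pt K L =
     {(\<alpha>, \<beta>). \<alpha> \<in> rel_maps X pt K L \<and> \<beta> \<in> rel_maps X pt K L \<and>
        (\<exists>h. is_homotopy X K \<alpha> \<beta> h \<and>
             brestr (bprod L (Delta2 1 1)) h = const_map pt (bprod L (Delta2 1 1)))}"


section \<open>The Aeppli homotopy set and the Aeppli product\<close>

definition aeppli_maps ::
  "'a bisset \<Rightarrow> (bisimplex, 'a) bmap \<Rightarrow> nat \<Rightarrow> nat \<Rightarrow> (bisimplex, 'a) bmap set" where
  "aeppli_maps X pt m n = rel_maps X pt (Delta2 m n) (delta_A m n)"

definition aeppli_rel ::
  "'a bisset \<Rightarrow> (bisimplex, 'a) bmap \<Rightarrow> nat \<Rightarrow> nat \<Rightarrow> (bisimplex, 'a) bmap rel" where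
  "aeppli_rel X pt m n = homotopy_rel X pt (Delta2 m n) (delta_A m n)"

definition aeppli_pi ::
  "'a bisset \<Rightarrow> (bisimplex, 'a) bmap \<Rightarrow> nat \<Rightarrow> nat \<Rightarrow> (bisimplex, 'a) bmap set set" where
  "aeppli_pi X pt m n = aeppli_maps X pt m n // aeppli_rel X pt m n"

definition aeppli_filler ::
  "'a bisset \<Rightarrow> (bisimplex, 'a) bmap \<Rightarrow> nat \<Rightarrow> nat \<Rightarrow>
   (bisimplex, 'a) bmap \<Rightarrow> (bisimplex, 'a) bmap \<Rightarrow> (bisimplex, 'a) bmap \<Rightarrow> bool" where
  "aeppli_filler X pt m n \<alpha> \<beta> \<theta> \<longleftrightarrow>
     \<theta> \<in> bihom (Delta2 (m + 1) (n + 1)) X \<and>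
     (\<forall>i < m - 1. d_map (m + 1) (n + 1) i \<theta> = const_map pt (Delta2 m (n + 1))) \<and>
     (\<forall>j < n - 1. dbar_map (m + 1) (n + 1) j \<theta> = const_map pt (Delta2 (m + 1) n)) \<and>
     d_map (m + 1) (n + 1) (m - 1) \<theta> = sbar_map m n (n - 1) \<alpha> \<and>
     dbar_map (m + 1) (n + 1) (n - 1) \<theta> = s_map m n (m - 1) \<alpha> \<and>
     d_map (m + 1) n (m + 1) (dbar_map (m + 1) (n + 1) (n + 1) \<theta>) = \<beta>"

text \<open>
  The product of two classes is the union of the classes $[d_m \overline d_n \theta]$ over
  all choices of representatives and of \<open>\<theta>\<close>.  When homotopy is an equivalence
  relation, this is a single class exactly if the class $[d_m \overline d_n \theta]$ exists and
  does not depend on the choices; so well-definedness is not built into the definition.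
\<close>

definition aeppli_prod ::
  "'a bisset \<Rightarrow> (bisimplex, 'a) bmap \<Rightarrow> nat \<Rightarrow> nat \<Rightarrow>
   (bisimplex, 'a) bmap set \<Rightarrow> (bisimplex, 'a) bmap set \<Rightarrow> (bisimplex, 'a) bmap set" where
  "aeppli_prod X pt m n a b =
     (\<Union>\<alpha> \<in> a. \<Union>\<beta> \<in> b. \<Union>\<theta> \<in> {\<theta>. aeppli_filler X pt m n \<alpha> \<beta> \<theta>}.
        aeppli_rel X pt m n `` {d_map (m + 1) n m (dbar_map (m + 1) (n + 1) n \<theta>)})"

end

theory Submission
  imports Defs "HOL-Library.Countable"
begin

text \<open>
  Write $m = a + 1$ and $n = b + 1$.  A map rel $\delta_{\mathrm A}\Delta^{m,n}$ is a cell
  $\alpha \in X_{m,n}$ whose faces are trivial except $d_m\alpha$ and $\overline d_n\alpha$,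
  whose common corner $d_m\overline d_n\alpha$ is trivial.  Fibrancy says that matching
  families of all horizontal faces but one and of all vertical faces but one bound a cell; the
  whole argument consists of such fillings.

  Splitting the product.  For a filler $\theta$ of the product of $\alpha$ and $\beta$ put
  $\mu = \overline d_{n+1}\theta$, $\nu = d_m\theta$ and $\delta = d_m\mu$.  Then $\mu$ is a
  horizontal triangle that transports $\beta$ along $t = \overline d_n\alpha$ to $\delta$, which is a
  vertical path starting at $t$, and $\nu$ is a vertical triangle that concatenates $\alpha$ and
  $\delta$.  Conversely $\mu$ and $\nu$ determine a filler (\<open>aprodI\<close>,
  \<open>aprodE\<close>).  For $\alpha = *$ the two triangles are a horizontal and a vertical homotopy with
  all faces but the obvious ones trivial.  So the relation $\beta \sim \epsilon$, meaning that
  $\epsilon$ is a product of $*$ and $\beta$, is a horizontal homotopy followed by a vertical one; since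
  the product is symmetric in the two directions, the order of the two does not matter.

  Uniqueness and associativity.  Tetrahedra in one direction, together with one mixed filling,
  show that two products of $\alpha$ and $\beta$ are related by $\sim$
  (\<open>aprod_unique\<close>).  Hence $\sim$ is an equivalence relation, and the product respects it
  in each variable, because each of the two kinds of homotopy can be absorbed by a tetrahedron.
  Associativity (\<open>aprod_assoc\<close>) is associativity of vertical concatenation together with
  the fact that transport is compatible with concatenation and with iteration.  The units and the right
  inverses come from a degenerate filler and from the horns in which another face is missing.

  Prism homotopies.  It remains to identify $\sim$ with homotopy rel
  $\delta_{\mathrm A}\Delta^{m,n}$.  If $\beta$ is a product of $\alpha$ and $*$, with filler
  $\theta$, then composing $\theta$ with a collapse
  $\Delta^m \times \Delta^1 \to \Delta^{m+1}$ in both directions gives a homotopy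
  (\<open>homotopy_of_filler\<close>).  Conversely the maximal chains of the two prisms cut a homotopy into
  cells, and these form a path of relative cells from $\alpha$ to $\beta$
  (\<open>aeq_of_prism\<close>).  Consecutive cells of this path differ by a cell in the prism over
  $d_n\Delta^n$, which is contracted along a second chain of cells by
  \<open>homotopic_to_const_chain\<close>.

  The maps $\Delta^{m,n} \to X$ themselves serve as cells, so that all simplicial identities
  come from those of the cofaces and codegeneracies.
\<close>

section \<open>Cells with bihorn fillers\<close>

text \<open>
  The cells of a pointed bisimplicial set with fillers for all horns $\Lambda^m_k\Delta^n \cup
  \Delta^m\Lambda^n_l$, $m, n \geq 1$.  The cells of all bidimensions form one set \<open>K\<close>; the
  bidimension of a cell is \<open>(hdim x, vdim x)\<close>, so that the operators \<open>d\<close>,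
  \<open>s\<close> and \<open>db\<close>, \<open>sb\<close> need no dimension arguments.  The dimension
  equations hold for all elements of the type.  The cell \<open>pt m n\<close> is the base point in
  bidimension $(m, n)$.  The identities between two degeneracies are never needed.
\<close>

locale bikan =
  fixes K :: "'c set" and hdim vdim :: "'c \<Rightarrow> nat"
    and d s db sb :: "nat \<Rightarrow> 'c \<Rightarrow> 'c" and pt :: "nat \<Rightarrow> nat \<Rightarrow> 'c"
  assumes hdim_ops [simp]: "\<And>i x. hdim (d i x) = hdim x - 1" "\<And>i x. hdim (s i x) = Suc (hdim x)"
      "\<And>j x. hdim (db j x) = hdim x" "\<And>j x. hdim (sb j x) = hdim x" "\<And>m n. hdim (pt m n) = m"
    and vdim_ops [simp]: "\<And>j x. vdim (db j x) = vdim x - 1" "\<And>j x. vdim (sb j x) = Suc (vdim x)"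
      "\<And>i x. vdim (d i x) = vdim x" "\<And>i x. vdim (s i x) = vdim x" "\<And>m n. vdim (pt m n) = n"
    and d_in [simp]: "\<And>i x. x \<in> K \<Longrightarrow> 0 < hdim x \<Longrightarrow> i \<le> hdim x \<Longrightarrow> d i x \<in> K"
    and db_in [simp]: "\<And>j x. x \<in> K \<Longrightarrow> 0 < vdim x \<Longrightarrow> j \<le> vdim x \<Longrightarrow> db j x \<in> K"
    and s_in [simp]: "\<And>i x. x \<in> K \<Longrightarrow> i \<le> hdim x \<Longrightarrow> s i x \<in> K"
    and sb_in [simp]: "\<And>j x. x \<in> K \<Longrightarrow> j \<le> vdim x \<Longrightarrow> sb j x \<in> K"
    and pt_in [simp]: "\<And>m n. pt m n \<in> K"
    and d_d: "\<And>i j x. x \<in> K \<Longrightarrow> i < j \<Longrightarrow> j \<le> hdim x \<Longrightarrow> 2 \<le> hdim x \<Longrightarrow>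
        d i (d j x) = d (j - 1) (d i x)"
    and db_db: "\<And>i j x. x \<in> K \<Longrightarrow> i < j \<Longrightarrow> j \<le> vdim x \<Longrightarrow> 2 \<le> vdim x \<Longrightarrow>
        db i (db j x) = db (j - 1) (db i x)"
    and d_s_less: "\<And>i j x. x \<in> K \<Longrightarrow> i < j \<Longrightarrow> j \<le> hdim x \<Longrightarrow> d i (s j x) = s (j - 1) (d i x)"
    and d_s_same [simp]: "\<And>i x. x \<in> K \<Longrightarrow> i \<le> hdim x \<Longrightarrow> d i (s i x) = x"
    and d_s_Suc [simp]: "\<And>i x. x \<in> K \<Longrightarrow> i \<le> hdim x \<Longrightarrow> d (Suc i) (s i x) = x"
    and d_s_greater: "\<And>i j x. x \<in> K \<Longrightarrow> Suc j < i \<Longrightarrow> i \<le> Suc (hdim x) \<Longrightarrow>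
        d i (s j x) = s j (d (i - 1) x)"
    and db_sb_less: "\<And>i j x. x \<in> K \<Longrightarrow> i < j \<Longrightarrow> j \<le> vdim x \<Longrightarrow> db i (sb j x) = sb (j - 1) (db i x)"
    and db_sb_same [simp]: "\<And>i x. x \<in> K \<Longrightarrow> i \<le> vdim x \<Longrightarrow> db i (sb i x) = x"
    and db_sb_Suc [simp]: "\<And>i x. x \<in> K \<Longrightarrow> i \<le> vdim x \<Longrightarrow> db (Suc i) (sb i x) = x"
    and db_sb_greater: "\<And>i j x. x \<in> K \<Longrightarrow> Suc j < i \<Longrightarrow> i \<le> Suc (vdim x) \<Longrightarrow>
        db i (sb j x) = sb j (db (i - 1) x)"
    and db_d: "\<And>i j x. x \<in> K \<Longrightarrow> 0 < hdim x \<Longrightarrow> 0 < vdim x \<Longrightarrow> i \<le> hdim x \<Longrightarrow> j \<le> vdim x \<Longrightarrow>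
        db j (d i x) = d i (db j x)"
    and d_sb [simp]: "\<And>i j x. x \<in> K \<Longrightarrow> 0 < hdim x \<Longrightarrow> i \<le> hdim x \<Longrightarrow> j \<le> vdim x \<Longrightarrow>
        d i (sb j x) = sb j (d i x)"
    and db_s [simp]: "\<And>i j x. x \<in> K \<Longrightarrow> 0 < vdim x \<Longrightarrow> i \<le> hdim x \<Longrightarrow> j \<le> vdim x \<Longrightarrow>
        db j (s i x) = s i (db j x)"
    and d_pt [simp]: "\<And>i m n. 0 < m \<Longrightarrow> i \<le> m \<Longrightarrow> d i (pt m n) = pt (m - 1) n"
    and db_pt [simp]: "\<And>j m n. 0 < n \<Longrightarrow> j \<le> n \<Longrightarrow> db j (pt m n) = pt m (n - 1)"
    and s_pt [simp]: "\<And>i m n. i \<le> m \<Longrightarrow> s i (pt m n) = pt (Suc m) n"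
    and sb_pt [simp]: "\<And>j m n. j \<le> n \<Longrightarrow> sb j (pt m n) = pt m (Suc n)"
    and horn: "\<And>m n k l x y. \<lbrakk>0 < m; 0 < n; k \<le> m; l \<le> n;
        \<And>i. i \<le> m \<Longrightarrow> i \<noteq> k \<Longrightarrow> x i \<in> K \<and> hdim (x i) = m - 1 \<and> vdim (x i) = n;
        \<And>j. j \<le> n \<Longrightarrow> j \<noteq> l \<Longrightarrow> y j \<in> K \<and> hdim (y j) = m \<and> vdim (y j) = n - 1;
        \<And>i i'. i < i' \<Longrightarrow> i' \<le> m \<Longrightarrow> i \<noteq> k \<Longrightarrow> i' \<noteq> k \<Longrightarrow> d i (x i') = d (i' - 1) (x i);
        \<And>j j'. j < j' \<Longrightarrow> j' \<le> n \<Longrightarrow> j \<noteq> l \<Longrightarrow> j' \<noteq> l \<Longrightarrow> db j (y j') = db (j' - 1) (y j);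
        \<And>i j. i \<le> m \<Longrightarrow> j \<le> n \<Longrightarrow> i \<noteq> k \<Longrightarrow> j \<noteq> l \<Longrightarrow> db j (x i) = d i (y j)\<rbrakk>
        \<Longrightarrow> \<exists>z. z \<in> K \<and> hdim z = m \<and> vdim z = n \<and>
              (\<forall>i\<le>m. i \<noteq> k \<longrightarrow> d i z = x i) \<and> (\<forall>j\<le>n. j \<noteq> l \<longrightarrow> db j z = y j)"
begin

text \<open>
  The two directions play symmetric roles.  In the contexts below the prefix \<open>T\<close> marks the
  notions and facts for the transposed structure.
\<close>

lemma transpose: "bikan K vdim hdim db sb d s (\<lambda>m n. pt n m)"
proof (unfold_locales, goal_cases)
  case (33 m n k l x y)
  have "\<exists>z. z \<in> K \<and> hdim z = n \<and> vdim z = m \<and>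
              (\<forall>i\<le>n. i \<noteq> l \<longrightarrow> d i z = y i) \<and> (\<forall>j\<le>m. j \<noteq> k \<longrightarrow> db j z = x j)"
    by (rule horn) (use 33 in auto)
  then show ?case by blast
qed (simp_all add: d_d db_db d_s_less db_sb_less d_s_greater db_sb_greater db_d)

text \<open>
  The cell \<open>z\<close> has the horizontal faces \<open>x i\<close>, $i \in I$, and the vertical faces
  \<open>y j\<close>, $j \in J$; of its other faces only $d_k$ and $\overline d_l$ may be nontrivial.
\<close>

definition fills where
  "fills m n k l I x J y z \<longleftrightarrow> z \<in> K \<and> hdim z = m \<and> vdim z = n \<and>
     (\<forall>i\<in>I. d i z = x i) \<and> (\<forall>j\<in>J. db j z = y j) \<and>
     (\<forall>i\<le>m. i \<noteq> k \<longrightarrow> i \<notin> I \<longrightarrow> d i z = pt (m - 1) n) \<and>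
     (\<forall>j\<le>n. j \<noteq> l \<longrightarrow> j \<notin> J \<longrightarrow> db j z = pt m (n - 1))"

text \<open>
  Horn filling when only the faces with indices in \<open>I\<close> and \<open>J\<close> are nontrivial: it suffices
  to match these with each other and to check that their remaining faces are trivial.
\<close>

lemma sparse_horn:
  assumes "0 < m" "0 < n" "k \<le> m" "l \<le> n" "k \<notin> I" "l \<notin> J"
    and x: "\<And>i. i \<in> I \<Longrightarrow> i \<le> m \<and> x i \<in> K \<and> hdim (x i) = m - 1 \<and> vdim (x i) = n"
    and y: "\<And>j. j \<in> J \<Longrightarrow> j \<le> n \<and> y j \<in> K \<and> hdim (y j) = m \<and> vdim (y j) = n - 1"
    and x0: "\<And>i i'. i \<in> I \<Longrightarrow> i' \<notin> I \<Longrightarrow> i' \<noteq> k \<Longrightarrow> i' < i \<Longrightarrow> d i' (x i) = pt (m - 2) n"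
    and x0': "\<And>i i'. i \<in> I \<Longrightarrow> Suc i' \<notin> I \<Longrightarrow> Suc i' \<noteq> k \<Longrightarrow> i \<le> i' \<Longrightarrow> Suc i' \<le> m \<Longrightarrow>
        d i' (x i) = pt (m - 2) n"
    and y0: "\<And>j j'. j \<in> J \<Longrightarrow> j' \<notin> J \<Longrightarrow> j' \<noteq> l \<Longrightarrow> j' < j \<Longrightarrow> db j' (y j) = pt m (n - 2)"
    and y0': "\<And>j j'. j \<in> J \<Longrightarrow> Suc j' \<notin> J \<Longrightarrow> Suc j' \<noteq> l \<Longrightarrow> j \<le> j' \<Longrightarrow> Suc j' \<le> n \<Longrightarrow>
        db j' (y j) = pt m (n - 2)"
    and x1: "\<And>i i'. i \<in> I \<Longrightarrow> i' \<in> I \<Longrightarrow> i < i' \<Longrightarrow> d i (x i') = d (i' - 1) (x i)"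
    and y1: "\<And>j j'. j \<in> J \<Longrightarrow> j' \<in> J \<Longrightarrow> j < j' \<Longrightarrow> db j (y j') = db (j' - 1) (y j)"
    and x2: "\<And>i j. i \<in> I \<Longrightarrow> j \<notin> J \<Longrightarrow> j \<noteq> l \<Longrightarrow> j \<le> n \<Longrightarrow> db j (x i) = pt (m - 1) (n - 1)"
    and y2: "\<And>i j. j \<in> J \<Longrightarrow> i \<notin> I \<Longrightarrow> i \<noteq> k \<Longrightarrow> i \<le> m \<Longrightarrow> d i (y j) = pt (m - 1) (n - 1)"
    and xy: "\<And>i j. i \<in> I \<Longrightarrow> j \<in> J \<Longrightarrow> db j (x i) = d i (y j)"
  shows "\<exists>z. fills m n k l I x J y z"
proof -
  define x' where "x' i = (if i \<in> I then x i else pt (m - 1) n)" for i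
  define y' where "y' j = (if j \<in> J then y j else pt m (n - 1))" for j
  have "\<exists>z. z \<in> K \<and> hdim z = m \<and> vdim z = n \<and>
              (\<forall>i\<le>m. i \<noteq> k \<longrightarrow> d i z = x' i) \<and> (\<forall>j\<le>n. j \<noteq> l \<longrightarrow> db j z = y' j)"
  proof (rule horn)
    fix i i' assume ii: "i < i'" "i' \<le> m" "i \<noteq> k" "i' \<noteq> k"
    then have "2 \<le> m" using \<open>k \<le> m\<close> by arith
    show "d i (x' i') = d (i' - 1) (x' i)"
      using ii x1[of i i'] x0'[of i "i' - 1"] x0[of i' i] \<open>2 \<le> m\<close>
      by (auto simp: x'_def numeral_2_eq_2)
  next
    fix j j' assume jj: "j < j'" "j' \<le> n" "j \<noteq> l" "j' \<noteq> l"
    then have "2 \<le> n" using \<open>l \<le> n\<close> by arith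
    show "db j (y' j') = db (j' - 1) (y' j)"
      using jj y1[of j j'] y0'[of j "j' - 1"] y0[of j' j] \<open>2 \<le> n\<close>
      by (auto simp: y'_def numeral_2_eq_2)
  next
    fix i j assume ij: "i \<le> m" "j \<le> n" "i \<noteq> k" "j \<noteq> l"
    then show "db j (x' i) = d i (y' j)"
      using xy[of i j] x2[of i j] y2[of j i] assms(1-2) by (auto simp: x'_def y'_def)
  qed (use assms in \<open>auto simp: x'_def y'_def\<close>)
  then obtain z where z: "z \<in> K" "hdim z = m" "vdim z = n"
    "\<And>i. i\<le>m \<Longrightarrow> i \<noteq> k \<Longrightarrow> d i z = x' i" "\<And>j. j\<le>n \<Longrightarrow> j \<noteq> l \<Longrightarrow> db j z = y' j" by blast
  have x'': "d i z = x i" if "i \<in> I" for i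
    using z(4)[of i] x[OF that] that \<open>k \<notin> I\<close> by (auto simp: x'_def)
  have y'': "db j z = y j" if "j \<in> J" for j
    using z(5)[of j] y[OF that] that \<open>l \<notin> J\<close> by (auto simp: y'_def)
  show ?thesis
    unfolding fills_def using z x'' y'' by (auto simp: x'_def y'_def)
qed

section \<open>Triangles and tetrahedra in one direction\<close>

text \<open>
  A horizontal triangle at position \<open>k\<close>: a cell \<open>w\<close> of bidimension $(m+1, n+1)$ with
  $d_k w = p$, $d_{k+1} w = q$, $d_{k+2} w = r$ and all other horizontal faces trivial.  In the
  vertical direction $\overline d_l w = g$, the face $\overline d_{l+1} w$ is free and the others
  are trivial.
\<close>

definition tri :: "nat \<Rightarrow> nat \<Rightarrow> nat \<Rightarrow> nat \<Rightarrow> 'c \<Rightarrow> 'c \<Rightarrow> 'c \<Rightarrow> 'c \<Rightarrow> 'c \<Rightarrow> bool" where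
  "tri k l m n w p q r g \<longleftrightarrow>
     k < m \<and> l \<le> n \<and> w \<in> K \<and> hdim w = Suc m \<and> vdim w = Suc n \<and>
     d k w = p \<and> d (Suc k) w = q \<and> d (Suc (Suc k)) w = r \<and> db l w = g \<and>
     (\<forall>i<k. d i w = pt m (Suc n)) \<and> (\<forall>i>k + 2. i \<le> Suc m \<longrightarrow> d i w = pt m (Suc n)) \<and>
     (\<forall>j<l. db j w = pt (Suc m) n) \<and> (\<forall>j>l + 1. j \<le> Suc n \<longrightarrow> db j w = pt (Suc m) n)"

text \<open>
  The vertical face $\overline d_l$ of a tetrahedron at position \<open>k\<close>: its four nontrivial
  horizontal faces are the $\overline d_l$-faces of the four triangles that bound the
  tetrahedron.
\<close>

definition tet :: "nat \<Rightarrow> nat \<Rightarrow> nat \<Rightarrow> nat \<Rightarrow> 'c \<Rightarrow> 'c \<Rightarrow> 'c \<Rightarrow> 'c \<Rightarrow> 'c \<Rightarrow> bool" where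
  "tet k l m n t g0 g1 g2 g3 \<longleftrightarrow>
     t \<in> K \<and> hdim t = Suc (Suc m) \<and> vdim t = n \<and>
     d k t = g0 \<and> d (Suc k) t = g1 \<and> d (Suc (Suc k)) t = g2 \<and> d (Suc (Suc (Suc k))) t = g3 \<and>
     (\<forall>i<k. d i t = pt (Suc m) n) \<and>
     (\<forall>i>k + 3. i \<le> Suc (Suc m) \<longrightarrow> d i t = pt (Suc m) n) \<and>
     (\<forall>j<l. db j t = pt (Suc (Suc m)) (n - 1)) \<and>
     (\<forall>j>l. j \<le> n \<longrightarrow> db j t = pt (Suc (Suc m)) (n - 1))"

lemma d_below: "z \<in> K \<Longrightarrow> i < c \<Longrightarrow> c \<le> hdim z \<Longrightarrow> 2 \<le> hdim z \<Longrightarrow> d i (d c z) = d (c - 1) (d i z)"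
  by (rule d_d)

lemma d_above: "z \<in> K \<Longrightarrow> c \<le> i \<Longrightarrow> Suc i \<le> hdim z \<Longrightarrow> 2 \<le> hdim z \<Longrightarrow> d i (d c z) = d c (d (Suc i) z)"
  using d_d[of z c "Suc i"] by simp

lemma db_below: "z \<in> K \<Longrightarrow> i < c \<Longrightarrow> c \<le> vdim z \<Longrightarrow> 2 \<le> vdim z \<Longrightarrow> db i (db c z) = db (c - 1) (db i z)"
  by (rule db_db)

lemma db_above: "z \<in> K \<Longrightarrow> c \<le> i \<Longrightarrow> Suc i \<le> vdim z \<Longrightarrow> 2 \<le> vdim z \<Longrightarrow> db i (db c z) = db c (db (Suc i) z)"
  using db_db[of z c "Suc i"] by simp

lemma triD:
  assumes "tri k l m n w p q r g"
  shows "w \<in> K" "hdim w = Suc m" "vdim w = Suc n"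
    "d k w = p" "d (Suc k) w = q" "d (Suc (Suc k)) w = r" "db l w = g"
    "\<And>i. i < k \<Longrightarrow> d i w = pt m (Suc n)"
    "\<And>i. k + 2 < i \<Longrightarrow> i \<le> Suc m \<Longrightarrow> d i w = pt m (Suc n)"
    "\<And>j. j < l \<Longrightarrow> db j w = pt (Suc m) n"
    "\<And>j. l + 1 < j \<Longrightarrow> j \<le> Suc n \<Longrightarrow> db j w = pt (Suc m) n"
  using assms unfolding tri_def by auto

lemma tri_bounds:
  assumes "tri k l m n w p q r g"
  shows "k < m" "l \<le> n"
  using assms unfolding tri_def by auto

text \<open>
  The four triangles of a tetrahedron have the faces $(p,q,r)$, $(p,e,f)$, $(q,e,u)$, $(r,f,u)$.
  When the second or the third of them is missing, it can be constructed.
\<close>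

lemma tetrahedron1:
  assumes w0: "tri k l m n w0 p q r g0" and w2: "tri k l m n w2 q e u g2"
    and w3: "tri k l m n w3 r f u g3" and t: "tet k l m n t g0 g1 g2 g3"
  obtains w1 where "tri k l m n w1 p e f g1"
proof -
  let ?I = "{k, Suc (Suc k), Suc (Suc (Suc k))}"
  let ?x = "\<lambda>i. if i = k then w0 else if i = Suc (Suc k) then w2 else w3"
  note F = triD[OF w0] triD[OF w2] triD[OF w3] t[unfolded tet_def]
  note kl = tri_bounds[OF w0]
  have "\<exists>z. fills (Suc (Suc m)) (Suc n) (Suc k) (Suc l) ?I ?x {l} (\<lambda>_. t) z"
  proof (rule sparse_horn, goal_cases)
    case (9 i i')
    then have "i' < k" by force
    with 9 show ?case using kl by (auto simp: F)
  next
    case (10 i i')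
    then have "k + 3 \<le> i'" by force
    with 10 show ?case using kl by (auto simp: F)
  next
    case (11 j j')
    with 11 show ?case using kl by (auto simp: F)
  next
    case (12 j j')
    with 12 show ?case using kl by (auto simp: F)
  next
    case (13 i i')
    then show ?case using kl by (auto simp: F)
  next
    case (15 i j)
    then have "j < l \<or> l + 1 < j" by force
    with 15 show ?case using kl by (auto simp: F)
  next
    case (16 i j)
    then have "i < k \<or> k + 3 < i" by force
    with 16 show ?case using kl by (auto simp: F)
  next
    case (17 i j)
    then show ?case using kl by (auto simp: F)
  next
    case (7 i)
    then show ?case using kl by (auto simp: F)
  qed (use kl in \<open>simp_all add: F\<close>)
  then obtain z where "fills (Suc (Suc m)) (Suc n) (Suc k) (Suc l) ?I ?x {l} (\<lambda>_. t) z" ..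
  note z = this[unfolded fills_def]
  have "tri k l m n (d (Suc k) z) p e f g1"
    unfolding tri_def using kl
    by (simp add: z F d_below[of z _ "Suc k"] d_above[of z "Suc k"] db_d[of z])
  then show thesis ..
qed

lemma tetrahedron2:
  assumes w0: "tri k l m n w0 p q r g0" and w1: "tri k l m n w1 p e f g1"
    and w3: "tri k l m n w3 r f u g3" and t: "tet k l m n t g0 g1 g2 g3"
  obtains w2 where "tri k l m n w2 q e u g2"
proof -
  let ?I = "{k, Suc k, Suc (Suc (Suc k))}"
  let ?x = "\<lambda>i. if i = k then w0 else if i = Suc k then w1 else w3"
  note F = triD[OF w0] triD[OF w1] triD[OF w3] t[unfolded tet_def]
  note kl = tri_bounds[OF w0]
  have "\<exists>z. fills (Suc (Suc m)) (Suc n) (Suc (Suc k)) (Suc l) ?I ?x {l} (\<lambda>_. t) z"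
  proof (rule sparse_horn, goal_cases)
    case (9 i i')
    then have "i' < k" by force
    with 9 show ?case using kl by (auto simp: F)
  next
    case (10 i i')
    then have "k + 3 \<le> i'" by force
    with 10 show ?case using kl by (auto simp: F)
  next
    case (15 i j)
    then have "j < l \<or> l + 1 < j" by force
    with 15 show ?case using kl by (auto simp: F)
  next
    case (16 i j)
    then have "i < k \<or> k + 3 < i" by force
    with 16 show ?case using kl by (auto simp: F)
  qed (use kl in \<open>auto simp: F\<close>)
  then obtain z where
    "fills (Suc (Suc m)) (Suc n) (Suc (Suc k)) (Suc l) ?I ?x {l} (\<lambda>_. t) z" ..
  note z = this[unfolded fills_def]
  have "tri k l m n (d (Suc (Suc k)) z) q e u g2"
    unfolding tri_def using kl
    by (simp add: z F d_below[of z _ "Suc (Suc k)"] d_above[of z "Suc (Suc k)"] db_d[of z])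
  then show thesis ..
qed

text \<open>
  Two of the three faces of a triangle at the last position, $k = a$, extend to a triangle.
\<close>

lemma fill_middle:
  assumes p: "p \<in> K" "hdim p = Suc a" "vdim p = Suc b" "db b p = d a g"
      "\<And>i. i < a \<Longrightarrow> d i p = pt a (Suc b)" "\<And>j. j < b \<Longrightarrow> db j p = pt (Suc a) b"
    and r: "r \<in> K" "hdim r = Suc a" "vdim r = Suc b" "db b r = d (Suc (Suc a)) g"
      "\<And>i. i < a \<Longrightarrow> d i r = pt a (Suc b)" "\<And>j. j < b \<Longrightarrow> db j r = pt (Suc a) b"
    and pr: "d a r = d (Suc a) p"
    and g: "g \<in> K" "hdim g = Suc (Suc a)" "vdim g = b"
      "\<And>i. i < a \<Longrightarrow> d i g = pt (Suc a) b" "\<And>j. j < b \<Longrightarrow> db j g = pt (Suc (Suc a)) (b - 1)"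
  obtains w where "tri a b (Suc a) b w p (d (Suc a) w) r g"
proof -
  let ?I = "{a, Suc (Suc a)}"
  let ?x = "\<lambda>i. if i = a then p else r"
  have "\<exists>z. fills (Suc (Suc a)) (Suc b) (Suc a) (Suc b) ?I ?x {b} (\<lambda>_. g) z"
  proof (rule sparse_horn, goal_cases)
    case (9 i i')
    then have "i' < a" by force
    with 9 show ?case by (auto simp: p r)
  qed (auto simp: p r g pr le_Suc_eq)
  then obtain z where "fills (Suc (Suc a)) (Suc b) (Suc a) (Suc b) ?I ?x {b} (\<lambda>_. g) z" ..
  note z = this[unfolded fills_def]
  have "tri a b (Suc a) b z p (d (Suc a) z) r g"
    unfolding tri_def by (simp add: z)
  then show thesis ..
qed

lemma fill_last:
  assumes p: "p \<in> K" "hdim p = Suc a" "vdim p = Suc b" "db b p = d a g"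
      "\<And>i. i < a \<Longrightarrow> d i p = pt a (Suc b)" "\<And>j. j < b \<Longrightarrow> db j p = pt (Suc a) b"
    and q: "q \<in> K" "hdim q = Suc a" "vdim q = Suc b" "db b q = d (Suc a) g"
      "\<And>i. i < a \<Longrightarrow> d i q = pt a (Suc b)" "\<And>j. j < b \<Longrightarrow> db j q = pt (Suc a) b"
    and pq: "d a q = d a p"
    and g: "g \<in> K" "hdim g = Suc (Suc a)" "vdim g = b"
      "\<And>i. i < a \<Longrightarrow> d i g = pt (Suc a) b" "\<And>j. j < b \<Longrightarrow> db j g = pt (Suc (Suc a)) (b - 1)"
  obtains w where "tri a b (Suc a) b w p q (d (Suc (Suc a)) w) g"
proof -
  let ?I = "{a, Suc a}"
  let ?x = "\<lambda>i. if i = a then p else q"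
  have "\<exists>z. fills (Suc (Suc a)) (Suc b) (Suc (Suc a)) (Suc b) ?I ?x {b} (\<lambda>_. g) z"
  proof (rule sparse_horn, goal_cases)
    case (9 i i')
    then have "i' < a" by force
    with 9 show ?case by (auto simp: p q)
  qed (auto simp: p q g pq le_Suc_eq)
  then obtain z where "fills (Suc (Suc a)) (Suc b) (Suc (Suc a)) (Suc b) ?I ?x {b} (\<lambda>_. g) z" ..
  note z = this[unfolded fills_def]
  have "tri a b (Suc a) b z p q (d (Suc (Suc a)) z) g"
    unfolding tri_def by (simp add: z)
  then show thesis ..
qed

text \<open>
  A filling that mixes both directions: two horizontal faces, at \<open>a\<close> and at one of
  $a+1$, $a+2$, and two vertical faces, at \<open>l\<close> and at $b+2$, are given.
\<close>

lemma fill_square: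
  assumes c: "c = Suc a \<and> c' = Suc (Suc a) \<or> c = Suc (Suc a) \<and> c' = Suc a" and l: "l \<le> b"
    and x0: "x0 \<in> K" "hdim x0 = Suc a" "vdim x0 = Suc (Suc b)"
      "\<And>i. i < a \<Longrightarrow> d i x0 = pt a (Suc (Suc b))"
      "\<And>j. j < l \<Longrightarrow> db j x0 = pt (Suc a) (Suc b)"
      "\<And>j. l + 1 < j \<Longrightarrow> j \<le> Suc b \<Longrightarrow> db j x0 = pt (Suc a) (Suc b)"
    and x1: "x1 \<in> K" "hdim x1 = Suc a" "vdim x1 = Suc (Suc b)"
      "\<And>i. i < a \<Longrightarrow> d i x1 = pt a (Suc (Suc b))"
      "\<And>j. j < l \<Longrightarrow> db j x1 = pt (Suc a) (Suc b)"
      "\<And>j. l + 1 < j \<Longrightarrow> j \<le> Suc b \<Longrightarrow> db j x1 = pt (Suc a) (Suc b)"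
    and x01: "d a x1 = d (c - 1) x0"
    and y0: "y0 \<in> K" "hdim y0 = Suc (Suc a)" "vdim y0 = Suc b"
      "\<And>i. i < a \<Longrightarrow> d i y0 = pt (Suc a) (Suc b)"
      "\<And>j. j < l \<Longrightarrow> db j y0 = pt (Suc (Suc a)) b"
      "\<And>j. l < j \<Longrightarrow> j \<le> b \<Longrightarrow> db j y0 = pt (Suc (Suc a)) b"
    and y1: "y1 \<in> K" "hdim y1 = Suc (Suc a)" "vdim y1 = Suc b"
      "\<And>i. i < a \<Longrightarrow> d i y1 = pt (Suc a) (Suc b)"
      "\<And>j. j < l \<Longrightarrow> db j y1 = pt (Suc (Suc a)) b"
      "\<And>j. l + 1 < j \<Longrightarrow> j \<le> Suc b \<Longrightarrow> db j y1 = pt (Suc (Suc a)) b"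
    and y01: "db l y1 = db (Suc b) y0"
    and xy: "db l x0 = d a y0" "db l x1 = d c y0"
      "db (Suc (Suc b)) x0 = d a y1" "db (Suc (Suc b)) x1 = d c y1"
  obtains z where "z \<in> K" "hdim z = Suc (Suc a)" "vdim z = Suc (Suc b)"
    "d a z = x0" "d c z = x1" "db l z = y0" "db (Suc (Suc b)) z = y1"
    "\<And>i. i < a \<Longrightarrow> d i z = pt (Suc a) (Suc (Suc b))"
    "\<And>j. j < l \<Longrightarrow> db j z = pt (Suc (Suc a)) (Suc b)"
    "\<And>j. l + 1 < j \<Longrightarrow> j \<le> Suc b \<Longrightarrow> db j z = pt (Suc (Suc a)) (Suc b)"
proof -
  let ?I = "{a, c}" and ?J = "{l, Suc (Suc b)}"
  let ?x = "\<lambda>i. if i = a then x0 else x1" and ?y = "\<lambda>j. if j = l then y0 else y1"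
  have cc: "a < c" "a < c'" "c \<noteq> c'" "c' \<le> Suc (Suc a)" "c \<le> Suc (Suc a)" using c by auto
  have I: "i < a" if "i \<le> Suc (Suc a)" "i \<notin> ?I" "i \<noteq> c'" for i
    using that c by auto
  have J: "j < l \<or> l + 1 < j \<and> j \<le> Suc b" if "j \<le> Suc (Suc b)" "j \<notin> ?J" "j \<noteq> Suc l" for j
    using that l by auto
  have "\<exists>z. fills (Suc (Suc a)) (Suc (Suc b)) c' (Suc l) ?I ?x ?J ?y z"
  proof (rule sparse_horn, goal_cases)
    case (9 i i')
    then have "i' < a" using I[of i'] cc by auto
    with 9 show ?case using l cc by (auto simp: x0 x1)
  next
    case (10 i i')
    then have "Suc i' < a" using I[of "Suc i'"] by auto
    with 10 show ?case using l cc by (auto simp: x0 x1)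
  next
    case (11 j j')
    then have "j' < l \<or> l + 1 < j' \<and> j' \<le> Suc b" using J[of j'] l by auto
    with 11 show ?case using l by (auto simp: y0 y1)
  next
    case (12 j j')
    then have "Suc j' < l \<or> l + 1 < Suc j' \<and> Suc j' \<le> Suc b" using J[of "Suc j'"] l by auto
    with 12 show ?case using l by (auto simp: y0 y1)
  next
    case (15 i j)
    then have "j < l \<or> l + 1 < j \<and> j \<le> Suc b" using J[of j] by auto
    with 15 show ?case using l by (auto simp: x0 x1)
  next
    case (16 i j)
    then have "i < a" using I[of i] by auto
    with 16 show ?case using l by (auto simp: y0 y1)
  qed (use cc l in \<open>auto simp: x0 x1 y0 y1 x01 y01 xy\<close>)
  then obtain z where z: "fills (Suc (Suc a)) (Suc (Suc b)) c' (Suc l) ?I ?x ?J ?y z" ..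
  show thesis
    by (rule that[of z]) (use z cc l in \<open>auto simp: fills_def\<close>)
qed

end

section \<open>Relative cells and the product relation\<close>

context bikan
begin

text \<open>
  The maps $\Delta^{a+1,b+1} \to X$ rel $\delta_{\mathrm A}\Delta^{a+1,b+1}$.  For such a cell
  \<open>x\<close> the face \<open>db (Suc b) x\<close> is called its target; all faces of the target are trivial.
\<close>

definition rel_cells :: "nat \<Rightarrow> nat \<Rightarrow> 'c set" where
  "rel_cells a b = {x \<in> K. hdim x = Suc a \<and> vdim x = Suc b \<and>
     (\<forall>i\<le>a. d i x = pt a (Suc b)) \<and> (\<forall>j\<le>b. db j x = pt (Suc a) b) \<and>
     d (Suc a) (db (Suc b) x) = pt a b}"

lemma rel_cellsD:
  assumes "x \<in> rel_cells a b"
  shows "x \<in> K" "hdim x = Suc a" "vdim x = Suc b"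
    "\<And>i. i \<le> a \<Longrightarrow> d i x = pt a (Suc b)" "\<And>j. j \<le> b \<Longrightarrow> db j x = pt (Suc a) b"
    "d (Suc a) (db (Suc b) x) = pt a b"
  using assms by (auto simp: rel_cells_def)

lemma target_facts:
  assumes "x \<in> rel_cells a b"
  shows "\<And>i. i \<le> Suc a \<Longrightarrow> d i (db (Suc b) x) = pt a b"
    and "\<And>j. j \<le> b \<Longrightarrow> 0 < b \<Longrightarrow> db j (db (Suc b) x) = pt (Suc a) (b - 1)"
proof -
  note F = rel_cellsD[OF assms]
  show "d i (db (Suc b) x) = pt a b" if "i \<le> Suc a" for i
    using that by (cases "i = Suc a") (simp_all add: F db_d[symmetric])
  show "db j (db (Suc b) x) = pt (Suc a) (b - 1)" if "j \<le> b" "0 < b" for j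
    using that by (simp add: F db_db)
qed

text \<open>
  \<open>aprod a b \<alpha> \<beta> \<epsilon>\<close>: some filler $\theta$ for $\alpha$ and $\beta$
  exhibits $\epsilon$ as a value of the Aeppli product, as a relation on cells.
\<close>

definition aprod :: "nat \<Rightarrow> nat \<Rightarrow> 'c \<Rightarrow> 'c \<Rightarrow> 'c \<Rightarrow> bool" where
  "aprod a b \<alpha> \<beta> \<epsilon> \<longleftrightarrow> (\<exists>\<theta>. \<theta> \<in> K \<and> hdim \<theta> = Suc (Suc a) \<and> vdim \<theta> = Suc (Suc b) \<and>
     (\<forall>i<a. d i \<theta> = pt (Suc a) (Suc (Suc b))) \<and> (\<forall>j<b. db j \<theta> = pt (Suc (Suc a)) (Suc b)) \<and>
     d a \<theta> = sb b \<alpha> \<and> db b \<theta> = s a \<alpha> \<and>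
     d (Suc (Suc a)) (db (Suc (Suc b)) \<theta>) = \<beta> \<and> d (Suc a) (db (Suc b) \<theta>) = \<epsilon>)"

interpretation T: bikan K vdim hdim db sb d s "\<lambda>m n. pt n m"
  by (rule transpose)

text \<open>
  \<open>vtri a b w p q r\<close>: a vertical triangle at the last position, with trivial horizontal faces
  except $d_{a+1} w$; it exhibits \<open>q\<close> as the concatenation of \<open>p\<close> and \<open>r\<close>.
  \<open>transports a b \<alpha> w \<delta> \<beta>\<close>: the horizontal triangle \<open>w\<close> transports
  \<open>\<beta>\<close> along the target of \<open>\<alpha>\<close> to \<open>\<delta>\<close>.
\<close>

abbreviation vtri where
  "vtri a b w p q r \<equiv> T.tri b a (Suc b) a w p q r (pt a (Suc (Suc b)))"

abbreviation transports where
  "transports a b \<alpha> w \<delta> \<beta> \<equiv>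
     tri a b (Suc a) b w (sb b (db (Suc b) \<alpha>)) \<delta> \<beta> (s a (db (Suc b) \<alpha>))"

lemma T_rel_cells: "T.rel_cells b a = rel_cells a b"
proof -
  have "db (Suc b) (d (Suc a) x) = d (Suc a) (db (Suc b) x)"
    if "x \<in> K" "hdim x = Suc a" "vdim x = Suc b" for x
    using that by (simp add: db_d)
  then show ?thesis by (auto simp: T.rel_cells_def rel_cells_def)
qed

lemma T_aprod: "T.aprod b a \<alpha> \<beta> \<epsilon> \<longleftrightarrow> aprod a b \<alpha> \<beta> \<epsilon>"
  unfolding T.aprod_def aprod_def by (intro ex_cong1) (auto simp: db_d)

text \<open>
  A filler of the product is put together from a transport and a concatenation.
\<close>

lemma aprodI:
  assumes \<alpha>: "\<alpha> \<in> rel_cells a b"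
    and \<mu>: "transports a b \<alpha> \<mu> \<delta> \<beta>"
    and \<nu>: "vtri a b \<nu> \<alpha> \<epsilon> \<delta>"
  shows "aprod a b \<alpha> \<beta> \<epsilon>"
proof -
  note F = rel_cellsD[OF \<alpha>] triD[OF \<mu>] T.triD[OF \<nu>] target_facts[OF \<alpha>]
  have sb\<alpha>: "db j (sb b \<alpha>) = pt (Suc a) (Suc b)" if "j < b" for j
    using that by (simp add: F db_sb_less)
  have s\<alpha>: "d i (s a \<alpha>) = pt (Suc a) (Suc b)" if "i < a" for i
    using that by (simp add: F d_s_less)
  obtain z where z: "z \<in> K" "hdim z = Suc (Suc a)" "vdim z = Suc (Suc b)"
    "d a z = sb b \<alpha>" "d (Suc a) z = \<nu>" "db b z = s a \<alpha>" "db (Suc (Suc b)) z = \<mu>"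
    "\<And>i. i < a \<Longrightarrow> d i z = pt (Suc a) (Suc (Suc b))"
    "\<And>j. j < b \<Longrightarrow> db j z = pt (Suc (Suc a)) (Suc b)"
    by (rule fill_square[of "Suc a" a "Suc (Suc a)" b b "sb b \<alpha>" \<nu> "s a \<alpha>" \<mu>])
      (simp_all add: F sb\<alpha> s\<alpha> db_sb_greater d_s_greater)
  have "d (Suc a) (db (Suc b) z) = \<epsilon>"
    using F z by (simp add: db_d[symmetric])
  then show ?thesis
    unfolding aprod_def using z F by blast
qed
end

context bikan
begin

lemma tri_faces:
  assumes "tri a b (Suc a) b w p q r g"
  shows "p \<in> K" "hdim p = Suc a" "vdim p = Suc b" "q \<in> K" "hdim q = Suc a" "vdim q = Suc b"
    "r \<in> K" "hdim r = Suc a" "vdim r = Suc b"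
    "g \<in> K" "hdim g = Suc (Suc a)" "vdim g = b"
    "\<And>i. i < a \<Longrightarrow> d i p = pt a (Suc b)" "\<And>i. i < a \<Longrightarrow> d i q = pt a (Suc b)"
    "\<And>i. i < a \<Longrightarrow> d i r = pt a (Suc b)"
    "d a q = d a p" "d (Suc a) q = d (Suc a) r" "d a r = d (Suc a) p"
    "\<And>j. j < b \<Longrightarrow> db j p = pt (Suc a) b" "\<And>j. j < b \<Longrightarrow> db j q = pt (Suc a) b"
    "\<And>j. j < b \<Longrightarrow> db j r = pt (Suc a) b"
    "db b p = d a g" "db b q = d (Suc a) g" "db b r = d (Suc (Suc a)) g"
    "d a (db (Suc b) w) = db (Suc b) p" "d (Suc a) (db (Suc b) w) = db (Suc b) q"
    "d (Suc (Suc a)) (db (Suc b) w) = db (Suc b) r"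
proof -
  note w = triD[OF assms]
  have pqr: "p = d a w" "q = d (Suc a) w" "r = d (Suc (Suc a)) w" "g = db b w" using w by simp_all
  note W = w(1-3,8-11)
  show "p \<in> K" "hdim p = Suc a" "vdim p = Suc b" "q \<in> K" "hdim q = Suc a" "vdim q = Suc b"
    "r \<in> K" "hdim r = Suc a" "vdim r = Suc b" "g \<in> K" "hdim g = Suc (Suc a)" "vdim g = b"
    by (simp_all add: pqr W)
  show "d i p = pt a (Suc b)" "d i q = pt a (Suc b)" "d i r = pt a (Suc b)" if "i < a" for i
    using that by (simp_all add: pqr W d_below)
  show "db j p = pt (Suc a) b" "db j q = pt (Suc a) b" "db j r = pt (Suc a) b" if "j < b" for j
    using that by (simp_all add: pqr W db_d)
  show "d a q = d a p" "d (Suc a) q = d (Suc a) r" "d a r = d (Suc a) p"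
    using d_d[of w a "Suc a"] d_d[of w a "Suc (Suc a)"] d_d[of w "Suc a" "Suc (Suc a)"]
    by (simp_all add: pqr W)
  show "db b p = d a g" "db b q = d (Suc a) g" "db b r = d (Suc (Suc a)) g"
    "d a (db (Suc b) w) = db (Suc b) p" "d (Suc a) (db (Suc b) w) = db (Suc b) q"
    "d (Suc (Suc a)) (db (Suc b) w) = db (Suc b) r"
    by (simp_all add: pqr W db_d)
qed

text \<open>
  Horizontal homotopy of relative cells: it fixes $d_{a+1}$ and may move $\overline d_{b+1}$.  The
  transposed notion \<open>T.hhom b a\<close> is vertical homotopy.
\<close>

definition hhom :: "nat \<Rightarrow> nat \<Rightarrow> 'c \<Rightarrow> 'c \<Rightarrow> bool" where
  "hhom a b x y \<longleftrightarrow> (\<exists>\<eta>. tri a b (Suc a) b \<eta> (pt (Suc a) (Suc b)) x y (pt (Suc (Suc a)) b))"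

lemma hhom_rel_cells:
  assumes "hhom a b x y"
  shows "x \<in> rel_cells a b \<longleftrightarrow> y \<in> rel_cells a b"
proof -
  obtain \<eta> where \<eta>: "tri a b (Suc a) b \<eta> (pt (Suc a) (Suc b)) x y (pt (Suc (Suc a)) b)"
    using assms hhom_def by blast
  note F = tri_faces[OF \<eta>]
  have "d (Suc a) (db (Suc b) x) = d (Suc a) (db (Suc b) y)"
    by (simp add: F flip: db_d)
  then show "x \<in> rel_cells a b \<longleftrightarrow> y \<in> rel_cells a b"
    by (auto simp: rel_cells_def F le_less)
qed

lemma hhom_refl: "x \<in> rel_cells a b \<Longrightarrow> hhom a b x x"
  unfolding hhom_def tri_def
  by (rule exI[of _ "s (Suc a) x"]) (auto simp: rel_cellsD d_s_less)
end

context bikan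
begin

interpretation T: bikan K vdim hdim db sb d s "\<lambda>m n. pt n m"
  by (rule transpose)

text \<open>
  The faces $\overline d_{b+2}\theta$ and $d_{a+1}\theta$ of a filler are a transport and a
  concatenation.
\<close>

lemma aprodE:
  assumes "aprod a b \<alpha> \<beta> \<epsilon>" and \<alpha>: "\<alpha> \<in> rel_cells a b"
  obtains \<mu> \<delta> \<nu> where
    "transports a b \<alpha> \<mu> \<delta> \<beta>"
    "vtri a b \<nu> \<alpha> \<epsilon> \<delta>"
proof -
  obtain z where z: "z \<in> K" "hdim z = Suc (Suc a)" "vdim z = Suc (Suc b)"
     "\<And>i. i<a \<Longrightarrow> d i z = pt (Suc a) (Suc (Suc b))" "\<And>j. j<b \<Longrightarrow> db j z = pt (Suc (Suc a)) (Suc b)"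
     "d a z = sb b \<alpha>" "db b z = s a \<alpha>"
     and \<beta>: "d (Suc (Suc a)) (db (Suc (Suc b)) z) = \<beta>" and \<epsilon>: "d (Suc a) (db (Suc b) z) = \<epsilon>"
    using assms unfolding aprod_def by blast
  note F = rel_cellsD[OF \<alpha>]
  have "tri a b (Suc a) b (db (Suc (Suc b)) z) (sb b (db (Suc b) \<alpha>))
      (d (Suc a) (db (Suc (Suc b)) z)) \<beta> (s a (db (Suc b) \<alpha>))"
    unfolding tri_def by (simp add: z \<beta> F db_below db_sb_greater flip: db_d)
  moreover have "T.tri b a (Suc b) a (d (Suc a) z) \<alpha> \<epsilon>
      (d (Suc a) (db (Suc (Suc b)) z)) (pt a (Suc (Suc b)))"
    unfolding T.tri_def using d_d[of z a "Suc a"] by (simp add: z \<epsilon> F db_d d_below)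
  ultimately show thesis ..
qed

lemma ex_mu:
  assumes "\<alpha> \<in> rel_cells a b" "\<beta> \<in> rel_cells a b"
  obtains \<mu> where "transports a b \<alpha> \<mu> (d (Suc a) \<mu>) \<beta>"
proof -
  note F = rel_cellsD[OF assms(1)] rel_cellsD[OF assms(2)] target_facts[OF assms(1)]
  show thesis
    by (rule fill_middle[of "sb b (db (Suc b) \<alpha>)" a b "s a (db (Suc b) \<alpha>)" \<beta>, OF _ _ _ _ _ _ _ _ _ _ _ _ _ _ _ _ _ _ that])
      (simp_all add: F db_sb_less d_s_less d_s_greater)
qed

lemma mu_facts:
  assumes \<alpha>: "\<alpha> \<in> rel_cells a b" and \<beta>: "\<beta> \<in> rel_cells a b"
    and \<mu>: "transports a b \<alpha> \<mu> \<delta> \<beta>"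
  shows "\<delta> \<in> K" "hdim \<delta> = Suc a" "vdim \<delta> = Suc b"
    "\<And>i. i \<le> a \<Longrightarrow> d i \<delta> = pt a (Suc b)" "d (Suc a) \<delta> = d (Suc a) \<beta>"
    "\<And>j. j < b \<Longrightarrow> db j \<delta> = pt (Suc a) b" "db b \<delta> = db (Suc b) \<alpha>"
    "d (Suc a) (db (Suc b) \<delta>) = pt a b"
    "\<And>i. i \<le> Suc a \<Longrightarrow> d i (db (Suc b) \<delta>) = pt a b"
proof -
  note F = tri_faces[OF \<mu>] rel_cellsD[OF \<beta>] rel_cellsD[OF \<alpha>] target_facts[OF \<alpha>]
  show 1: "\<delta> \<in> K" "hdim \<delta> = Suc a" "vdim \<delta> = Suc b"
    "d (Suc a) \<delta> = d (Suc a) \<beta>"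
    "\<And>j. j < b \<Longrightarrow> db j \<delta> = pt (Suc a) b" "db b \<delta> = db (Suc b) \<alpha>" by (simp_all add: F)
  show 2: "d i \<delta> = pt a (Suc b)" if "i \<le> a" for i
    using that by (cases "i = a") (simp_all add: F)
  show 3: "d (Suc a) (db (Suc b) \<delta>) = pt a b"
    by (simp add: F flip: db_d) (simp add: F db_d)
  show "d i (db (Suc b) \<delta>) = pt a b" if "i \<le> Suc a" for i
    using that by (cases "i = Suc a") (simp_all add: 1 2 3 flip: db_d)
qed

lemma ex_nu:
  assumes \<alpha>: "\<alpha> \<in> rel_cells a b"
    and \<delta>: "\<delta> \<in> K" "hdim \<delta> = Suc a" "vdim \<delta> = Suc b"
    "\<And>i. i \<le> a \<Longrightarrow> d i \<delta> = pt a (Suc b)"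
    "\<And>j. j < b \<Longrightarrow> db j \<delta> = pt (Suc a) b" "db b \<delta> = db (Suc b) \<alpha>"
  obtains \<nu> where "vtri a b \<nu> \<alpha> (db (Suc b) \<nu>) \<delta>"
proof -
  note F = rel_cellsD[OF \<alpha>]
  show thesis
    by (rule T.fill_middle[of \<alpha> b a "pt a (Suc (Suc b))" \<delta>, OF _ _ _ _ _ _ _ _ _ _ _ _ _ _ _ _ _ _ that])
      (simp_all add: F \<delta>)
qed

lemma aprod_exists:
  assumes "\<alpha> \<in> rel_cells a b" "\<beta> \<in> rel_cells a b"
  shows "\<exists>\<epsilon>. aprod a b \<alpha> \<beta> \<epsilon>"
proof -
  obtain \<mu> where \<mu>: "transports a b \<alpha> \<mu> (d (Suc a) \<mu>) \<beta>"
    by (rule ex_mu[OF assms])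
  note F = mu_facts[OF assms \<mu>]
  obtain \<nu> where "vtri a b \<nu> \<alpha> (db (Suc b) \<nu>) (d (Suc a) \<mu>)"
    by (rule ex_nu[OF assms(1) F(1-4) F(6,7)])
  with aprodI[OF assms(1) \<mu>] show ?thesis by blast
qed

lemma aprod_closed:
  assumes "aprod a b \<alpha> \<beta> \<epsilon>" "\<alpha> \<in> rel_cells a b" "\<beta> \<in> rel_cells a b"
  shows "\<epsilon> \<in> rel_cells a b"
proof -
  obtain \<mu> \<delta> \<nu> where
    \<mu>: "transports a b \<alpha> \<mu> \<delta> \<beta>" and
    \<nu>: "vtri a b \<nu> \<alpha> \<epsilon> \<delta>"
    by (rule aprodE[OF assms(1,2)])
  note F = T.tri_faces[OF \<nu>] mu_facts[OF assms(2,3) \<mu>] rel_cellsD[OF assms(2)]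
  have "d a \<epsilon> = pt a (Suc b)" "db b \<epsilon> = pt (Suc a) b" by (simp_all add: F)
  moreover have "d (Suc a) (db (Suc b) \<epsilon>) = pt a b"
    by (simp add: F)
  ultimately show ?thesis
    by (auto simp: rel_cells_def F le_less)
qed

lemma aprod_pt_right:
  assumes "\<alpha> \<in> rel_cells a b"
  shows "aprod a b \<alpha> (pt (Suc a) (Suc b)) \<alpha>"
  unfolding aprod_def
  by (rule exI[of _ "s a (sb b \<alpha>)"])
    (use assms in \<open>simp add: rel_cellsD d_s_less db_sb_less db_sb_greater d_s_greater\<close>)

lemma pt_rel_cells: "pt (Suc a) (Suc b) \<in> rel_cells a b"
  by (simp add: rel_cells_def)

text \<open>
  Concatenating $\alpha$ with a suitable \<open>\<delta>\<close> gives the base point, and \<open>\<delta>\<close> is the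
  transport of some \<open>\<beta>\<close>: both triangles come from horns whose missing face is the last one.
\<close>

lemma ex_right_inverse:
  assumes \<alpha>: "\<alpha> \<in> rel_cells a b"
  obtains \<beta> where "\<beta> \<in> rel_cells a b" "aprod a b \<alpha> \<beta> (pt (Suc a) (Suc b))"
proof -
  let ?t = "db (Suc b) \<alpha>"
  note F = rel_cellsD[OF \<alpha>] target_facts[OF \<alpha>]
  obtain \<nu> where \<nu>: "vtri a b \<nu> \<alpha> (pt (Suc a) (Suc b)) (db (Suc (Suc b)) \<nu>)"
    by (rule T.fill_last[of \<alpha> b a "pt a (Suc (Suc b))" "pt (Suc a) (Suc b)"]) (simp_all add: F)
  define \<delta> where "\<delta> = db (Suc (Suc b)) \<nu>"
  note \<nu> = \<nu>[folded \<delta>_def]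
  note N = T.tri_faces[OF \<nu>]
  obtain \<mu> where \<mu>: "tri a b (Suc a) b \<mu> (sb b ?t) \<delta> (d (Suc (Suc a)) \<mu>) (s a ?t)"
    by (rule fill_last[of "sb b ?t" a b "s a ?t" \<delta>])
      (simp_all add: F N db_sb_less d_s_less d_s_greater)
  define \<beta> where "\<beta> = d (Suc (Suc a)) \<mu>"
  note \<mu> = \<mu>[folded \<beta>_def]
  note M = tri_faces[OF \<mu>]
  have "d a \<beta> = pt a (Suc b)" "db b \<beta> = pt (Suc a) b" by (simp_all add: M F d_s_greater)
  moreover have "d (Suc a) (db (Suc b) \<beta>) = pt a b"
  proof -
    have "d (Suc a) (db (Suc b) \<beta>) = db (Suc b) (d (Suc a) \<beta>)" by (simp add: M db_d)
    also have "\<dots> = db (Suc b) (d (Suc a) \<delta>)" by (simp add: M)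
    also have "\<dots> = d (Suc a) (db (Suc b) \<delta>)" by (simp add: N db_d)
    also have "\<dots> = pt a b" by (simp flip: N(17))
    finally show ?thesis .
  qed
  ultimately have "\<beta> \<in> rel_cells a b"
    by (auto simp: rel_cells_def M le_less)
  then show thesis by (rule that[OF _ aprodI[OF \<alpha> \<mu> \<nu>]])
qed

text \<open>
  The products of the base point with $\beta$ are reached by a horizontal and a vertical homotopy.
\<close>

lemma aprod_pt_left:
  assumes "\<beta> \<in> rel_cells a b"
  shows "aprod a b (pt (Suc a) (Suc b)) \<beta> \<epsilon> \<longleftrightarrow> (\<exists>\<delta>. T.hhom b a \<epsilon> \<delta> \<and> hhom a b \<delta> \<beta>)"
proof
  assume "aprod a b (pt (Suc a) (Suc b)) \<beta> \<epsilon>"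
  from aprodE[OF this pt_rel_cells] obtain \<mu> \<delta> \<nu> where
    "tri a b (Suc a) b \<mu> (sb b (db (Suc b) (pt (Suc a) (Suc b)))) \<delta> \<beta> (s a (db (Suc b) (pt (Suc a) (Suc b))))"
    "vtri a b \<nu> (pt (Suc a) (Suc b)) \<epsilon> \<delta>" .
  then have "hhom a b \<delta> \<beta>" "T.hhom b a \<epsilon> \<delta>"
    by (auto simp: hhom_def T.hhom_def)
  then show "\<exists>\<delta>. T.hhom b a \<epsilon> \<delta> \<and> hhom a b \<delta> \<beta>" by blast
next
  assume "\<exists>\<delta>. T.hhom b a \<epsilon> \<delta> \<and> hhom a b \<delta> \<beta>"
  then obtain \<mu> \<delta> \<nu> where
    "tri a b (Suc a) b \<mu> (pt (Suc a) (Suc b)) \<delta> \<beta> (pt (Suc (Suc a)) b)"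
    "vtri a b \<nu> (pt (Suc a) (Suc b)) \<epsilon> \<delta>"
    by (auto simp: hhom_def T.hhom_def)
  then show "aprod a b (pt (Suc a) (Suc b)) \<beta> \<epsilon>"
    by (intro aprodI[OF pt_rel_cells]) simp_all
qed

end

context bikan
begin

section \<open>Independence of choices\<close>

text \<open>
  A cell of bidimension $(a+1, b)$ with trivial faces, such as the target of a relative cell.
\<close>

definition sphere :: "nat \<Rightarrow> nat \<Rightarrow> 'c \<Rightarrow> bool" where
  "sphere a b t \<longleftrightarrow> t \<in> K \<and> hdim t = Suc a \<and> vdim t = b \<and> (\<forall>i\<le>Suc a. d i t = pt a b) \<and>
     (0 < b \<longrightarrow> (\<forall>j\<le>b. db j t = pt (Suc a) (b - 1)))"

lemma sphereD:
  assumes "sphere a b t"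
  shows "t \<in> K" "hdim t = Suc a" "vdim t = b" "\<And>i. i \<le> Suc a \<Longrightarrow> d i t = pt a b"
    "\<And>j. j \<le> b \<Longrightarrow> 0 < b \<Longrightarrow> db j t = pt (Suc a) (b - 1)"
  using assms by (auto simp: sphere_def)

lemma sphere_target: "x \<in> rel_cells a b \<Longrightarrow> sphere a b (db (Suc b) x)"
  by (auto simp: sphere_def target_facts rel_cellsD)

text \<open>
  Degenerate triangles and tetrahedra on a sphere, which serve as the constant faces in the
  tetrahedra below.
\<close>

lemma tri_degen_low:
  assumes "sphere a b t"
  shows "tri a b (Suc a) b (s a (sb b t)) (sb b t) (sb b t) (pt (Suc a) (Suc b)) (s a t)"
  using sphereD[OF assms] by (simp add: tri_def d_s_less db_sb_less d_s_greater)

lemma tri_degen_high: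
  assumes "sphere a b t"
  shows "tri a b (Suc a) b (s (Suc a) (sb b t)) (pt (Suc a) (Suc b)) (sb b t) (sb b t) (s (Suc a) t)"
  using sphereD[OF assms] by (simp add: tri_def d_s_less db_sb_less d_s_greater)

lemma tet_degen_low:
  assumes "sphere a b t"
  shows "tet a b (Suc a) b (s a (s a t)) (s a t) (s a t) (s a t) (pt (Suc (Suc a)) b)"
  using sphereD[OF assms] by (simp add: tet_def d_s_less d_s_greater)

lemma tet_degen_high:
  assumes "sphere a b t"
  shows "tet a b (Suc a) b (s (Suc (Suc a)) (s a t)) (s (Suc a) t) (s (Suc a) t) (s a t) (s a t)"
  using sphereD[OF assms] by (simp add: tet_def d_s_less d_s_greater)

lemma tet_pt: "tet a b (Suc a) b (pt (Suc (Suc (Suc a))) b) (pt (Suc (Suc a)) b) (pt (Suc (Suc a)) b)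
    (pt (Suc (Suc a)) b) (pt (Suc (Suc a)) b)"
  by (simp add: tet_def)

lemma tri_degen_rel:
  assumes "x \<in> rel_cells a b"
  shows "tri a b (Suc a) b (s (Suc a) x) (pt (Suc a) (Suc b)) x x (pt (Suc (Suc a)) b)"
  using assms by (simp add: tri_def rel_cellsD d_s_less)

end

context bikan
begin
interpretation T: bikan K vdim hdim db sb d s "\<lambda>m n. pt n m"
  by (rule transpose)

lemma aprod_hhom_right:
  assumes \<alpha>: "\<alpha> \<in> rel_cells a b" and "aprod a b \<alpha> \<beta> \<epsilon>" and \<beta>: "hhom a b \<beta> \<beta>'"
  shows "aprod a b \<alpha> \<beta>' \<epsilon>"
proof -
  obtain \<mu> \<delta> \<nu> where
    \<mu>: "transports a b \<alpha> \<mu> \<delta> \<beta>" and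
    \<nu>: "vtri a b \<nu> \<alpha> \<epsilon> \<delta>"
    by (rule aprodE[OF assms(2) \<alpha>])
  obtain \<eta> where \<eta>: "tri a b (Suc a) b \<eta> (pt (Suc a) (Suc b)) \<beta> \<beta>' (pt (Suc (Suc a)) b)"
    using \<beta> hhom_def by blast
  note t = sphere_target[OF \<alpha>]
  obtain \<mu>' where "transports a b \<alpha> \<mu>' \<delta> \<beta>'"
    by (rule tetrahedron2[OF tri_degen_low[OF t] \<mu> \<eta> tet_degen_low[OF t]])
  from aprodI[OF \<alpha> this \<nu>] show ?thesis .
qed

lemma aprod_vhom_result:
  assumes \<alpha>: "\<alpha> \<in> rel_cells a b" and "aprod a b \<alpha> \<beta> \<epsilon>" and \<epsilon>: "T.hhom b a \<epsilon>' \<epsilon>"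
  shows "aprod a b \<alpha> \<beta> \<epsilon>'"
proof -
  obtain \<mu> \<delta> \<nu> where
    \<mu>: "transports a b \<alpha> \<mu> \<delta> \<beta>" and
    \<nu>: "vtri a b \<nu> \<alpha> \<epsilon> \<delta>"
    by (rule aprodE[OF assms(2) \<alpha>])
  obtain \<eta> where \<eta>: "vtri a b \<eta> (pt (Suc a) (Suc b)) \<epsilon>' \<epsilon>"
    using \<epsilon> T.hhom_def by blast
  have \<alpha>': "\<alpha> \<in> T.rel_cells b a" using \<alpha> by (simp add: T_rel_cells)
  obtain \<nu>' where "vtri a b \<nu>' \<alpha> \<epsilon>' \<delta>"
    by (rule T.tetrahedron2[OF T.tri_degen_rel[OF \<alpha>'] \<eta> \<nu> T.tet_pt])
  from aprodI[OF \<alpha> \<mu> this] show ?thesis .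
qed

lemma aprod_vhom_left:
  assumes \<alpha>: "\<alpha> \<in> rel_cells a b" and \<beta>: "\<beta> \<in> rel_cells a b"
    and "aprod a b \<alpha> \<beta> \<epsilon>" and \<alpha>\<alpha>': "T.hhom b a \<alpha> \<alpha>'"
  shows "aprod a b \<alpha>' \<beta> \<epsilon>"
proof -
  obtain \<mu> \<delta> \<nu> where
    \<mu>: "transports a b \<alpha> \<mu> \<delta> \<beta>" and
    \<nu>: "vtri a b \<nu> \<alpha> \<epsilon> \<delta>"
    by (rule aprodE[OF assms(3) \<alpha>])
  obtain \<eta> where \<eta>: "vtri a b \<eta> (pt (Suc a) (Suc b)) \<alpha> \<alpha>'"
    using \<alpha>\<alpha>' T.hhom_def by blast
  have \<alpha>': "\<alpha>' \<in> rel_cells a b" using \<alpha> T.hhom_rel_cells[OF \<alpha>\<alpha>'] by (simp add: T_rel_cells)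
  have t: "db (Suc b) \<alpha> = db (Suc b) \<alpha>'" using T.tri_faces(17)[OF \<eta>] .
  note F = mu_facts[OF \<alpha> \<beta> \<mu>]
  obtain \<nu>' where \<nu>': "vtri a b \<nu>' \<alpha>' (db (Suc b) \<nu>') \<delta>"
    by (rule ex_nu[OF \<alpha>' F(1-4) F(6) F(7)[unfolded t]])
  obtain \<zeta> where "vtri a b \<zeta> (pt (Suc a) (Suc b)) \<epsilon> (db (Suc b) \<nu>')"
    by (rule T.tetrahedron1[OF \<eta> \<nu> \<nu>' T.tet_pt])
  then have "T.hhom b a \<epsilon> (db (Suc b) \<nu>')"
    unfolding T.hhom_def by blast
  from aprod_vhom_result[OF \<alpha>' aprodI[OF \<alpha>' \<mu>[unfolded t] \<nu>'] this] show ?thesis .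
qed

text \<open>
  Two products of $\alpha$ and $\beta$ differ by a horizontal homotopy, which comes from the choice of
  the transport, and a vertical one, which comes from the choice of the concatenation.
\<close>

lemma aprod_unique:
  assumes \<alpha>: "\<alpha> \<in> rel_cells a b" and \<beta>: "\<beta> \<in> rel_cells a b"
    and "aprod a b \<alpha> \<beta> \<epsilon>" "aprod a b \<alpha> \<beta> \<epsilon>'"
  shows "aprod a b (pt (Suc a) (Suc b)) \<epsilon> \<epsilon>'"
proof -
  let ?t = "db (Suc b) \<alpha>"
  obtain \<mu> \<delta> \<nu> where
    \<mu>: "tri a b (Suc a) b \<mu> (sb b ?t) \<delta> \<beta> (s a ?t)" and
    \<nu>: "vtri a b \<nu> \<alpha> \<epsilon> \<delta>"
    by (rule aprodE[OF assms(3) \<alpha>])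
  obtain \<mu>' \<delta>' \<nu>' where
    \<mu>': "tri a b (Suc a) b \<mu>' (sb b ?t) \<delta>' \<beta> (s a ?t)" and
    \<nu>': "vtri a b \<nu>' \<alpha> \<epsilon>' \<delta>'"
    by (rule aprodE[OF assms(4) \<alpha>])
  note t = sphere_target[OF \<alpha>]
  \<comment> \<open>the two transports of \<open>\<beta>\<close> are homotopic relative to their source \<open>?t\<close>\<close>
  obtain \<kappa> where \<kappa>: "tri a b (Suc a) b \<kappa> (pt (Suc a) (Suc b)) \<delta>' \<delta> (s (Suc a) ?t)"
    by (rule tetrahedron1[OF tri_degen_high[OF t] \<mu>' \<mu> tet_degen_high[OF t]])
  note F = triD[OF \<kappa>] rel_cellsD[OF \<alpha>] T.triD[OF \<nu>] target_facts[OF \<alpha>]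
  obtain z where z: "z \<in> K" "hdim z = Suc (Suc a)" "vdim z = Suc (Suc b)"
    "d a z = pt (Suc a) (Suc (Suc b))" "d (Suc (Suc a)) z = \<nu>"
    "db b z = s (Suc a) \<alpha>" "db (Suc (Suc b)) z = \<kappa>"
    "\<And>i. i < a \<Longrightarrow> d i z = pt (Suc a) (Suc (Suc b))"
    "\<And>j. j < b \<Longrightarrow> db j z = pt (Suc (Suc a)) (Suc b)"
    \<comment> \<open>move the concatenation \<open>\<nu>\<close> along \<open>\<kappa>\<close>, with \<open>\<alpha>\<close> fixed\<close>
    by (rule fill_square[of "Suc (Suc a)" a "Suc a" b b "pt (Suc a) (Suc (Suc b))" \<nu> "s (Suc a) \<alpha>" \<kappa>])
      (simp_all add: F d_s_less)
  have \<nu>'': "vtri a b (d (Suc a) z) \<alpha> (d (Suc a) (db (Suc b) z)) \<delta>'"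
    unfolding T.tri_def using d_d[of z a "Suc a"] by (simp add: z F db_d d_below)
  have "tri a b (Suc a) b (db (Suc b) z) (pt (Suc a) (Suc b)) (d (Suc a) (db (Suc b) z)) \<epsilon> (pt (Suc (Suc a)) b)"
    unfolding tri_def using db_db[of z b "Suc b"] by (simp add: z F db_below flip: db_d)
  then have hh: "hhom a b (d (Suc a) (db (Suc b) z)) \<epsilon>"
    unfolding hhom_def by blast
  have \<alpha>': "\<alpha> \<in> T.rel_cells b a" using \<alpha> by (simp add: T_rel_cells)
  obtain \<zeta> where "vtri a b \<zeta> (pt (Suc a) (Suc b)) \<epsilon>' (d (Suc a) (db (Suc b) z))"
    by (rule T.tetrahedron1[OF T.tri_degen_rel[OF \<alpha>'] \<nu>' \<nu>'' T.tet_pt])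
  then have "T.hhom b a \<epsilon>' (d (Suc a) (db (Suc b) z))"
    unfolding T.hhom_def by blast
  with hh show ?thesis
    using aprod_pt_left[OF aprod_closed[OF assms(3) \<alpha> \<beta>]] by blast
qed

end

context bikan
begin

interpretation T: bikan K vdim hdim db sb d s "\<lambda>m n. pt n m"
  by (rule transpose)

text \<open>
  The equivalence relation on relative cells generated by horizontal and vertical homotopy.  By
  \<open>aprod_pt_left\<close> and the symmetry of the product it is the composite of the two, in either order;
  that it is symmetric and transitive is the uniqueness of products with the base point.
\<close>

definition aeq :: "nat \<Rightarrow> nat \<Rightarrow> 'c \<Rightarrow> 'c \<Rightarrow> bool" where
  "aeq a b x y \<longleftrightarrow> x \<in> rel_cells a b \<and> y \<in> rel_cells a b \<and> aprod a b (pt (Suc a) (Suc b)) x y"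

lemma aeq_refl: "x \<in> rel_cells a b \<Longrightarrow> aeq a b x x"
  using aprod_pt_left[of x a b x] hhom_refl[of x a b] T.hhom_refl[of x b a]
  by (auto simp: aeq_def T_rel_cells)

lemma aeq_sym:
  assumes "aeq a b x y"
  shows "aeq a b y x"
  using aprod_unique[OF pt_rel_cells, of x a b y x] assms aeq_refl[of x a b] unfolding aeq_def by blast

lemma aeq_trans:
  assumes "aeq a b x y" "aeq a b y z"
  shows "aeq a b x z"
  using aprod_unique[OF pt_rel_cells, of y a b x z] aeq_sym[OF assms(1)] assms unfolding aeq_def by blast

lemma hhom_aeq:
  assumes "hhom a b x y" "x \<in> rel_cells a b"
  shows "aeq a b x y"
proof -
  have y: "y \<in> rel_cells a b" using assms hhom_rel_cells by blast
  have "T.hhom b a x x" using T.hhom_refl assms by (simp add: T_rel_cells)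
  then have "aeq a b y x" using assms y by (auto simp: aeq_def aprod_pt_left)
  then show ?thesis by (rule aeq_sym)
qed

lemma vhom_aeq:
  assumes "T.hhom b a x y" "x \<in> rel_cells a b"
  shows "aeq a b x y"
proof -
  have y: "y \<in> rel_cells a b" using assms T.hhom_rel_cells[OF assms(1)] by (simp add: T_rel_cells)
  then have "aeq a b y x"
    using assms hhom_refl[OF y] by (auto simp: aeq_def aprod_pt_left)
  then show ?thesis by (rule aeq_sym)
qed

lemma aeqE:
  assumes "aeq a b x y"
  obtains z where "hhom a b z x" "T.hhom b a y z" "x \<in> rel_cells a b" "y \<in> rel_cells a b" "z \<in> rel_cells a b"
  using assms aprod_pt_left[of x a b y] hhom_rel_cells[of a b _ x] unfolding aeq_def by blast

end

context bikan
begin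

interpretation T: bikan K vdim hdim db sb d s "\<lambda>m n. pt n m"
  by (rule transpose)

text \<open>
  Every homotopy of one of the three arguments splits into a horizontal and a vertical one; one of them
  is absorbed by a lemma above and the other by its transpose.
\<close>

lemma aprod_aeq_right:
  assumes \<alpha>: "\<alpha> \<in> rel_cells a b" and p: "aprod a b \<alpha> \<beta> \<epsilon>" and e: "aeq a b \<beta> \<beta>'"
  shows "aprod a b \<alpha> \<beta>' \<epsilon>"
proof -
  obtain z where z: "hhom a b z \<beta>'" "T.hhom b a \<beta> z"
    by (rule aeqE[OF aeq_sym[OF e]])
  have "aprod a b \<alpha> z \<epsilon>"
    using T.aprod_hhom_right[of \<alpha> b a \<beta> \<epsilon> z] \<alpha> p z(2) by (simp add: T_rel_cells T_aprod)
  then show ?thesis by (rule aprod_hhom_right[OF \<alpha> _ z(1)])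
qed

lemma aprod_aeq_left:
  assumes \<beta>: "\<beta> \<in> rel_cells a b" and p: "aprod a b \<alpha> \<beta> \<epsilon>" and e: "aeq a b \<alpha> \<alpha>'"
  shows "aprod a b \<alpha>' \<beta> \<epsilon>"
proof -
  obtain z where z: "hhom a b z \<alpha>'" "T.hhom b a \<alpha> z" "\<alpha> \<in> rel_cells a b" "z \<in> rel_cells a b"
    by (rule aeqE[OF aeq_sym[OF e]])
  have "aprod a b z \<beta> \<epsilon>" by (rule aprod_vhom_left[OF z(3) \<beta> p z(2)])
  then show ?thesis
    using T.aprod_vhom_left[of z b a \<beta> \<epsilon> \<alpha>'] z(1,4) \<beta> by (simp add: T_rel_cells T_aprod)
qed

lemma aprod_aeq_result:
  assumes \<alpha>: "\<alpha> \<in> rel_cells a b" and p: "aprod a b \<alpha> \<beta> \<epsilon>" and e: "aeq a b \<epsilon> \<epsilon>'"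
  shows "aprod a b \<alpha> \<beta> \<epsilon>'"
proof -
  obtain z where z: "hhom a b z \<epsilon>" "T.hhom b a \<epsilon>' z"
    by (rule aeqE[OF e])
  have "aprod a b \<alpha> \<beta> z"
    using T.aprod_vhom_result[of \<alpha> b a \<beta> \<epsilon> z] \<alpha> p z(1) by (simp add: T_rel_cells T_aprod)
  then show ?thesis by (rule aprod_vhom_result[OF \<alpha> _ z(2)])
qed

lemma aprod_unique_iff:
  assumes \<alpha>: "\<alpha> \<in> rel_cells a b" and \<beta>: "\<beta> \<in> rel_cells a b" and p: "aprod a b \<alpha> \<beta> \<epsilon>"
  shows "aprod a b \<alpha> \<beta> \<epsilon>' \<longleftrightarrow> aeq a b \<epsilon> \<epsilon>'"
  using aprod_unique[OF \<alpha> \<beta> p] aprod_aeq_result[OF \<alpha> p] aprod_closed[OF _ \<alpha> \<beta>] p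
  unfolding aeq_def by blast

section \<open>Associativity\<close>

text \<open>
  Write $\alpha \circ \delta$ for concatenation, $t$ and $u$ for the targets of $\alpha$ and
  $\beta$, and $t \rhd \xi$ for transport along $t$.  Then $\alpha\beta = \alpha \circ
  (t \rhd \beta)$, and both products of three cells equal
  $\alpha \circ (t \rhd \beta) \circ (t \rhd (u \rhd \gamma))$.  All equations hold on the
  nose for suitable choices of the triangles.
\<close>

lemma aprod_assoc:
  assumes \<alpha>: "\<alpha> \<in> rel_cells a b" and \<beta>: "\<beta> \<in> rel_cells a b" and \<gamma>: "\<gamma> \<in> rel_cells a b"
  obtains \<alpha>\<beta> \<beta>\<gamma> \<sigma> where "aprod a b \<alpha> \<beta> \<alpha>\<beta>" "aprod a b \<beta> \<gamma> \<beta>\<gamma>" "aprod a b \<alpha>\<beta> \<gamma> \<sigma>" "aprod a b \<alpha> \<beta>\<gamma> \<sigma>"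
proof -
  let ?t = "db (Suc b) \<alpha>" and ?u = "db (Suc b) \<beta>"
  note S = sphere_target[OF \<alpha>] sphere_target[OF \<beta>]
  obtain \<mu>1 where "tri a b (Suc a) b \<mu>1 (sb b ?t) (d (Suc a) \<mu>1) \<beta> (s a ?t)"
    by (rule ex_mu[OF \<alpha> \<beta>])
  then obtain \<delta>1 where \<mu>1: "tri a b (Suc a) b \<mu>1 (sb b ?t) \<delta>1 \<beta> (s a ?t)" by blast
  obtain \<mu>2 where "tri a b (Suc a) b \<mu>2 (sb b ?u) (d (Suc a) \<mu>2) \<gamma> (s a ?u)"
    by (rule ex_mu[OF \<beta> \<gamma>])
  then obtain \<xi> where \<mu>2: "tri a b (Suc a) b \<mu>2 (sb b ?u) \<xi> \<gamma> (s a ?u)" by blast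
  note F1 = mu_facts[OF \<alpha> \<beta> \<mu>1] and F2 = mu_facts[OF \<beta> \<gamma> \<mu>2]
  obtain \<nu>1 where "vtri a b \<nu>1 \<alpha> (db (Suc b) \<nu>1) \<delta>1"
    by (rule ex_nu[OF \<alpha> F1(1-4) F1(6,7)])
  then obtain \<alpha>\<beta> where \<nu>1: "vtri a b \<nu>1 \<alpha> \<alpha>\<beta> \<delta>1" by blast
  obtain \<nu>2 where "vtri a b \<nu>2 \<beta> (db (Suc b) \<nu>2) \<xi>"
    by (rule ex_nu[OF \<beta> F2(1-4) F2(6,7)])
  then obtain \<beta>\<gamma> where \<nu>2: "vtri a b \<nu>2 \<beta> \<beta>\<gamma> \<xi>" by blast
  define \<omega> where "\<omega> = db (Suc b) \<mu>1"
  have \<omega>: "\<omega> \<in> K" "hdim \<omega> = Suc (Suc a)" "vdim \<omega> = b"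
    "d a \<omega> = ?t" "d (Suc a) \<omega> = db (Suc b) \<delta>1" "d (Suc (Suc a)) \<omega> = ?u"
    "\<And>i. i < a \<Longrightarrow> d i \<omega> = pt (Suc a) b" "\<And>j. j < b \<Longrightarrow> db j \<omega> = pt (Suc (Suc a)) (b - 1)"
    using triD[OF \<mu>1] tri_faces[OF \<mu>1] sphereD[OF S(1)]
    by (simp_all add: \<omega>_def db_below flip: db_d)
  \<comment> \<open>\<open>\<delta>3\<close> is the transport of \<open>\<xi>\<close> along \<open>?t\<close>, chosen to start where \<open>\<delta>1\<close> ends\<close>
  obtain \<mu>3 where "tri a b (Suc a) b \<mu>3 (sb b ?t) (d (Suc a) \<mu>3) \<xi> \<omega>"
    by (rule fill_middle[of "sb b ?t" a b \<omega> \<xi>]) (simp_all add: F2 sphereD[OF S(1)] rel_cellsD[OF \<alpha>] \<omega> db_sb_less)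
  then obtain \<delta>3 where \<mu>3: "tri a b (Suc a) b \<mu>3 (sb b ?t) \<delta>3 \<xi> \<omega>" by blast
  note F3 = tri_faces[OF \<mu>3]
  have ab: "\<alpha>\<beta> \<in> rel_cells a b" by (rule aprod_closed[OF aprodI[OF \<alpha> \<mu>1 \<nu>1] \<alpha> \<beta>])
  have tab: "db (Suc b) \<alpha>\<beta> = db (Suc b) \<delta>1" using T.tri_faces(17)[OF \<nu>1] .
  note S3 = sphere_target[OF ab]
  have w0: "tri a b (Suc a) b (sb b \<omega>) (sb b ?t) (sb b (db (Suc b) \<alpha>\<beta>)) (sb b ?u) \<omega>"
    by (simp add: tri_def \<omega> tab db_sb_less)
  have w: "tet a b (Suc a) b (s a \<omega>) \<omega> \<omega> (s a (db (Suc b) \<alpha>\<beta>)) (s a ?u)"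
    by (simp add: tet_def \<omega> tab d_s_less d_s_greater)
  \<comment> \<open>transport is compatible with iteration: \<open>\<delta>3\<close> is also the transport of \<open>\<gamma>\<close> along
    the target of \<open>\<alpha>\<beta>\<close>\<close>
  obtain \<mu>4 where \<mu>4: "transports a b \<alpha>\<beta> \<mu>4 \<delta>3 \<gamma>"
    by (rule tetrahedron2[OF w0 \<mu>3 \<mu>2 w])
  note F4 = mu_facts[OF ab \<gamma> \<mu>4]
  obtain \<nu>4 where "vtri a b \<nu>4 \<alpha>\<beta> (db (Suc b) \<nu>4) \<delta>3"
    by (rule ex_nu[OF ab F4(1-4) F4(6,7)])
  then obtain \<sigma> where \<nu>4: "vtri a b \<nu>4 \<alpha>\<beta> \<sigma> \<delta>3" by blast
  note G = triD[OF \<mu>1] triD[OF \<mu>3] T.triD[OF \<nu>2] sphereD[OF S(1)] rel_cellsD[OF \<alpha>] \<omega>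
  \<comment> \<open>transport is compatible with concatenation: \<open>\<delta>5\<close> is the transport of \<open>\<beta>\<gamma>\<close> and the
    concatenation of \<open>\<delta>1\<close> and \<open>\<delta>3\<close>\<close>
  have c: "Suc (Suc a) = Suc a \<and> Suc a = Suc (Suc a) \<or> Suc (Suc a) = Suc (Suc a) \<and> Suc a = Suc a" by simp
  obtain z where z: "z \<in> K" "hdim z = Suc (Suc a)" "vdim z = Suc (Suc b)"
    "d a z = sb b (sb b ?t)" "d (Suc (Suc a)) z = \<nu>2" "db b z = \<mu>1" "db (Suc (Suc b)) z = \<mu>3"
    "\<And>i. i < a \<Longrightarrow> d i z = pt (Suc a) (Suc (Suc b))"
    "\<And>j. j < b \<Longrightarrow> db j z = pt (Suc (Suc a)) (Suc b)"
    by (rule fill_square[OF c order_refl, of "sb b (sb b ?t)" b \<nu>2 \<mu>1 \<mu>3])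
      (simp_all add: G \<omega>_def[symmetric] db_sb_less db_sb_greater)
  define \<delta>5 where "\<delta>5 = d (Suc a) (db (Suc b) z)"
  have \<mu>5: "tri a b (Suc a) b (db (Suc b) z) (sb b ?t) \<delta>5 \<beta>\<gamma> (s a ?t)"
    unfolding tri_def \<delta>5_def using db_db[of z b "Suc b"] by (simp add: z G db_below flip: db_d)
  have n5: "vtri a b (d (Suc a) z) \<delta>1 \<delta>5 \<delta>3"
    unfolding T.tri_def \<delta>5_def using d_d[of z a "Suc a"] by (simp add: z G db_d d_below)
  \<comment> \<open>associativity of concatenation\<close>
  obtain \<nu>5 where \<nu>5: "vtri a b \<nu>5 \<alpha> \<sigma> \<delta>5"
    by (rule T.tetrahedron1[OF \<nu>1 \<nu>4 n5 T.tet_pt])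
  show thesis
    by (rule that[OF aprodI[OF \<alpha> \<mu>1 \<nu>1] aprodI[OF \<beta> \<mu>2 \<nu>2] aprodI[OF ab \<mu>4 \<nu>4] aprodI[OF \<alpha> \<mu>5 \<nu>5]])
qed

end

context bikan
begin

section \<open>Prisms of cells\<close>

text \<open>
  A cell with trivial horizontal faces and with free vertical faces at $l$ and $l+1$: a vertical path at
  position $l$ whose end points need not be trivial.  The face $\overline d_l$ is its source.
\<close>

definition free_path :: "nat \<Rightarrow> nat \<Rightarrow> nat \<Rightarrow> 'c \<Rightarrow> bool" where
  "free_path a b l x \<longleftrightarrow> x \<in> K \<and> hdim x = Suc a \<and> vdim x = Suc b \<and> l \<le> b \<and>
     (\<forall>i\<le>Suc a. d i x = pt a (Suc b)) \<and> (\<forall>j<l. db j x = pt (Suc a) b) \<and>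
     (\<forall>j>l + 1. j \<le> Suc b \<longrightarrow> db j x = pt (Suc a) b)"

text \<open>
  The sources of free paths: all faces are trivial except $\overline d_l$, about which nothing is
  assumed.
\<close>

definition loose :: "nat \<Rightarrow> nat \<Rightarrow> nat \<Rightarrow> 'c \<Rightarrow> bool" where
  "loose a b l t \<longleftrightarrow> t \<in> K \<and> hdim t = Suc a \<and> vdim t = b \<and> l \<le> b \<and> (\<forall>i\<le>Suc a. d i t = pt a b) \<and>
     (\<forall>j<l. db j t = pt (Suc a) (b - 1)) \<and> (\<forall>j>l. j \<le> b \<longrightarrow> db j t = pt (Suc a) (b - 1))"

lemma looseD:
  assumes "loose a b l t"
  shows "t \<in> K" "hdim t = Suc a" "vdim t = b" "l \<le> b" "\<And>i. i \<le> Suc a \<Longrightarrow> d i t = pt a b"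
    "\<And>j. j < l \<Longrightarrow> db j t = pt (Suc a) (b - 1)" "\<And>j. l < j \<Longrightarrow> j \<le> b \<Longrightarrow> db j t = pt (Suc a) (b - 1)"
  using assms by (auto simp: loose_def)

lemma free_pathD:
  assumes "free_path a b l x"
  shows "x \<in> K" "hdim x = Suc a" "vdim x = Suc b" "l \<le> b" "\<And>i. i \<le> Suc a \<Longrightarrow> d i x = pt a (Suc b)"
    "\<And>j. j < l \<Longrightarrow> db j x = pt (Suc a) b" "\<And>j. l + 1 < j \<Longrightarrow> j \<le> Suc b \<Longrightarrow> db j x = pt (Suc a) b"
  using assms by (auto simp: free_path_def)

lemma loose_start:
  assumes "free_path a b l x"
  shows "loose a b l (db l x)"
proof -
  note F = free_pathD[OF assms]
  show ?thesis
    unfolding loose_def using F(4) by (auto simp: F(1-3,5-) db_below db_above simp flip: db_d)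
qed

text \<open>
  A free path \<open>x\<close> is homotopic, at the horizontal position \<open>k\<close> and with its source fixed, to
  the constant path at that source.
\<close>

definition homotopic_to_const :: "nat \<Rightarrow> nat \<Rightarrow> nat \<Rightarrow> nat \<Rightarrow> 'c \<Rightarrow> bool" where
  "homotopic_to_const a b l k x \<longleftrightarrow> free_path a b l x \<and>
     (\<exists>w. tri k l (Suc a) b w (sb l (db l x)) x (pt (Suc a) (Suc b)) (s k (db l x)))"

lemma tri_pt: "k \<le> a \<Longrightarrow> l \<le> b \<Longrightarrow>
    tri k l (Suc a) b (pt (Suc (Suc a)) (Suc b)) (pt (Suc a) (Suc b)) (pt (Suc a) (Suc b)) (pt (Suc a) (Suc b)) (pt (Suc (Suc a)) b)"
  by (simp add: tri_def)

text \<open>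
  The property is inherited along a homotopy \<open>C\<close> that moves both end points: compare
  \<open>C\<close> with the degenerate homotopy \<open>sb l c\<close> of constant paths that has the same source.
\<close>

lemma homotopic_to_const_step:
  assumes x: "homotopic_to_const a b l k x"
    and C: "tri k l (Suc a) b C x y (pt (Suc a) (Suc b)) c"
  shows "homotopic_to_const a b l k y"
proof -
  obtain w where fx: "free_path a b l x" and
    w: "tri k l (Suc a) b w (sb l (db l x)) x (pt (Suc a) (Suc b)) (s k (db l x))"
    using x homotopic_to_const_def by blast
  have kl: "k \<le> a" "l \<le> b" using tri_bounds[OF C] by auto
  note FC = triD[OF C]
  have xy: "x = d k C" "y = d (Suc k) C" "c = db l C" using FC by simp_all
  note W = FC(1-3,6,8-11)
  have y: "y \<in> K" "hdim y = Suc a" "vdim y = Suc b" using kl by (simp_all add: xy W)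
  have "d i y = pt a (Suc b)" if i: "i \<le> Suc a" for i
  proof -
    consider "i < k" | "i = k" | "k < i" by linarith
    then show ?thesis
    proof cases
      case 1 then show ?thesis using kl by (simp add: xy W d_below)
    next
      case 2
      have "d k (d (Suc k) C) = d k (d k C)" using d_d[of C k "Suc k"] kl by (simp add: W)
      then show ?thesis using free_pathD(5)[OF fx, of k] kl 2 by (simp add: xy)
    next
      case 3
      then have "d i (d (Suc k) C) = d (Suc k) (d (Suc i) C)" using i kl by (simp add: W d_above)
      also have "d (Suc i) C = pt (Suc a) (Suc b)"
        using 3 i W by (cases "i = Suc k") (simp_all add: W)
      finally show ?thesis using kl by (simp add: xy)
    qed
  qed
  then have fy: "free_path a b l y"
    using y kl by (auto simp: free_path_def xy W db_d)
  have c: "c \<in> K" "hdim c = Suc (Suc a)" "vdim c = b" "d k c = db l x" "d (Suc k) c = db l y"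
    "\<And>i. i < k \<Longrightarrow> d i c = pt (Suc a) b" "\<And>i. k + 1 < i \<Longrightarrow> i \<le> Suc (Suc a) \<Longrightarrow> d i c = pt (Suc a) b"
    "\<And>j. j < l \<Longrightarrow> db j c = pt (Suc (Suc a)) (b - 1)"
    "\<And>j. l < j \<Longrightarrow> j \<le> b \<Longrightarrow> db j c = pt (Suc (Suc a)) (b - 1)"
  proof -
    fix i assume "i < k"
    then show "d i c = pt (Suc a) b"
      using kl by (simp add: xy W flip: db_d)
  next
    fix i assume "k + 1 < i" "i \<le> Suc (Suc a)"
    then show "d i c = pt (Suc a) b"
      using kl by (cases "i = Suc (Suc k)") (simp_all add: xy W flip: db_d)
  qed (use kl in \<open>simp_all add: xy W db_d db_below db_above\<close>)
  have t1: "tet k l (Suc a) b (s (Suc k) c) (s k (db l x)) c c (pt (Suc (Suc a)) b)"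
    using kl by (simp add: tet_def c d_s_less d_s_greater)
  obtain w1 where w1: "tri k l (Suc a) b w1 (sb l (db l x)) y (pt (Suc a) (Suc b)) c"
    by (rule tetrahedron1[OF w C tri_pt[OF kl] t1])
  have w0: "tri k l (Suc a) b (sb l c) (sb l (db l x)) (sb l (db l y)) (pt (Suc a) (Suc b)) c"
    using kl by (simp add: tri_def c db_sb_less db_sb_greater)
  have t2: "tet k l (Suc a) b (s k c) c c (s k (db l y)) (pt (Suc (Suc a)) b)"
    using kl by (simp add: tet_def c d_s_less d_s_greater)
  obtain w2 where "tri k l (Suc a) b w2 (sb l (db l y)) y (pt (Suc a) (Suc b)) (s k (db l y))"
    by (rule tetrahedron2[OF w0 w1 tri_pt[OF kl] t2])
  with fy show ?thesis by (auto simp: homotopic_to_const_def)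
qed

text \<open>
  A homotopy at position \<open>k\<close> can be moved to position $k + 1$.
\<close>

lemma homotopic_to_const_shift:
  assumes "homotopic_to_const a b l k x"
  obtains w where "tri k l (Suc a) b w (pt (Suc a) (Suc b)) (sb l (db l x)) x (s (Suc k) (db l x))"
proof -
  obtain w where fx: "free_path a b l x" and
    w: "tri k l (Suc a) b w (sb l (db l x)) x (pt (Suc a) (Suc b)) (s k (db l x))"
    using assms homotopic_to_const_def by blast
  have kl: "k \<le> a" "l \<le> b" using tri_bounds[OF w] by auto
  define t where "t = db l x"
  note t = looseD(1-3,5-)[OF loose_start[OF fx, folded t_def]]
  have w0: "tri k l (Suc a) b (s (Suc k) (sb l t)) (pt (Suc a) (Suc b)) (sb l t) (sb l t) (s (Suc k) t)"
    using kl by (simp add: tri_def t d_s_less d_s_greater db_sb_less db_sb_greater)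
  have w2: "tri k l (Suc a) b (s k (sb l t)) (sb l t) (sb l t) (pt (Suc a) (Suc b)) (s k t)"
    using kl by (simp add: tri_def t d_s_less d_s_greater db_sb_less db_sb_greater)
  have t1: "tet k l (Suc a) b (s (Suc (Suc k)) (s k t)) (s (Suc k) t) (s (Suc k) t) (s k t) (s k t)"
    using kl by (simp add: tet_def t d_s_less d_s_greater)
  show thesis
    by (rule tetrahedron1[OF w0 w2 w[folded t_def] t1, unfolded t_def, OF that])
qed

lemma homotopic_to_const_Suc:
  assumes x: "homotopic_to_const a b l k x" and "k < a"
  shows "homotopic_to_const a b l (Suc k) x"
proof -
  have fx: "free_path a b l x" using x by (simp add: homotopic_to_const_def)
  obtain w where w: "tri k l (Suc a) b w (pt (Suc a) (Suc b)) (sb l (db l x)) x (s (Suc k) (db l x))"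
    by (rule homotopic_to_const_shift[OF x])
  note F = triD[OF w]
  have "d i w = pt (Suc a) (Suc b)" if "i < Suc k" for i
    using that by (cases "i = k") (simp_all add: F)
  then have "tri (Suc k) l (Suc a) b w (sb l (db l x)) x (pt (Suc a) (Suc b)) (s (Suc k) (db l x))"
    using \<open>k < a\<close> tri_bounds[OF w] by (simp add: tri_def F)
  with fx show ?thesis by (auto simp: homotopic_to_const_def)
qed

lemma homotopic_to_const_chain:
  assumes C: "\<And>k. k \<le> a \<Longrightarrow> tri k l (Suc a) b (C k) (\<rho> k) (\<rho> (Suc k)) (pt (Suc a) (Suc b)) (c k)"
    and \<rho>0: "\<rho> 0 = sb l t" and t: "sphere a b t" and l: "l \<le> b"
  obtains w where "tri a l (Suc a) b w (pt (Suc a) (Suc b)) (sb l (db l (\<rho> (Suc a)))) (\<rho> (Suc a))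
      (s (Suc a) (db l (\<rho> (Suc a))))"
proof -
  note S = sphereD[OF t]
  have 0: "homotopic_to_const a b l 0 (\<rho> 0)"
  proof -
    have "tri 0 l (Suc a) b (s 0 (sb l t)) (sb l t) (sb l t) (pt (Suc a) (Suc b)) (s 0 (db l (sb l t)))"
      using l by (simp add: tri_def S d_s_greater db_sb_less db_sb_greater)
    moreover have "free_path a b l (sb l t)"
      using l by (auto simp: free_path_def S db_sb_less db_sb_greater)
    ultimately show ?thesis
      using l by (auto simp: homotopic_to_const_def \<rho>0 S)
  qed
  have "homotopic_to_const a b l k (\<rho> (Suc k))" if "k \<le> a" for k
    using that
  proof (induction k)
    case 0
    then show ?case using homotopic_to_const_step[OF \<open>homotopic_to_const a b l 0 (\<rho> 0)\<close> C] by blast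
  next
    case (Suc k)
    then show ?case using homotopic_to_const_step[OF homotopic_to_const_Suc C[of "Suc k"]] by simp
  qed
  then show thesis using homotopic_to_const_shift that by blast
qed

end

context bikan
begin

interpretation T: bikan K vdim hdim db sb d s "\<lambda>m n. pt n m"
  by (rule transpose)

text \<open>
  \<open>B\<close> is a vertical triangle whose nontrivial faces, besides the free $d_{a+1}B$, are the
  relative cells $\overline d_l B$ and $\overline d_{l+1} B$ and the free path
  $\overline d_{b+2} B$, which starts at the target $t$ of $\overline d_l B$.  If that path is
  homotopic to the constant path at $t$, then the two relative cells are equivalent.
\<close>

lemma aeq_of_path:
  assumes B: "B \<in> K" "hdim B = Suc a" "vdim B = Suc (Suc b)" "\<And>i. i \<le> a \<Longrightarrow> d i B = pt a (Suc (Suc b))"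
      "\<And>j. j < l \<Longrightarrow> db j B = pt (Suc a) (Suc b)"
      "\<And>j. l + 1 < j \<Longrightarrow> j \<le> Suc b \<Longrightarrow> db j B = pt (Suc a) (Suc b)"
    and l: "l \<le> b" and x: "db l B \<in> rel_cells a b"
    and t: "t = db l (db (Suc (Suc b)) B)"
    and w: "tri a l (Suc a) b w (pt (Suc a) (Suc b)) (sb l t) (db (Suc (Suc b)) B) (s (Suc a) t)"
  shows "aeq a b (db l B) (db (Suc l) B)"
proof -
  define x where "x = db l B"
  note X = rel_cellsD[OF assms(8)[folded x_def]]
  note W = triD[OF w]
  have tx: "db (Suc b) x = t"
    using l by (simp add: x_def t B db_above)
  have t_in: "t \<in> K" "hdim t = Suc a" "vdim t = b" using l by (simp_all add: t B)
  have c: "Suc (Suc a) = Suc a \<and> Suc a = Suc (Suc a) \<or> Suc (Suc a) = Suc (Suc a) \<and> Suc a = Suc a" by simp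
  obtain z where z: "z \<in> K" "hdim z = Suc (Suc a)" "vdim z = Suc (Suc b)"
    "d a z = pt (Suc a) (Suc (Suc b))" "d (Suc (Suc a)) z = B"
    "db l z = s (Suc a) x" "db (Suc (Suc b)) z = w"
    "\<And>i. i < a \<Longrightarrow> d i z = pt (Suc a) (Suc (Suc b))"
    "\<And>j. j < l \<Longrightarrow> db j z = pt (Suc (Suc a)) (Suc b)"
    "\<And>j. l + 1 < j \<Longrightarrow> j \<le> Suc b \<Longrightarrow> db j z = pt (Suc (Suc a)) (Suc b)"
    by (rule fill_square[OF c l, of "pt (Suc a) (Suc (Suc b))" B "s (Suc a) x" w])
      (use l in \<open>simp_all add: B W X tx x_def[symmetric] d_s_less\<close>)
  define x' where "x' = d (Suc a) (db (Suc l) z)"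
  \<comment> \<open>\<open>z\<close> deforms \<open>B\<close> into a triangle with the faces \<open>x\<close>, \<open>x'\<close> and a constant path\<close>
  have e1: "db b (db (Suc l) z) = pt (Suc (Suc a)) b"
  proof (cases "l = b")
    case True
    then have "db b (db (Suc l) z) = db b (db b z)"
      using db_db[of z b "Suc b"] by (simp add: z)
    moreover have "db b z = s (Suc a) x" using z(6) True by simp
    ultimately show ?thesis by (simp add: X)
  next
    case False
    then show ?thesis using l by (simp add: z db_above)
  qed
  have e2: "db j (db (Suc l) z) = pt (Suc (Suc a)) b" if "j < b" for j
  proof -
    consider "j < l" | "j = l" | "l < j" by linarith
    then show ?thesis
    proof cases
      case 2
      then have "db j (db (Suc l) z) = db l (db l z)"
        using db_db[of z l "Suc l"] l by (simp add: z)
      then show ?thesis using l by (simp add: z X)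
    qed (use l that in \<open>simp_all add: z db_above db_below\<close>)
  qed
  have "tri a b (Suc a) b (db (Suc l) z) (pt (Suc a) (Suc b)) x' (db (Suc l) B) (pt (Suc (Suc a)) b)"
    unfolding tri_def x'_def using l by (simp add: z e1 e2 flip: db_d)
  then have hh: "hhom a b x' (db (Suc l) B)" unfolding hhom_def by blast
  define B' where "B' = d (Suc a) z"
  have B': "B' \<in> K" "hdim B' = Suc a" "vdim B' = Suc (Suc b)" "\<And>i. i \<le> a \<Longrightarrow> d i B' = pt a (Suc (Suc b))"
      "\<And>j. j < l \<Longrightarrow> db j B' = pt (Suc a) (Suc b)"
      "\<And>j. l + 1 < j \<Longrightarrow> j \<le> Suc b \<Longrightarrow> db j B' = pt (Suc a) (Suc b)"
      "db l B' = x" "db (Suc l) B' = x'" "db (Suc (Suc b)) B' = sb l t"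
  proof -
    fix i assume "i \<le> a"
    then show "d i B' = pt a (Suc (Suc b))"
      using d_d[of z a "Suc a"] by (cases "i = a") (simp_all add: B'_def z d_below)
  qed (use l in \<open>simp_all add: B'_def x'_def z W X db_d\<close>)
  have x': "x' \<in> K" "hdim x' = Suc a" "vdim x' = Suc b" using l by (simp_all add: x'_def z)
  \<comment> \<open>comparison with the degenerate triangle \<open>sb l x\<close>\<close>
  let ?J = "{l, Suc (Suc b), Suc (Suc (Suc b))}"
  let ?y = "\<lambda>j. if j = l then sb (Suc b) x else if j = Suc (Suc b) then B' else sb l x"
  have sx: "db j (sb l x) = pt (Suc a) (Suc b)" if "j < l \<or> l + 1 < j \<and> j \<le> Suc b" for j
    using that l by (auto simp: X db_sb_less db_sb_greater)
  have sx': "db j (sb (Suc b) x) = pt (Suc a) (Suc b)" if "j \<le> b" for j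
    using that by (simp add: X db_sb_less)
  have J: "j < l \<or> l + 1 < j \<and> j \<le> Suc b"
    if "j \<le> Suc (Suc (Suc b))" "j \<notin> ?J" "j \<noteq> Suc l" for j
    using that l by auto
  have "\<exists>z. fills (Suc a) (Suc (Suc (Suc b))) (Suc a) (Suc l) {} (\<lambda>_. x) ?J ?y z"
  proof (rule sparse_horn, goal_cases)
    case (11 j j')
    then have "j' < l \<or> l + 1 < j' \<and> j' \<le> Suc b" using J[of j'] l by auto
    with 11 show ?case using l by (auto simp: B' sx sx')
  next
    case (12 j j')
    then have "Suc j' < l \<or> l + 1 < Suc j' \<and> Suc j' \<le> Suc b" using J[of "Suc j'"] l by auto
    with 12 show ?case using l by (auto simp: B' sx sx')
  next
    case (14 j j')
    have "db l (sb l x) = db (Suc b) (sb (Suc b) x)" using l by (simp add: X)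
    moreover have "db (Suc (Suc b)) (sb l x) = sb l t"
      using l by (simp add: X db_sb_greater tx)
    ultimately show ?case using 14 l by (auto simp: B' X)
  next
    case (16 i j)
    then have "i \<le> a" by simp
    with 16 show ?case using l by (auto simp: B' X)
  qed (use l in \<open>auto simp: B' X\<close>)
  then obtain v where "fills (Suc a) (Suc (Suc (Suc b))) (Suc a) (Suc l) {} (\<lambda>_. x) ?J ?y v" ..
  note v = this[unfolded fills_def]
  have v': "db l v = sb (Suc b) x" "db (Suc (Suc b)) v = B'" "db (Suc (Suc (Suc b))) v = sb l x"
    "\<And>j. j < l \<Longrightarrow> db j v = pt (Suc a) (Suc (Suc b))"
    "\<And>j. l + 1 < j \<Longrightarrow> j \<le> Suc b \<Longrightarrow> db j v = pt (Suc a) (Suc (Suc b))"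
    "\<And>i. i \<le> a \<Longrightarrow> d i v = pt a (Suc (Suc (Suc b)))"
    "v \<in> K" "hdim v = Suc a" "vdim v = Suc (Suc (Suc b))"
    using v l by auto
  have e3: "db j (db (Suc l) v) = pt (Suc a) (Suc b)" if "j \<le> b" for j
  proof -
    consider "j < l" | "j = l" | "l < j" by linarith
    then show ?thesis
    proof cases
      case 2
      then have "db j (db (Suc l) v) = db l (db l v)"
        using db_db[of v l "Suc l"] l by (simp add: v')
      then show ?thesis using l by (simp add: v' sx')
    qed (use l that in \<open>simp_all add: v' db_above db_below\<close>)
  qed
  have "vtri a b (db (Suc l) v) (pt (Suc a) (Suc b)) x' x"
    unfolding T.tri_def using l by (simp add: v' e3 B' X db_above flip: db_d)
  then have vh: "T.hhom b a x' x" unfolding T.hhom_def by blast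
  have "x' \<in> rel_cells a b"
    using T.hhom_rel_cells[OF vh] assms(8) by (simp add: T_rel_cells x_def)
  then show ?thesis
    using vhom_aeq[OF vh] hhom_aeq[OF hh] aeq_sym aeq_trans x_def by blast
qed

text \<open>
  The cell \<open>H k l\<close> is the restriction of a homotopy from $\alpha$ to $\beta$ to the product of the
  $k$-th maximal chain $(0,0) < \dots < (k,0) < (k,1) < \dots < (a+1,1)$ of the horizontal
  prism and the $l$-th one of the vertical prism.  The relative cells \<open>\<gamma> l\<close> lead from
  $\alpha$ to a neighbour of $\beta$; consecutive ones are joined by the triangle \<open>B l\<close>, whose
  third face is the end of the chain of homotopies \<open>C k\<close> that starts at a constant path.
\<close>

lemma aeq_of_prism:
  assumes \<alpha>: "\<alpha> \<in> rel_cells a b"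
    and H: "\<And>k l. k \<le> Suc a \<Longrightarrow> l \<le> Suc b \<Longrightarrow> H k l \<in> K \<and> hdim (H k l) = Suc (Suc a) \<and> vdim (H k l) = Suc (Suc b)"
    and d_start: "\<And>l. l \<le> Suc b \<Longrightarrow> d 0 (H 0 l) = sb l \<alpha>"
    and db_start: "\<And>k. k \<le> Suc a \<Longrightarrow> db 0 (H k 0) = s k \<alpha>"
    and d_step: "\<And>k l. k \<le> a \<Longrightarrow> l \<le> Suc b \<Longrightarrow> d (Suc k) (H (Suc k) l) = d (Suc k) (H k l)"
    and db_step: "\<And>k l. k \<le> Suc a \<Longrightarrow> l \<le> b \<Longrightarrow> db (Suc l) (H k (Suc l)) = db (Suc l) (H k l)"
    and d_pt: "\<And>i k l. k \<le> Suc a \<Longrightarrow> l \<le> Suc b \<Longrightarrow> i < k \<or> k + 1 < i \<and> i \<le> Suc a \<Longrightarrow>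
        d i (H k l) = pt (Suc a) (Suc (Suc b))"
    and db_pt: "\<And>j k l. k \<le> Suc a \<Longrightarrow> l \<le> Suc b \<Longrightarrow> j < l \<or> l + 1 < j \<and> j \<le> Suc b \<Longrightarrow>
        db j (H k l) = pt (Suc (Suc a)) (Suc b)"
    and corner: "\<And>k l. k \<le> a \<Longrightarrow> l \<le> b \<Longrightarrow> d (Suc (Suc a)) (db (Suc (Suc b)) (H k l)) = pt (Suc a) (Suc b)"
    and \<beta>: "d (Suc (Suc a)) (db (Suc (Suc b)) (H (Suc a) (Suc b))) = \<beta>"
  shows "aeq a b \<alpha> \<beta>"
proof -
  define B where "B l = d (Suc a) (H (Suc a) l)" for l
  define \<gamma> where "\<gamma> l = db l (B l)" for l
  have B: "B l \<in> K" "hdim (B l) = Suc a" "vdim (B l) = Suc (Suc b)"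
    "\<And>i. i \<le> a \<Longrightarrow> d i (B l) = pt a (Suc (Suc b))"
    "\<And>j. j < l \<or> l + 1 < j \<and> j \<le> Suc b \<Longrightarrow> db j (B l) = pt (Suc a) (Suc b)" if "l \<le> Suc b" for l
  proof -
    note h = H[of "Suc a" l]
    show "B l \<in> K" "hdim (B l) = Suc a" "vdim (B l) = Suc (Suc b)" using h that by (simp_all add: B_def)
    show "d i (B l) = pt a (Suc (Suc b))" if i: "i \<le> a" for i
      using h \<open>l \<le> Suc b\<close> i by (simp add: B_def d_below d_pt)
    show "db j (B l) = pt (Suc a) (Suc b)" if "j < l \<or> l + 1 < j \<and> j \<le> Suc b" for j
    proof -
      have "j \<le> Suc (Suc b)" using that \<open>l \<le> Suc b\<close> by auto
      then have "db j (B l) = d (Suc a) (db j (H (Suc a) l))"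
        using h \<open>l \<le> Suc b\<close> by (simp add: B_def db_d)
      also have "\<dots> = pt (Suc a) (Suc b)" using that \<open>l \<le> Suc b\<close> by (simp add: db_pt)
      finally show ?thesis .
    qed
  qed
  have step: "\<gamma> (Suc l) \<in> rel_cells a b \<and> aeq a b (\<gamma> l) (\<gamma> (Suc l))" if l: "l \<le> b" and x: "\<gamma> l \<in> rel_cells a b" for l
  proof -
    define C where "C k = db (Suc (Suc b)) (H k l)" for k
    define \<rho> where "\<rho> k = (if k = 0 then d 0 (C 0) else d k (C (k - 1)))" for k
    have C: "tri k l (Suc a) b (C k) (\<rho> k) (\<rho> (Suc k)) (pt (Suc a) (Suc b)) (db l (C k))" if "k \<le> a" for k
    proof -
      have h: "H k l \<in> K" "hdim (H k l) = Suc (Suc a)" "vdim (H k l) = Suc (Suc b)" using H[of k l] that l by auto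
      have "d k (C k) = \<rho> k"
      proof (cases k)
        case (Suc k')
        then show ?thesis
          using d_step[of k' l] H[of k' l] h that l by (simp add: \<rho>_def C_def flip: db_d)
      qed (simp add: \<rho>_def)
      moreover have "d i (C k) = pt (Suc a) (Suc b)" if i: "i < k \<or> k + 1 < i \<and> i \<le> Suc (Suc a)" for i
      proof (cases "i = Suc (Suc a)")
        case True
        then show ?thesis using corner[of k l] \<open>k \<le> a\<close> l by (simp add: C_def)
      next
        case False
        then have "d i (C k) = db (Suc (Suc b)) (d i (H k l))"
          using h i \<open>k \<le> a\<close> by (subst db_d) (auto simp: C_def)
        moreover have "d i (H k l) = pt (Suc a) (Suc (Suc b))"
          using False i \<open>k \<le> a\<close> l by (intro d_pt) auto
        ultimately show ?thesis by simp
      qed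
      moreover have "db j (C k) = pt (Suc (Suc a)) b" if j: "j < l \<or> l + 1 < j \<and> j \<le> Suc b" for j
      proof -
        have "j \<le> Suc b" using j l by auto
        then have "db j (C k) = db (Suc b) (db j (H k l))"
          using h by (simp add: C_def db_below)
        then show ?thesis using db_pt[of k l j] j \<open>k \<le> a\<close> l by simp
      qed
      ultimately show ?thesis
        using that l h by (simp add: tri_def C_def \<rho>_def)
    qed
    have "\<rho> 0 = sb l (db (Suc b) \<alpha>)"
      using d_start[of l] H[of 0 l] l rel_cellsD[OF \<alpha>] by (simp add: \<rho>_def C_def db_sb_greater flip: db_d)
    note chain = homotopic_to_const_chain[of a l b C \<rho>, OF C this sphere_target[OF \<alpha>] l]
    have \<rho>: "\<rho> (Suc a) = db (Suc (Suc b)) (B l)"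
      using d_step[of a l] H[of a l] H[of "Suc a" l] l by (simp add: \<rho>_def C_def B_def flip: db_d)
    have \<gamma>: "db (Suc l) (B l) = \<gamma> (Suc l)"
      using db_step[of "Suc a" l] H[of "Suc a" l] H[of "Suc a" "Suc l"] l by (simp add: \<gamma>_def B_def db_d)
    obtain w where w: "tri a l (Suc a) b w (pt (Suc a) (Suc b)) (sb l (db l (\<rho> (Suc a)))) (\<rho> (Suc a))
        (s (Suc a) (db l (\<rho> (Suc a))))"
      by (rule chain) auto
    have "aeq a b (db l (B l)) (db (Suc l) (B l))"
      by (rule aeq_of_path[OF _ _ _ _ _ _ l x[unfolded \<gamma>_def] refl w[unfolded \<rho>]])
        (use B[of l] l in auto)
    then show ?thesis by (auto simp: \<gamma> \<gamma>_def[of l, symmetric] aeq_def)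
  qed
  have \<gamma>0: "\<gamma> 0 = \<alpha>"
    using db_start[of "Suc a"] H[of "Suc a" 0] rel_cellsD[OF \<alpha>] by (simp add: \<gamma>_def B_def db_d)
  have "\<gamma> l \<in> rel_cells a b \<and> aeq a b \<alpha> (\<gamma> l)" if "l \<le> Suc b" for l
    using that
  proof (induction l)
    case 0
    then show ?case using \<alpha> aeq_refl by (simp add: \<gamma>0)
  next
    case (Suc l)
    then show ?case using step[of l] aeq_trans by auto
  qed
  then have \<gamma>: "\<gamma> (Suc b) \<in> rel_cells a b" "aeq a b \<alpha> (\<gamma> (Suc b))" by auto
  let ?H = "H (Suc a) (Suc b)"
  have h: "?H \<in> K" "hdim ?H = Suc (Suc a)" "vdim ?H = Suc (Suc b)" using H by auto
  have "tri a b (Suc a) b (db (Suc (Suc b)) ?H) (pt (Suc a) (Suc b)) (d (Suc a) (db (Suc (Suc b)) ?H)) \<beta>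
     (pt (Suc (Suc a)) b)"
    using h by (simp add: tri_def \<beta> d_pt db_pt db_below flip: db_d)
  then have hh: "hhom a b (d (Suc a) (db (Suc (Suc b)) ?H)) \<beta>" by (auto simp: hhom_def)
  have "T.tri b a (Suc b) a (d (Suc a) ?H) (pt (Suc a) (Suc b)) (\<gamma> (Suc b)) (d (Suc a) (db (Suc (Suc b)) ?H))
     (pt a (Suc (Suc b)))"
    using h by (simp add: T.tri_def \<gamma>_def B_def d_pt db_pt d_below db_d)
  then have vh: "T.hhom b a (\<gamma> (Suc b)) (d (Suc a) (db (Suc (Suc b)) ?H))" by (auto simp: T.hhom_def)
  have "aeq a b (\<gamma> (Suc b)) (d (Suc a) (db (Suc (Suc b)) ?H))"
    by (rule vhom_aeq[OF vh \<gamma>(1)])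
  moreover from this have "aeq a b (d (Suc a) (db (Suc (Suc b)) ?H)) \<beta>"
    using hhom_aeq[OF hh] by (simp add: aeq_def)
  ultimately show ?thesis
    using \<gamma>(2) aeq_trans by blast
qed

end

section \<open>Standard bisimplices and their subcomplexes\<close>

text \<open>
  The face and degeneracy operators of a standard simplex, on lists of values.
\<close>

definition del_nth :: "nat \<Rightarrow> 'a list \<Rightarrow> 'a list" where
  "del_nth i xs = take i xs @ drop (Suc i) xs"

definition dup_nth :: "nat \<Rightarrow> 'a list \<Rightarrow> 'a list" where
  "dup_nth i xs = take (Suc i) xs @ drop i xs"

lemma nth_del: "i < length xs \<Longrightarrow> p < length xs - 1 \<Longrightarrow>
    del_nth i xs ! p = xs ! (if p < i then p else Suc p)"
  by (auto simp: del_nth_def nth_append)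

lemma nth_dup: "i < length xs \<Longrightarrow> p \<le> length xs \<Longrightarrow>
    dup_nth i xs ! p = xs ! (if p \<le> i then p else p - 1)"
  by (auto simp: dup_nth_def nth_append)

lemma length_del [simp]: "i < length xs \<Longrightarrow> length (del_nth i xs) = length xs - 1"
  by (auto simp: del_nth_def)

lemma length_dup [simp]: "i < length xs \<Longrightarrow> length (dup_nth i xs) = Suc (length xs)"
  by (auto simp: dup_nth_def)

lemma set_del: "set (del_nth i xs) \<subseteq> set xs"
  using set_take_subset set_drop_subset by (fastforce simp: del_nth_def)

lemma set_dup: "set (dup_nth i xs) \<subseteq> set xs"
  using set_take_subset set_drop_subset by (fastforce simp: dup_nth_def)

lemma map_del: "map f (del_nth i xs) = del_nth i (map f xs)"
  by (simp add: del_nth_def take_map drop_map)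

lemma map_dup: "map f (dup_nth i xs) = dup_nth i (map f xs)"
  by (simp add: dup_nth_def take_map drop_map)

lemma sorted_del: "sorted (xs :: nat list) \<Longrightarrow> i < length xs \<Longrightarrow> sorted (del_nth i xs)"
  by (auto simp: sorted_iff_nth_mono nth_del)

lemma sorted_dup: "sorted (xs :: nat list) \<Longrightarrow> i < length xs \<Longrightarrow> sorted (dup_nth i xs)"
  by (auto simp: sorted_iff_nth_mono nth_dup)

lemma Delta_simps [simp]:
  "xs \<in> simplices (Delta m) k \<longleftrightarrow> length xs = Suc k \<and> sorted xs \<and> set xs \<subseteq> {..m}"
  "face (Delta m) k i xs = del_nth i xs" "degen (Delta m) k i xs = dup_nth i xs"
  by (auto simp: Delta_def del_nth_def dup_nth_def)

lemma simplicial_set_Delta: "simplicial_set (Delta m)"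
proof (unfold_locales, goal_cases)
  case (1 k i x)
  then show ?case using set_del[of i x] by (auto simp: sorted_del)
next
  case (2 k i x)
  then show ?case using set_dup[of i x] by (auto simp: sorted_dup)
qed (auto intro!: nth_equalityI simp: nth_del nth_dup)

text \<open>
  Subsets that are closed under the operators are simplicial, respectively bisimplicial, sets.
\<close>

lemma simplicial_subset:
  assumes "simplicial_set A" "\<And>k. S k \<subseteq> simplices A k"
    and "\<And>k i x. i \<le> Suc k \<Longrightarrow> x \<in> S (Suc k) \<Longrightarrow> face A (Suc k) i x \<in> S k"
    and "\<And>k i x. i \<le> k \<Longrightarrow> x \<in> S k \<Longrightarrow> degen A k i x \<in> S (Suc k)"
  shows "simplicial_set (A\<lparr>simplices := S\<rparr>)"
proof -
  interpret simplicial_set A by (rule assms)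
  show ?thesis
    by unfold_locales (use assms(2-) in \<open>auto simp: subset_iff face_face face_degen_less face_degen_same face_degen_greater degen_degen\<close>)
qed

lemma bisimplicial_set_boxtimes:
  assumes "simplicial_set A" "simplicial_set B"
  shows "bisimplicial_set (boxtimes A B)"
proof -
  interpret A: simplicial_set A by (rule assms)
  interpret B: simplicial_set B by (rule assms)
  show ?thesis
  proof (rule bisimplicial_set.intro)
    show "simplicial_set (hrow (boxtimes A B) n)" for n
      by unfold_locales
        (auto simp: hrow_def boxtimes_def A.face_closed A.degen_closed A.face_face A.face_degen_less A.face_degen_same
          A.face_degen_greater A.degen_degen)
    show "simplicial_set (vcol (boxtimes A B) n)" for n
      by unfold_locales
        (auto simp: vcol_def boxtimes_def B.face_closed B.degen_closed B.face_face B.face_degen_less B.face_degen_same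
          B.face_degen_greater B.degen_degen)
  qed (auto simp: boxtimes_def)
qed

lemma bisimplicial_subset:
  assumes X: "bisimplicial_set X" and S: "\<And>m n. S m n \<subseteq> cells X m n"
    and "\<And>m n i x. i \<le> Suc m \<Longrightarrow> x \<in> S (Suc m) n \<Longrightarrow> hface X (Suc m) n i x \<in> S m n"
    and "\<And>m n i x. i \<le> m \<Longrightarrow> x \<in> S m n \<Longrightarrow> hdegen X m n i x \<in> S (Suc m) n"
    and "\<And>m n j x. j \<le> Suc n \<Longrightarrow> x \<in> S m (Suc n) \<Longrightarrow> vface X m (Suc n) j x \<in> S m n"
    and "\<And>m n j x. j \<le> n \<Longrightarrow> x \<in> S m n \<Longrightarrow> vdegen X m n j x \<in> S m (Suc n)"
  shows "bisimplicial_set (X\<lparr>cells := S\<rparr>)"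
proof -
  interpret bisimplicial_set X by (rule X)
  show ?thesis
  proof (rule bisimplicial_set.intro)
    fix n
    have "hrow (X\<lparr>cells := S\<rparr>) n = (hrow X n)\<lparr>simplices := (\<lambda>m. S m n)\<rparr>"
      by (simp add: hrow_def)
    moreover have "simplicial_set ((hrow X n)\<lparr>simplices := (\<lambda>m. S m n)\<rparr>)"
      by (rule simplicial_subset[OF row]) (use assms in \<open>auto simp: hrow_def\<close>)
    ultimately show "simplicial_set (hrow (X\<lparr>cells := S\<rparr>) n)" by simp
  next
    fix m
    have "vcol (X\<lparr>cells := S\<rparr>) m = (vcol X m)\<lparr>simplices := S m\<rparr>"
      by (simp add: vcol_def)
    moreover have "simplicial_set ((vcol X m)\<lparr>simplices := S m\<rparr>)"
      by (rule simplicial_subset[OF col]) (use assms in \<open>auto simp: vcol_def\<close>)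
    ultimately show "simplicial_set (vcol (X\<lparr>cells := S\<rparr>) m)" by simp
  qed (use S in \<open>auto simp: subset_iff hface_vface hface_vdegen hdegen_vface hdegen_vdegen\<close>)
qed

lemma bisimplicial_set_Delta2: "bisimplicial_set (Delta2 m n)"
  unfolding Delta2_def by (intro bisimplicial_set_boxtimes simplicial_set_Delta)

lemma Delta2_simps [simp]:
  "(xs, ys) \<in> cells (Delta2 m n) p q \<longleftrightarrow>
     length xs = Suc p \<and> sorted xs \<and> set xs \<subseteq> {..m} \<and> length ys = Suc q \<and> sorted ys \<and> set ys \<subseteq> {..n}"
  "hface (Delta2 m n) p q i = apfst (del_nth i)" "hdegen (Delta2 m n) p q i = apfst (dup_nth i)"
  "vface (Delta2 m n) p q i = apsnd (del_nth i)" "vdegen (Delta2 m n) p q i = apsnd (dup_nth i)"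
  by (auto simp: Delta2_def boxtimes_def)

lemma Horn2_eq: "Horn2 m k n l = (Delta2 m n)\<lparr>cells := \<lambda>p q. {(xs, ys) \<in> cells (Delta2 m n) p q.
    (\<exists>i\<le>m. i \<noteq> k \<and> i \<notin> set xs) \<or> (\<exists>j\<le>n. j \<noteq> l \<and> j \<notin> set ys)}\<rparr>"
proof -
  have "cells (Horn2 m k n l) p q = {(xs, ys). (xs, ys) \<in> cells (Delta2 m n) p q \<and>
    ((\<exists>i\<le>m. i \<noteq> k \<and> i \<notin> set xs) \<or> (\<exists>j\<le>n. j \<noteq> l \<and> j \<notin> set ys))}" for p q
    unfolding Horn2_def bunion_def boxtimes_def Horn_def face_simplices_def by auto
  then show ?thesis
    by (intro bisset.equality ext)
      (simp_all add: Horn2_def bunion_def boxtimes_def Horn_def Delta2_def Delta_def)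
qed

lemma delta_A_eq: "delta_A m n = (Delta2 m n)\<lparr>cells := \<lambda>p q. {(xs, ys) \<in> cells (Delta2 m n) p q.
    (\<exists>i<m. i \<notin> set xs) \<or> (\<exists>j<n. j \<notin> set ys) \<or> (\<exists>i\<le>m. i \<notin> set xs) \<and> (\<exists>j\<le>n. j \<notin> set ys)}\<rparr>"
proof -
  have lt: "{..m} - {m} = {..<m}" for m :: nat by auto
  have "cells (delta_A m n) p q = {(xs, ys). (xs, ys) \<in> cells (Delta2 m n) p q \<and>
    ((\<exists>i<m. i \<notin> set xs) \<or> (\<exists>j<n. j \<notin> set ys) \<or> (\<exists>i\<le>m. i \<notin> set xs) \<and> (\<exists>j\<le>n. j \<notin> set ys))}" for p q
    unfolding delta_A_def bunion_def boxtimes_def Horn_def Boundary_def face_simplices_def lt by auto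
  then show ?thesis
    by (intro bisset.equality ext)
      (simp_all add: delta_A_def bunion_def boxtimes_def Horn_def Boundary_def Delta2_def Delta_def)
qed

lemma bisimplicial_set_Horn2: "bisimplicial_set (Horn2 m k n l)"
  unfolding Horn2_eq
proof (rule bisimplicial_subset[OF bisimplicial_set_Delta2], goal_cases)
  case (2 p q i x)
  then show ?case using set_del[of i "fst x"] by (cases x) (auto simp: sorted_del)
next
  case (3 p q i x)
  then show ?case using set_dup[of i "fst x"] by (cases x) (auto simp: sorted_dup)
next
  case (4 p q i x)
  then show ?case using set_del[of i "snd x"] by (cases x) (auto simp: sorted_del)
next
  case (5 p q i x)
  then show ?case using set_dup[of i "snd x"] by (cases x) (auto simp: sorted_dup)
qed auto

section \<open>Extension of maps along horns\<close>

text \<open>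
  Transport of structure along an injection \<open>f\<close>; the operators are only meaningful on the range of
  \<open>f\<close>.
\<close>

definition bimage :: "('a \<Rightarrow> 'b) \<Rightarrow> 'a bisset \<Rightarrow> 'b bisset" where
  "bimage f A = \<lparr>cells = (\<lambda>m n. f ` cells A m n),
     hface = (\<lambda>m n i. f \<circ> hface A m n i \<circ> the_inv f),
     hdegen = (\<lambda>m n i. f \<circ> hdegen A m n i \<circ> the_inv f),
     vface = (\<lambda>m n i. f \<circ> vface A m n i \<circ> the_inv f),
     vdegen = (\<lambda>m n i. f \<circ> vdegen A m n i \<circ> the_inv f)\<rparr>"

lemma bimage_simps [simp]:
  "cells (bimage f A) m n = f ` cells A m n"
  "inj f \<Longrightarrow> hface (bimage f A) m n i (f x) = f (hface A m n i x)"
  "inj f \<Longrightarrow> hdegen (bimage f A) m n i (f x) = f (hdegen A m n i x)"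
  "inj f \<Longrightarrow> vface (bimage f A) m n i (f x) = f (vface A m n i x)"
  "inj f \<Longrightarrow> vdegen (bimage f A) m n i (f x) = f (vdegen A m n i x)"
  by (simp_all add: bimage_def the_inv_f_f)

lemma bisimplicial_closed:
  assumes "bisimplicial_set A"
  shows "x \<in> cells A (Suc m) n \<Longrightarrow> i \<le> Suc m \<Longrightarrow> hface A (Suc m) n i x \<in> cells A m n"
    "x \<in> cells A m n \<Longrightarrow> i \<le> m \<Longrightarrow> hdegen A m n i x \<in> cells A (Suc m) n"
    "x \<in> cells A m (Suc n) \<Longrightarrow> j \<le> Suc n \<Longrightarrow> vface A m (Suc n) j x \<in> cells A m n"
    "x \<in> cells A m n \<Longrightarrow> j \<le> n \<Longrightarrow> vdegen A m n j x \<in> cells A m (Suc n)"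
proof -
  interpret bisimplicial_set A by (rule assms)
  interpret row: simplicial_set "hrow A n" by (rule row)
  interpret col: simplicial_set "vcol A m" by (rule col)
  show "x \<in> cells A (Suc m) n \<Longrightarrow> i \<le> Suc m \<Longrightarrow> hface A (Suc m) n i x \<in> cells A m n"
    "x \<in> cells A m n \<Longrightarrow> i \<le> m \<Longrightarrow> hdegen A m n i x \<in> cells A (Suc m) n"
    "x \<in> cells A m (Suc n) \<Longrightarrow> j \<le> Suc n \<Longrightarrow> vface A m (Suc n) j x \<in> cells A m n"
    "x \<in> cells A m n \<Longrightarrow> j \<le> n \<Longrightarrow> vdegen A m n j x \<in> cells A m (Suc n)"
    using row.face_closed row.degen_closed col.face_closed col.degen_closed by (auto simp: hrow_def vcol_def)
qed

lemma bisimplicial_set_bimage: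
  assumes A: "bisimplicial_set A" and f: "inj f"
  shows "bisimplicial_set (bimage f A)"
proof -
  interpret bisimplicial_set A by (rule A)
  show ?thesis
  proof (rule bisimplicial_set.intro)
    show "simplicial_set (hrow (bimage f A) n)" for n
    proof -
      interpret row: simplicial_set "hrow A n" by (rule row)
      show ?thesis
        by unfold_locales
          (use row.face_closed row.degen_closed row.face_face row.face_degen_less row.face_degen_same
            row.face_degen_greater row.degen_degen in \<open>auto simp: hrow_def f\<close>)
    qed
    show "simplicial_set (vcol (bimage f A) n)" for n
    proof -
      interpret col: simplicial_set "vcol A n" by (rule col)
      show ?thesis
        by unfold_locales
          (use col.face_closed col.degen_closed col.face_face col.face_degen_less col.face_degen_same
            col.face_degen_greater col.degen_degen in \<open>auto simp: vcol_def f\<close>)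
    qed
  qed (auto simp: f hface_vface hface_vdegen hdegen_vface hdegen_vdegen)
qed

lemma biso_bimage:
  assumes A: "bisimplicial_set A" and f: "inj f"
  shows "(\<lambda>m n. restrict f (cells A m n)) \<in> biso A (bimage f A)"
proof -
  let ?g = "\<lambda>m n. restrict (the_inv f) (f ` cells A m n)"
  note C = bisimplicial_closed[OF A]
  have "?g \<in> bihom (bimage f A) A"
    by (auto simp: bihom_def f the_inv_f_f C)
  moreover have "(\<lambda>m n. restrict f (cells A m n)) \<in> bihom A (bimage f A)"
    by (auto simp: bihom_def f C)
  moreover have "bcomp A ?g (\<lambda>m n. restrict f (cells A m n)) = bid A"
    by (auto simp: bcomp_def bid_def compose_def fun_eq_iff f the_inv_f_f)
  moreover have "bcomp (bimage f A) (\<lambda>m n. restrict f (cells A m n)) ?g = bid (bimage f A)"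
    by (auto simp: bcomp_def bid_def compose_def fun_eq_iff f the_inv_f_f)
  ultimately show ?thesis unfolding biso_def by blast
qed

lemma bihomD:
  assumes "f \<in> bihom A B"
  shows "x \<in> cells A m n \<Longrightarrow> f m n x \<in> cells B m n"
    "x \<notin> cells A m n \<Longrightarrow> f m n x = undefined"
    "x \<in> cells A (Suc m) n \<Longrightarrow> i \<le> Suc m \<Longrightarrow> f m n (hface A (Suc m) n i x) = hface B (Suc m) n i (f (Suc m) n x)"
    "x \<in> cells A m n \<Longrightarrow> i \<le> m \<Longrightarrow> f (Suc m) n (hdegen A m n i x) = hdegen B m n i (f m n x)"
    "x \<in> cells A m (Suc n) \<Longrightarrow> i \<le> Suc n \<Longrightarrow> f m n (vface A m (Suc n) i x) = vface B m (Suc n) i (f m (Suc n) x)"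
    "x \<in> cells A m n \<Longrightarrow> i \<le> n \<Longrightarrow> f m (Suc n) (vdegen A m n i x) = vdegen B m n i (f m n x)"
proof -
  note f = assms[unfolded bihom_def mem_Collect_eq]
  have 0: "f m n \<in> cells A m n \<rightarrow>\<^sub>E cells B m n" for m n
    using f by simp
  show "x \<in> cells A m n \<Longrightarrow> f m n x \<in> cells B m n"
    by (rule PiE_mem[OF 0])
  show "x \<notin> cells A m n \<Longrightarrow> f m n x = undefined"
    by (rule PiE_arb[OF 0])
qed (use assms in \<open>simp_all add: bihom_def\<close>)

lemma bihomI:
  assumes "\<And>m n x. x \<in> cells A m n \<Longrightarrow> f m n x \<in> cells B m n"
    "\<And>m n x. x \<notin> cells A m n \<Longrightarrow> f m n x = undefined"
    "\<And>m n i x. x \<in> cells A (Suc m) n \<Longrightarrow> i \<le> Suc m \<Longrightarrow> f m n (hface A (Suc m) n i x) = hface B (Suc m) n i (f (Suc m) n x)"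
    "\<And>m n i x. x \<in> cells A m n \<Longrightarrow> i \<le> m \<Longrightarrow> f (Suc m) n (hdegen A m n i x) = hdegen B m n i (f m n x)"
    "\<And>m n i x. x \<in> cells A m (Suc n) \<Longrightarrow> i \<le> Suc n \<Longrightarrow> f m n (vface A m (Suc n) i x) = vface B m (Suc n) i (f m (Suc n) x)"
    "\<And>m n i x. x \<in> cells A m n \<Longrightarrow> i \<le> n \<Longrightarrow> f m (Suc n) (vdegen A m n i x) = vdegen B m n i (f m n x)"
  shows "f \<in> bihom A B"
  unfolding bihom_def using assms by (auto intro: PiE_I)

lemma bcomp_in_bihom:
  assumes A: "bisimplicial_set A" and f: "f \<in> bihom A B" and g: "g \<in> bihom B C"
  shows "bcomp A g f \<in> bihom A C"
  by (rule bihomI)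
    (simp_all add: bcomp_def compose_def bihomD[OF f] bihomD[OF g] bisimplicial_closed[OF A])

lemma bcomp_apply: "x \<in> cells A m n \<Longrightarrow> bcomp A g f m n x = g m n (f m n x)"
  by (simp add: bcomp_def compose_def)

lemma to_point_in_bihom:
  assumes "bisimplicial_set A"
  shows "to_point A \<in> bihom A (Delta2 0 0)"
proof -
  have del: "del_nth i (replicate (Suc p) (0::nat)) = replicate p 0" if "i \<le> p" for i p
    using that by (intro nth_equalityI) (auto simp: nth_del simp del: replicate.simps)
  have dup: "dup_nth i (replicate p (0::nat)) = replicate (Suc p) 0" if "i < p" for i p
    using that by (intro nth_equalityI) (auto simp: nth_dup simp del: replicate.simps)
  show ?thesis
    by (rule bihomI)
      (auto simp: to_point_def bisimplicial_closed[OF assms] del dup simp del: replicate.simps)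
qed

lemma bcomp_to_point:
  assumes "f \<in> bihom A B"
  shows "bcomp A (to_point B) f = to_point A"
  using bihomD(1)[OF assms] by (auto simp: bcomp_def compose_def to_point_def fun_eq_iff restrict_def)

text \<open>
  Fibrancy is tested in the universe \<open>'u\<close>.  Since \<open>'u\<close> is infinite and bisimplices form a
  countable type, every horn inclusion has an isomorphic copy in \<open>'u\<close>, and this copy is an anodyne
  extension.
\<close>

lemma fibrant_extend:
  fixes X :: "'a bisset"
  assumes fib: "fibrant TYPE('u :: infinite) X" and u: "u \<in> bihom (Horn2 m k n l) X"
    and mn: "1 \<le> m" "1 \<le> n" "k \<le> m" "l \<le> n"
  obtains w where "w \<in> bihom (Delta2 m n) X" "brestr (Horn2 m k n l) w = u"
proof -
  let ?H = "Horn2 m k n l" and ?D = "Delta2 m n"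
  obtain e :: "nat \<Rightarrow> 'u" where "inj e"
    using infinite_countable_subset[OF infinite_UNIV[where ?'a = 'u]] by auto
  define \<phi> :: "bisimplex \<Rightarrow> 'u" where "\<phi> = e \<circ> to_nat"
  have \<phi>: "inj \<phi>" unfolding \<phi>_def by (intro inj_compose \<open>inj e\<close> inj_to_nat)
  note H = bisimplicial_set_Horn2[of m k n l] and D = bisimplicial_set_Delta2[of m n]
  have sub: "cells ?H p q \<subseteq> cells ?D p q" for p q by (auto simp: Horn2_eq)
  let ?A = "bimage \<phi> ?H" and ?B = "bimage \<phi> ?D"
  note A = bisimplicial_set_bimage[OF H \<phi>] and B = bisimplicial_set_bimage[OF D \<phi>]
  let ?a = "\<lambda>p q. restrict \<phi> (cells ?H p q)" and ?b = "\<lambda>p q. restrict \<phi> (cells ?D p q)"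
  let ?f = "\<lambda>p q. restrict (\<lambda>x. x) (cells ?A p q)"
  have ops: "hface ?H = hface ?D" "hdegen ?H = hdegen ?D" "vface ?H = vface ?D" "vdegen ?H = vdegen ?D"
    by (simp_all add: Horn2_eq)
  have f: "?f \<in> bihom ?A ?B"
    by (rule bihomI)
      (use sub in \<open>auto simp: \<phi> inj_image_mem_iff[OF \<phi>] bisimplicial_closed[OF H]
        simp del: Delta2_simps(2-5) simp flip: ops\<close>)
  have a: "?a \<in> biso ?H ?A" by (rule biso_bimage[OF H \<phi>])
  have b: "?b \<in> biso ?D ?B" by (rule biso_bimage[OF D \<phi>])
  have fa: "bcomp ?H ?f ?a = brestr ?H ?b"
    using subsetD[OF sub]
    by (auto simp: bcomp_def compose_def brestr_def fun_eq_iff restrict_def simp del: Delta2_simps)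
  have "horn_map ?A ?B ?f"
    unfolding horn_map_def using A B f a b fa mn by blast
  then have an: "anodyne ?A ?B ?f"
    unfolding anodyne_def by (auto simp: mono_bmap_def inj_on_def)
  \<comment> \<open>the lifting problem for the copy; the square commutes because its target is terminal\<close>
  obtain a' where a': "a' \<in> bihom ?A ?H" "bcomp ?H a' ?a = bid ?H"
    using a unfolding biso_def by blast
  let ?u = "bcomp ?A u a'"
  have u': "?u \<in> bihom ?A X" by (rule bcomp_in_bihom[OF A a'(1) u])
  have pB: "to_point ?B \<in> bihom ?B (Delta2 0 0)" by (rule to_point_in_bihom[OF B])
  have "bcomp ?A (to_point X) ?u = bcomp ?A (to_point ?B) ?f"
    by (simp only: bcomp_to_point[OF u'] bcomp_to_point[OF f])
  then obtain w where w: "w \<in> bihom ?B X" "bcomp ?A w ?f = ?u"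
    using fib[unfolded fibrant_def fibration_def] an u' pB by blast
  have b': "?b \<in> bihom ?D ?B" using b unfolding biso_def by blast
  show thesis
  proof (rule that)
    show "bcomp ?D w ?b \<in> bihom ?D X" by (rule bcomp_in_bihom[OF D b' w(1)])
    show "brestr ?H (bcomp ?D w ?b) = u"
    proof (intro ext)
      fix p q x
      show "brestr ?H (bcomp ?D w ?b) p q x = u p q x"
      proof (cases "x \<in> cells ?H p q")
        case True
        have "w p q (\<phi> x) = bcomp ?A w ?f p q (\<phi> x)" using True by (simp add: bcomp_apply)
        also have "\<dots> = u p q (a' p q (\<phi> x))" unfolding w(2) using True by (simp add: bcomp_apply)
        also have "a' p q (\<phi> x) = x"
          using fun_cong[OF fun_cong[OF fun_cong[OF a'(2)]], of p q x] True
          by (simp add: bcomp_apply bid_def)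
        finally show ?thesis using True sub[of p q] by (auto simp: brestr_def bcomp_apply)
      qed (simp add: brestr_def bihomD(2)[OF u])
    qed
  qed
qed

text \<open>
  The map $\theta$ composed with the map of standard bisimplices induced by \<open>f\<close> and
  \<open>g\<close>; the arguments \<open>m\<close> and \<open>n\<close> are the dimensions of the source.
\<close>

definition pull :: "nat \<Rightarrow> nat \<Rightarrow> (nat \<Rightarrow> nat) \<Rightarrow> (nat \<Rightarrow> nat) \<Rightarrow> (bisimplex, 'a) bmap \<Rightarrow> (bisimplex, 'a) bmap" where
  "pull m n f g \<theta> = bcomp (Delta2 m n) \<theta> (std_map m n f g)"

lemma pull_apply:
  "(xs, ys) \<in> cells (Delta2 m n) p q \<Longrightarrow> pull m n f g \<theta> p q (xs, ys) = \<theta> p q (map f xs, map g ys)"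
  by (simp add: pull_def bcomp_apply std_map_def)

lemma pull_undefined: "x \<notin> cells (Delta2 m n) p q \<Longrightarrow> pull m n f g \<theta> p q x = undefined"
  by (simp add: pull_def bcomp_def compose_def)

text \<open>
  Monotone maps $[m'] \to [m]$; their values outside $[m']$ are irrelevant.
\<close>

definition mor :: "nat \<Rightarrow> nat \<Rightarrow> (nat \<Rightarrow> nat) \<Rightarrow> bool" where
  "mor m' m f \<longleftrightarrow> (\<forall>i\<le>m'. f i \<le> m) \<and> (\<forall>i j. i \<le> j \<longrightarrow> j \<le> m' \<longrightarrow> f i \<le> f j)"

lemma mor_sorted: "mor m' m f \<Longrightarrow> sorted xs \<Longrightarrow> set xs \<subseteq> {..m'} \<Longrightarrow> sorted (map f xs)"
  by (induction xs) (auto simp: mor_def subset_iff)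

lemma mor_set: "mor m' m f \<Longrightarrow> set xs \<subseteq> {..m'} \<Longrightarrow> set (map f xs) \<subseteq> {..m}"
  by (auto simp: mor_def)

lemma mor_intros [simp]:
  "mor m m id" "i \<le> Suc m \<Longrightarrow> mor m (Suc m) (coface i)" "i \<le> m \<Longrightarrow> mor (Suc m) m (codegen i)"
  by (auto simp: mor_def coface_def codegen_def)

lemma std_map_in_bihom:
  assumes f: "mor m' m f" and g: "mor n' n g"
  shows "std_map m' n' f g \<in> bihom (Delta2 m' n') (Delta2 m n)"
proof -
  have del: "set (del_nth i xs) \<subseteq> A" and dup: "set (dup_nth i xs) \<subseteq> A" if "set xs \<subseteq> A" for i A and xs :: "nat list"
    using subset_trans[OF set_del that] subset_trans[OF set_dup that] by simp_all
  have im: "h ` set xs \<subseteq> {..k}" if "mor k' k h" "set xs \<subseteq> {..k'}" for h k k' xs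
    using mor_set[OF that] by simp
  show ?thesis
    by (rule bihomI)
      (auto simp: std_map_def sorted_del sorted_dup map_del map_dup del dup
        mor_sorted[OF f] mor_sorted[OF g] im[OF f] im[OF g] simp del: image_subset_iff)
qed

lemma std_map_closed:
  assumes "mor m' m f" "mor n' n g" "(xs, ys) \<in> cells (Delta2 m' n') p q"
  shows "(map f xs, map g ys) \<in> cells (Delta2 m n) p q"
  using bihomD(1)[OF std_map_in_bihom[OF assms(1,2)] assms(3)] assms(3) by (simp add: std_map_def)

lemma pull_in_bihom:
  assumes "\<theta> \<in> bihom (Delta2 m n) X" "mor m' m f" "mor n' n g"
  shows "pull m' n' f g \<theta> \<in> bihom (Delta2 m' n') X"
  unfolding pull_def
  by (rule bcomp_in_bihom[OF bisimplicial_set_Delta2 std_map_in_bihom[OF assms(2,3)] assms(1)])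

lemma pull_pull:
  assumes "mor m'' m' f'" "mor n'' n' g'"
  shows "pull m'' n'' f' g' (pull m' n' f g \<theta>) = pull m'' n'' (f \<circ> f') (g \<circ> g') \<theta>"
proof (intro ext)
  fix p q x
  show "pull m'' n'' f' g' (pull m' n' f g \<theta>) p q x = pull m'' n'' (f \<circ> f') (g \<circ> g') \<theta> p q x"
  proof (cases "x \<in> cells (Delta2 m'' n'') p q")
    case True
    obtain xs ys where x: "x = (xs, ys)" by (cases x)
    have "(map f' xs, map g' ys) \<in> cells (Delta2 m' n') p q"
      by (rule std_map_closed[OF assms True[unfolded x]])
    then show ?thesis using True unfolding x by (simp only: pull_apply map_map)
  qed (simp add: pull_undefined)
qed

lemma pull_cong:
  assumes "\<And>i. i \<le> m \<Longrightarrow> f i = f' i" "\<And>j. j \<le> n \<Longrightarrow> g j = g' j"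
  shows "pull m n f g \<theta> = pull m n f' g' \<theta>"
proof (intro ext)
  fix p q x
  show "pull m n f g \<theta> p q x = pull m n f' g' \<theta> p q x"
  proof (cases "x \<in> cells (Delta2 m n) p q")
    case True
    obtain xs ys where x: "x = (xs, ys)" by (cases x)
    have "map f xs = map f' xs" "map g ys = map g' ys"
      using True assms by (auto simp: x)
    then show ?thesis using True unfolding x by (simp only: pull_apply)
  qed (simp add: pull_undefined)
qed

lemma pull_id:
  assumes "\<theta> \<in> bihom (Delta2 m n) X" "\<And>i. i \<le> m \<Longrightarrow> f i = i" "\<And>j. j \<le> n \<Longrightarrow> g j = j"
  shows "pull m n f g \<theta> = \<theta>"
proof (intro ext)
  fix p q x
  show "pull m n f g \<theta> p q x = \<theta> p q x"
  proof (cases "x \<in> cells (Delta2 m n) p q")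
    case True
    obtain xs ys where x: "x = (xs, ys)" by (cases x)
    have "map f xs = xs" "map g ys = ys"
      using True assms(2,3) by (auto simp: x subset_iff intro!: map_idI)
    then show ?thesis using True unfolding x by (simp only: pull_apply)
  qed (simp add: pull_undefined bihomD(2)[OF assms(1)])
qed

lemma d_map_pull: "d_map m n i \<theta> = pull (m - 1) n (coface i) id \<theta>"
  and s_map_pull: "s_map m n i \<theta> = pull (Suc m) n (codegen i) id \<theta>"
  and dbar_map_pull: "dbar_map m n i \<theta> = pull m (n - 1) id (coface i) \<theta>"
  and sbar_map_pull: "sbar_map m n i \<theta> = pull m (Suc n) id (codegen i) \<theta>"
  by (simp_all add: d_map_def s_map_def dbar_map_def sbar_map_def pull_def)

lemma const_map_apply: "x \<in> cells K p q \<Longrightarrow> const_map pt K p q x = pt p q (replicate (Suc p) 0, replicate (Suc q) 0)"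
  by (simp add: const_map_def bcomp_apply to_point_def)

lemma const_map_undefined: "x \<notin> cells K p q \<Longrightarrow> const_map pt K p q x = undefined"
  by (simp add: const_map_def bcomp_def compose_def)

lemma const_map_in_bihom:
  "pt \<in> bihom (Delta2 0 0) X \<Longrightarrow> bisimplicial_set K \<Longrightarrow> const_map pt K \<in> bihom K X"
  unfolding const_map_def by (rule bcomp_in_bihom[OF _ to_point_in_bihom])

lemma pull_const:
  assumes "mor m' m f" "mor n' n g"
  shows "pull m' n' f g (const_map pt (Delta2 m n)) = const_map pt (Delta2 m' n')"
proof (intro ext)
  fix p q x
  show "pull m' n' f g (const_map pt (Delta2 m n)) p q x = const_map pt (Delta2 m' n') p q x"
  proof (cases "x \<in> cells (Delta2 m' n') p q")
    case True
    have "std_map m' n' f g p q x \<in> cells (Delta2 m n) p q"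
      by (rule bihomD(1)[OF std_map_in_bihom[OF assms] True])
    then show ?thesis using True by (simp add: pull_def bcomp_apply const_map_apply)
  qed (simp add: pull_undefined const_map_undefined)
qed

text \<open>
  A simplex that omits the value \<open>i\<close> factors through $\delta^i$, and $\sigma^i$ recovers the
  factor.
\<close>

lemma omit_lower:
  assumes "(xs, ys) \<in> cells (Delta2 m n) p q" "i \<notin> set xs" "i \<le> m"
  shows "(map (codegen i) xs, ys) \<in> cells (Delta2 (m - 1) n) p q"
    and "map (coface i) (map (codegen i) xs) = xs"
proof -
  show "map (coface i) (map (codegen i) xs) = xs"
    using assms by (intro nth_equalityI) (auto simp: coface_def codegen_def)
  have "sorted (map (codegen i) xs)"
    by (rule mor_sorted[of m m]) (use assms in \<open>auto simp: mor_def codegen_def\<close>)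
  moreover have "codegen i v \<le> m - 1" if "v \<in> set xs" for v
  proof -
    have "v \<le> m" "v \<noteq> i" using assms that by auto
    then show ?thesis using \<open>i \<le> m\<close> by (auto simp: codegen_def)
  qed
  ultimately show "(map (codegen i) xs, ys) \<in> cells (Delta2 (m - 1) n) p q"
    using assms by auto
qed

lemma omit_lower_v:
  assumes "(xs, ys) \<in> cells (Delta2 m n) p q" "j \<notin> set ys" "j \<le> n"
  shows "(xs, map (codegen j) ys) \<in> cells (Delta2 m (n - 1)) p q"
    and "map (coface j) (map (codegen j) ys) = ys"
  using omit_lower[of ys xs n m q p j] assms by simp_all

lemma d_map_omit:
  assumes "(xs, ys) \<in> cells (Delta2 m n) p q" "i \<notin> set xs" "i \<le> m"
  shows "d_map m n i \<theta> p q (map (codegen i) xs, ys) = \<theta> p q (xs, ys)"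
  unfolding d_map_pull pull_apply[OF omit_lower(1)[OF assms]] omit_lower(2)[OF assms] by simp

lemma dbar_map_omit:
  assumes "(xs, ys) \<in> cells (Delta2 m n) p q" "j \<notin> set ys" "j \<le> n"
  shows "dbar_map m n j \<theta> p q (xs, map (codegen j) ys) = \<theta> p q (xs, ys)"
  unfolding dbar_map_pull pull_apply[OF omit_lower_v(1)[OF assms]] omit_lower_v(2)[OF assms] by simp

lemma two_omitted:
  assumes "i < i'" "i \<notin> set xs" "i' \<notin> set xs"
  shows "map (codegen i) (map (codegen i') xs) = map (codegen (i' - 1)) (map (codegen i) xs)"
    "i \<notin> set (map (codegen i') xs)" "i' - 1 \<notin> set (map (codegen i) xs)"
proof -
  have *: "x \<noteq> i" "x \<noteq> i'" if "x \<in> set xs" for x using assms that by auto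
  show "map (codegen i) (map (codegen i') xs) = map (codegen (i' - 1)) (map (codegen i) xs)"
    using * assms(1) by (auto simp: codegen_def)
  have "codegen i' v \<noteq> i" "codegen i v \<noteq> i' - 1" if "v \<in> set xs" for v
    using *[OF that] assms(1) by (auto simp: codegen_def)
  then show "i \<notin> set (map (codegen i') xs)" "i' - 1 \<notin> set (map (codegen i) xs)"
    by fastforce+
qed

text \<open>
  Matching families of maps glue to a map on the horn: its value at a cell is computed with any face that
  contains the cell.
\<close>

lemma horn_fill_maps:
  fixes X :: "'a bisset"
  assumes fib: "fibrant TYPE('u :: infinite) X"
    and mn: "0 < m" "0 < n" "k \<le> m" "l \<le> n"
    and x: "\<And>i. i \<le> m \<Longrightarrow> i \<noteq> k \<Longrightarrow> x i \<in> bihom (Delta2 (m - 1) n) X"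
    and y: "\<And>j. j \<le> n \<Longrightarrow> j \<noteq> l \<Longrightarrow> y j \<in> bihom (Delta2 m (n - 1)) X"
    and xx: "\<And>i i'. i < i' \<Longrightarrow> i' \<le> m \<Longrightarrow> i \<noteq> k \<Longrightarrow> i' \<noteq> k \<Longrightarrow>
        d_map (m - 1) n i (x i') = d_map (m - 1) n (i' - 1) (x i)"
    and yy: "\<And>j j'. j < j' \<Longrightarrow> j' \<le> n \<Longrightarrow> j \<noteq> l \<Longrightarrow> j' \<noteq> l \<Longrightarrow>
        dbar_map m (n - 1) j (y j') = dbar_map m (n - 1) (j' - 1) (y j)"
    and xy: "\<And>i j. i \<le> m \<Longrightarrow> j \<le> n \<Longrightarrow> i \<noteq> k \<Longrightarrow> j \<noteq> l \<Longrightarrow>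
        dbar_map (m - 1) n j (x i) = d_map m (n - 1) i (y j)"
  shows "\<exists>z \<in> bihom (Delta2 m n) X. (\<forall>i\<le>m. i \<noteq> k \<longrightarrow> d_map m n i z = x i) \<and>
    (\<forall>j\<le>n. j \<noteq> l \<longrightarrow> dbar_map m n j z = y j)"
proof -
  define vx where "vx i p q c = x i p q (map (codegen i) (fst c), snd c)" for i p q and c :: bisimplex
  define vy where "vy j p q c = y j p q (fst c, map (codegen j) (snd c))" for j p q and c :: bisimplex
  define okx where "okx i c \<longleftrightarrow> i \<le> m \<and> i \<noteq> k \<and> i \<notin> set (fst c)" for i and c :: bisimplex
  define oky where "oky j c \<longleftrightarrow> j \<le> n \<and> j \<noteq> l \<and> j \<notin> set (snd c)" for j and c :: bisimplex
  have xx': "vx i p q c = vx i' p q c" if c: "c \<in> cells (Delta2 m n) p q" and ok: "okx i c" "okx i' c" and "i < i'" for i i' p q c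
  proof -
    obtain xs ys where [simp]: "c = (xs, ys)" by (cases c)
    have o: "i \<le> m" "i' \<le> m" "i \<noteq> k" "i' \<noteq> k" "i \<notin> set xs" "i' \<notin> set xs" using ok by (auto simp: okx_def)
    note L = omit_lower(1)[OF c[simplified \<open>c = (xs, ys)\<close>]]
    note t = two_omitted[OF \<open>i < i'\<close> o(5,6)]
    have i: "i \<le> m - 1" "i' - 1 \<le> m - 1" using \<open>i < i'\<close> o by auto
    have "vx i' p q c = d_map (m - 1) n i (x i') p q (map (codegen i) (map (codegen i') xs), ys)"
      using d_map_omit[OF L[OF o(6,2)] t(2) i(1), of "x i'"] by (simp add: vx_def)
    also have "\<dots> = d_map (m - 1) n (i' - 1) (x i) p q (map (codegen (i' - 1)) (map (codegen i) xs), ys)"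
      by (simp only: xx[OF \<open>i < i'\<close> o(2,3,4)] t(1))
    also have "\<dots> = vx i p q c"
      using d_map_omit[OF L[OF o(5,1)] t(3) i(2), of "x i"] by (simp add: vx_def)
    finally show ?thesis by simp
  qed
  have yy': "vy j p q c = vy j' p q c" if c: "c \<in> cells (Delta2 m n) p q" and ok: "oky j c" "oky j' c" and "j < j'" for j j' p q c
  proof -
    obtain xs ys where [simp]: "c = (xs, ys)" by (cases c)
    have o: "j \<le> n" "j' \<le> n" "j \<noteq> l" "j' \<noteq> l" "j \<notin> set ys" "j' \<notin> set ys" using ok by (auto simp: oky_def)
    note L = omit_lower_v(1)[OF c[simplified \<open>c = (xs, ys)\<close>]]
    note t = two_omitted[OF \<open>j < j'\<close> o(5,6)]
    have j: "j \<le> n - 1" "j' - 1 \<le> n - 1" using \<open>j < j'\<close> o by auto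
    have "vy j' p q c = dbar_map m (n - 1) j (y j') p q (xs, map (codegen j) (map (codegen j') ys))"
      using dbar_map_omit[OF L[OF o(6,2)] t(2) j(1), of "y j'"] by (simp add: vy_def)
    also have "\<dots> = dbar_map m (n - 1) (j' - 1) (y j) p q (xs, map (codegen (j' - 1)) (map (codegen j) ys))"
      by (simp only: yy[OF \<open>j < j'\<close> o(2,3,4)] t(1))
    also have "\<dots> = vy j p q c"
      using dbar_map_omit[OF L[OF o(5,1)] t(3) j(2), of "y j"] by (simp add: vy_def)
    finally show ?thesis by simp
  qed
  have xy': "vx i p q c = vy j p q c" if c: "c \<in> cells (Delta2 m n) p q" and ok: "okx i c" "oky j c" for i j p q c
  proof -
    obtain xs ys where [simp]: "c = (xs, ys)" by (cases c)
    have o: "i \<le> m" "i \<noteq> k" "i \<notin> set xs" "j \<le> n" "j \<noteq> l" "j \<notin> set ys" using ok by (auto simp: okx_def oky_def)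
    note c' = c[simplified \<open>c = (xs, ys)\<close>]
    have "vx i p q c = dbar_map (m - 1) n j (x i) p q (map (codegen i) xs, map (codegen j) ys)"
      using dbar_map_omit[OF omit_lower(1)[OF c' o(3,1)] o(6,4), of "x i"] by (simp add: vx_def)
    also have "\<dots> = d_map m (n - 1) i (y j) p q (map (codegen i) xs, map (codegen j) ys)"
      using xy o by simp
    also have "\<dots> = vy j p q c"
      using d_map_omit[OF omit_lower_v(1)[OF c' o(6,4)] o(3,1), of "y j"] by (simp add: vy_def)
    finally show ?thesis .
  qed
  define u where "u p q c = (if c \<in> cells (Horn2 m k n l) p q then
     (if \<exists>i. okx i c then vx (SOME i. okx i c) p q c else vy (SOME j. oky j c) p q c) else undefined)" for p q c
  have Hc: "c \<in> cells (Horn2 m k n l) p q \<longleftrightarrow> c \<in> cells (Delta2 m n) p q \<and> ((\<exists>i. okx i c) \<or> (\<exists>j. oky j c))" for c p q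
    by (cases c) (auto simp: Horn2_eq okx_def oky_def)
  have ux: "u p q c = vx i p q c" if c: "c \<in> cells (Delta2 m n) p q" and ok: "okx i c" for i p q c
  proof -
    have "okx (SOME i. okx i c) c" by (rule someI[of "\<lambda>i. okx i c", OF ok])
    then have "vx (SOME i. okx i c) p q c = vx i p q c"
      using xx'[OF c] ok by (metis linorder_neqE_nat)
    then show ?thesis using c ok Hc by (auto simp: u_def)
  qed
  have uy: "u p q c = vy j p q c" if c: "c \<in> cells (Delta2 m n) p q" and ok: "oky j c" for j p q c
  proof (cases "\<exists>i. okx i c")
    case True
    then show ?thesis using ux[OF c] xy'[OF c _ ok] by metis
  next
    case False
    have "oky (SOME j. oky j c) c" by (rule someI[of "\<lambda>j. oky j c", OF ok])
    then have "vy (SOME j. oky j c) p q c = vy j p q c"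
      using yy'[OF c] ok by (metis linorder_neqE_nat)
    then show ?thesis using c ok Hc False by (auto simp: u_def)
  qed
  have lowx: "(map (codegen i) (fst c), snd c) \<in> cells (Delta2 (m - 1) n) p q" "x i \<in> bihom (Delta2 (m - 1) n) X"
    if "c \<in> cells (Delta2 m n) p q" "okx i c" for i p q c
    using omit_lower(1)[of "fst c" "snd c" m n p q i] that x by (auto simp: okx_def simp del: Delta2_simps)
  have lowy: "(fst c, map (codegen j) (snd c)) \<in> cells (Delta2 m (n - 1)) p q" "y j \<in> bihom (Delta2 m (n - 1)) X"
    if "c \<in> cells (Delta2 m n) p q" "oky j c" for j p q c
    using omit_lower_v(1)[of "fst c" "snd c" m n p q j] that y by (auto simp: oky_def simp del: Delta2_simps)
  note D = bisimplicial_closed[OF bisimplicial_set_Delta2[of m n]]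
  have okx_ops: "okx i c \<Longrightarrow> okx i (hface (Delta2 m n) p q r c)" "okx i c \<Longrightarrow> okx i (hdegen (Delta2 m n) p q r c)"
    "okx i c \<Longrightarrow> okx i (vface (Delta2 m n) p q r c)" "okx i c \<Longrightarrow> okx i (vdegen (Delta2 m n) p q r c)" for i p q r c
    using set_del[of r "fst c"] set_dup[of r "fst c"] by (auto simp: okx_def)
  have oky_ops: "oky j c \<Longrightarrow> oky j (hface (Delta2 m n) p q r c)" "oky j c \<Longrightarrow> oky j (hdegen (Delta2 m n) p q r c)"
    "oky j c \<Longrightarrow> oky j (vface (Delta2 m n) p q r c)" "oky j c \<Longrightarrow> oky j (vdegen (Delta2 m n) p q r c)" for j p q r c
    using set_del[of r "snd c"] set_dup[of r "snd c"] by (auto simp: oky_def)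
  have ops: "hface (Horn2 m k n l) = hface (Delta2 m n)" "hdegen (Horn2 m k n l) = hdegen (Delta2 m n)"
    "vface (Horn2 m k n l) = vface (Delta2 m n)" "vdegen (Horn2 m k n l) = vdegen (Delta2 m n)"
    by (simp_all add: Horn2_eq)
  have u: "u \<in> bihom (Horn2 m k n l) X"
  proof (rule bihomI, unfold ops)
    fix p q c assume "c \<in> cells (Horn2 m k n l) p q"
    then consider i where "c \<in> cells (Delta2 m n) p q" "okx i c" | j where "c \<in> cells (Delta2 m n) p q" "oky j c"
      unfolding Hc by blast
    then show "u p q c \<in> cells X p q"
    proof cases
      case 1
      then show ?thesis using bihomD(1)[OF lowx(2)[OF 1] lowx(1)[OF 1]] by (simp add: ux vx_def)
    next
      case 2
      then show ?thesis using bihomD(1)[OF lowy(2)[OF 2] lowy(1)[OF 2]] by (simp add: uy vy_def)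
    qed
  next
    fix p q c assume "c \<notin> cells (Horn2 m k n l) p q"
    then show "u p q c = undefined" by (simp add: u_def)
  next
    fix p q r c assume "c \<in> cells (Horn2 m k n l) (Suc p) q" and r: "r \<le> Suc p"
    then consider i where "c \<in> cells (Delta2 m n) (Suc p) q" "okx i c" | j where "c \<in> cells (Delta2 m n) (Suc p) q" "oky j c"
      unfolding Hc by blast
    then show "u p q (hface (Delta2 m n) (Suc p) q r c) = hface X (Suc p) q r (u (Suc p) q c)"
    proof cases
      case 1
      show ?thesis
        using bihomD(3)[OF lowx(2)[OF 1] lowx(1)[OF 1] r] ux[OF D(1)[OF 1(1) r] okx_ops(1)[OF 1(2)]] ux[OF 1]
        by (simp add: vx_def map_del)
    next
      case 2
      show ?thesis
        using bihomD(3)[OF lowy(2)[OF 2] lowy(1)[OF 2] r] uy[OF D(1)[OF 2(1) r] oky_ops(1)[OF 2(2)]] uy[OF 2]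
        by (simp add: vy_def map_del)
    qed
  next
    fix p q r c assume "c \<in> cells (Horn2 m k n l) p q" and r: "r \<le> p"
    then consider i where "c \<in> cells (Delta2 m n) p q" "okx i c" | j where "c \<in> cells (Delta2 m n) p q" "oky j c"
      unfolding Hc by blast
    then show "u (Suc p) q (hdegen (Delta2 m n) p q r c) = hdegen X p q r (u p q c)"
    proof cases
      case 1
      show ?thesis
        using bihomD(4)[OF lowx(2)[OF 1] lowx(1)[OF 1] r] ux[OF D(2)[OF 1(1) r] okx_ops(2)[OF 1(2)]] ux[OF 1]
        by (simp add: vx_def map_dup)
    next
      case 2
      show ?thesis
        using bihomD(4)[OF lowy(2)[OF 2] lowy(1)[OF 2] r] uy[OF D(2)[OF 2(1) r] oky_ops(2)[OF 2(2)]] uy[OF 2]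
        by (simp add: vy_def map_dup)
    qed
  next
    fix p q r c assume "c \<in> cells (Horn2 m k n l) p (Suc q)" and r: "r \<le> Suc q"
    then consider i where "c \<in> cells (Delta2 m n) p (Suc q)" "okx i c" | j where "c \<in> cells (Delta2 m n) p (Suc q)" "oky j c"
      unfolding Hc by blast
    then show "u p q (vface (Delta2 m n) p (Suc q) r c) = vface X p (Suc q) r (u p (Suc q) c)"
    proof cases
      case 1
      show ?thesis
        using bihomD(5)[OF lowx(2)[OF 1] lowx(1)[OF 1] r] ux[OF D(3)[OF 1(1) r] okx_ops(3)[OF 1(2)]] ux[OF 1]
        by (simp add: vx_def map_del)
    next
      case 2
      show ?thesis
        using bihomD(5)[OF lowy(2)[OF 2] lowy(1)[OF 2] r] uy[OF D(3)[OF 2(1) r] oky_ops(3)[OF 2(2)]] uy[OF 2]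
        by (simp add: vy_def map_del)
    qed
  next
    fix p q r c assume "c \<in> cells (Horn2 m k n l) p q" and r: "r \<le> q"
    then consider i where "c \<in> cells (Delta2 m n) p q" "okx i c" | j where "c \<in> cells (Delta2 m n) p q" "oky j c"
      unfolding Hc by blast
    then show "u p (Suc q) (vdegen (Delta2 m n) p q r c) = vdegen X p q r (u p q c)"
    proof cases
      case 1
      show ?thesis
        using bihomD(6)[OF lowx(2)[OF 1] lowx(1)[OF 1] r] ux[OF D(4)[OF 1(1) r] okx_ops(4)[OF 1(2)]] ux[OF 1]
        by (simp add: vx_def map_dup)
    next
      case 2
      show ?thesis
        using bihomD(6)[OF lowy(2)[OF 2] lowy(1)[OF 2] r] uy[OF D(4)[OF 2(1) r] oky_ops(4)[OF 2(2)]] uy[OF 2]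
        by (simp add: vy_def map_dup)
    qed
  qed
  obtain w where w: "w \<in> bihom (Delta2 m n) X" "brestr (Horn2 m k n l) w = u"
    by (rule fibrant_extend[OF fib u]) (use mn in auto)
  have wu: "w p q c = u p q c" if "c \<in> cells (Horn2 m k n l) p q" for p q c
    unfolding w(2)[symmetric] using that by (simp add: brestr_def)
  have face: "map (codegen i) (map (coface i) xs) = xs" "i \<notin> set (map (coface i) xs)" for i xs
    by (auto simp: coface_def codegen_def intro!: map_idI)
  have "d_map m n i w = x i" if i: "i \<le> m" "i \<noteq> k" for i
  proof (intro ext)
    fix p q c
    show "d_map m n i w p q c = x i p q c"
    proof (cases "c \<in> cells (Delta2 (m - 1) n) p q")
      case True
      obtain xs ys where c: "c = (xs, ys)" by (cases c)
      let ?c = "(map (coface i) xs, ys)"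
      have ok: "okx i ?c" using i face by (auto simp: okx_def)
      have "std_map (m - 1) n (coface i) id p q c \<in> cells (Delta2 m n) p q"
        by (rule bihomD(1)[OF std_map_in_bihom True]) (use i mn mor_intros(2)[of i "m - 1"] in auto)
      then have D: "?c \<in> cells (Delta2 m n) p q" using True by (simp add: std_map_def c)
      have "d_map m n i w p q c = w p q ?c"
        using True unfolding c d_map_pull by (simp add: pull_apply del: Delta2_simps)
      also have "\<dots> = u p q ?c" using D ok by (intro wu) (auto simp: Hc)
      also have "\<dots> = x i p q c" using ux[OF D ok] unfolding vx_def fst_conv snd_conv face by (simp add: c)
      finally show ?thesis .
    next
      case False
      then show ?thesis using bihomD(2)[OF x[OF i]] by (simp add: d_map_pull pull_undefined)
    qed
  qed
  moreover have "dbar_map m n j w = y j" if j: "j \<le> n" "j \<noteq> l" for j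
  proof (intro ext)
    fix p q c
    show "dbar_map m n j w p q c = y j p q c"
    proof (cases "c \<in> cells (Delta2 m (n - 1)) p q")
      case True
      obtain xs ys where c: "c = (xs, ys)" by (cases c)
      let ?c = "(xs, map (coface j) ys)"
      have ok: "oky j ?c" using j face by (auto simp: oky_def)
      have "std_map m (n - 1) id (coface j) p q c \<in> cells (Delta2 m n) p q"
        by (rule bihomD(1)[OF std_map_in_bihom True]) (use j mn mor_intros(2)[of j "n - 1"] in auto)
      then have D: "?c \<in> cells (Delta2 m n) p q" using True by (simp add: std_map_def c)
      have "dbar_map m n j w p q c = w p q ?c"
        using True unfolding c dbar_map_pull by (simp add: pull_apply del: Delta2_simps)
      also have "\<dots> = u p q ?c" using D ok by (intro wu) (auto simp: Hc)
      also have "\<dots> = y j p q c" using uy[OF D ok] unfolding vy_def fst_conv snd_conv face by (simp add: c)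
      finally show ?thesis .
    next
      case False
      then show ?thesis using bihomD(2)[OF y[OF j]] by (simp add: dbar_map_pull pull_undefined)
    qed
  qed
  ultimately show ?thesis using w(1) by blast
qed

lemma mor_coface: "b = Suc a \<Longrightarrow> i \<le> b \<Longrightarrow> mor a b (coface i)"
  by simp

lemma mor_codegen: "a = Suc b \<Longrightarrow> i \<le> b \<Longrightarrow> mor a b (codegen i)"
  by simp

section \<open>Maps of standard bisimplices as cells\<close>

text \<open>
  A map $\Delta^{m,n} \to X$ together with its bidimension, which the map itself need not determine.
\<close>

type_synonym 'a tagged = "nat \<times> nat \<times> (bisimplex, 'a) bmap"

definition tagged_cells :: "'a bisset \<Rightarrow> 'a tagged set" where
  "tagged_cells X = {(m, n, \<theta>). \<theta> \<in> bihom (Delta2 m n) X}"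

definition tag_d :: "nat \<Rightarrow> 'a tagged \<Rightarrow> 'a tagged" where
  "tag_d i = (\<lambda>(m, n, \<theta>). (m - 1, n, d_map m n i \<theta>))"

definition tag_s :: "nat \<Rightarrow> 'a tagged \<Rightarrow> 'a tagged" where
  "tag_s i = (\<lambda>(m, n, \<theta>). (Suc m, n, s_map m n i \<theta>))"

definition tag_dbar :: "nat \<Rightarrow> 'a tagged \<Rightarrow> 'a tagged" where
  "tag_dbar j = (\<lambda>(m, n, \<theta>). (m, n - 1, dbar_map m n j \<theta>))"

definition tag_sbar :: "nat \<Rightarrow> 'a tagged \<Rightarrow> 'a tagged" where
  "tag_sbar j = (\<lambda>(m, n, \<theta>). (m, Suc n, sbar_map m n j \<theta>))"

definition tag_pt :: "(bisimplex, 'a) bmap \<Rightarrow> nat \<Rightarrow> nat \<Rightarrow> 'a tagged" where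
  "tag_pt pt m n = (m, n, const_map pt (Delta2 m n))"

lemmas tag_defs = tagged_cells_def tag_d_def tag_s_def tag_dbar_def tag_sbar_def tag_pt_def
lemmas maps_pull = d_map_pull s_map_pull dbar_map_pull sbar_map_pull
lemmas tag_simps = tag_defs maps_pull pull_pull mor_coface mor_codegen coface_def codegen_def

lemma bikan_tagged:
  fixes X :: "'a bisset"
  assumes pt: "pt \<in> bihom (Delta2 0 0) X" and fib: "fibrant TYPE('u :: infinite) X"
  shows "bikan (tagged_cells X) fst (\<lambda>c. fst (snd c)) tag_d tag_s tag_dbar tag_sbar (tag_pt pt)"
proof (unfold_locales, goal_cases)
  case (11 i x)
  then show ?case by (cases x) (auto simp: tag_defs maps_pull intro!: pull_in_bihom mor_coface)
next
  case (12 j x)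
  then show ?case by (cases x) (auto simp: tag_defs maps_pull intro!: pull_in_bihom mor_coface)
next
  case (13 i x)
  then show ?case by (cases x) (auto simp: tag_defs maps_pull intro!: pull_in_bihom mor_codegen)
next
  case (14 i x)
  then show ?case by (cases x) (auto simp: tag_defs maps_pull intro!: pull_in_bihom mor_codegen)
next
  case (15 m n)
  then show ?case by (simp add: tag_defs const_map_in_bihom[OF pt bisimplicial_set_Delta2])
next
  case (16 i j x) then show ?case by (cases x) (auto simp: tag_simps intro!: pull_cong)
next
  case (17 i j x) then show ?case by (cases x) (auto simp: tag_simps intro!: pull_cong)
next
  case (18 i j x) then show ?case by (cases x) (auto simp: tag_simps intro!: pull_cong)
next
  case (19 i x) then show ?case by (cases x) (auto simp: tag_simps intro!: pull_id)
next
  case (20 i x) then show ?case by (cases x) (auto simp: tag_simps intro!: pull_id)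
next
  case (21 i j x) then show ?case by (cases x) (auto simp: tag_simps intro!: pull_cong)
next
  case (22 i j x) then show ?case by (cases x) (auto simp: tag_simps intro!: pull_cong)
next
  case (23 i x) then show ?case by (cases x) (auto simp: tag_simps intro!: pull_id)
next
  case (24 i x) then show ?case by (cases x) (auto simp: tag_simps intro!: pull_id)
next
  case (25 i j x) then show ?case by (cases x) (auto simp: tag_simps intro!: pull_cong)
next
  case (26 i j x) then show ?case by (cases x) (auto simp: tag_simps)
next
  case (27 i j x) then show ?case by (cases x) (auto simp: tag_simps)
next
  case (28 i j x) then show ?case by (cases x) (auto simp: tag_simps)
next
  case (29 i m n) then show ?case by (simp add: tag_simps pull_const)
next
  case (30 j m n) then show ?case by (simp add: tag_simps pull_const)
next
  case (31 i m n) then show ?case by (simp add: tag_simps pull_const)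
next
  case (32 j m n) then show ?case by (simp add: tag_simps pull_const)
next
  case (33 m n k l x y)
  define x' where "x' i = snd (snd (x i))" for i
  define y' where "y' j = snd (snd (y j))" for j
  have x: "x i = (m - 1, n, x' i)" "x' i \<in> bihom (Delta2 (m - 1) n) X" if "i \<le> m" "i \<noteq> k" for i
    using 33(5)[OF that] by (cases "x i"; auto simp: x'_def tag_defs)+
  have y: "y j = (m, n - 1, y' j)" "y' j \<in> bihom (Delta2 m (n - 1)) X" if "j \<le> n" "j \<noteq> l" for j
    using 33(6)[OF that] by (cases "y j"; auto simp: y'_def tag_defs)+
  have "\<exists>z \<in> bihom (Delta2 m n) X. (\<forall>i\<le>m. i \<noteq> k \<longrightarrow> d_map m n i z = x' i) \<and>
    (\<forall>j\<le>n. j \<noteq> l \<longrightarrow> dbar_map m n j z = y' j)"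
  proof (rule horn_fill_maps[OF fib 33(1-4)])
    fix i i' assume "i < i'" "i' \<le> m" "i \<noteq> k" "i' \<noteq> k"
    then show "d_map (m - 1) n i (x' i') = d_map (m - 1) n (i' - 1) (x' i)"
      using 33(7)[of i i'] x[of i] x[of i'] by (simp add: tag_defs)
  next
    fix j j' assume "j < j'" "j' \<le> n" "j \<noteq> l" "j' \<noteq> l"
    then show "dbar_map m (n - 1) j (y' j') = dbar_map m (n - 1) (j' - 1) (y' j)"
      using 33(8)[of j j'] y[of j] y[of j'] by (simp add: tag_defs)
  next
    fix i j assume "i \<le> m" "j \<le> n" "i \<noteq> k" "j \<noteq> l"
    then show "dbar_map (m - 1) n j (x' i) = d_map m (n - 1) i (y' j)"
      using 33(9)[of i j] x[of i] y[of j] by (simp add: tag_defs)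
  qed (use x y in auto)
  then obtain z where "z \<in> bihom (Delta2 m n) X" "\<forall>i\<le>m. i \<noteq> k \<longrightarrow> d_map m n i z = x' i"
    "\<forall>j\<le>n. j \<noteq> l \<longrightarrow> dbar_map m n j z = y' j" by blast
  then show ?case
    using x y by (intro exI[of _ "(m, n, z)"]) (auto simp: tag_defs)
qed (auto simp: tag_defs)

text \<open>
  A map is constant on $\delta_{\mathrm A}\Delta^{m,n}$ iff it is constant at all bisimplices that lie
  in one of its pieces.
\<close>

lemma cells_boundary:
  assumes "\<theta> \<in> bihom (Delta2 m n) X"
  shows "brestr (delta_A m n) \<theta> = const_map pt (delta_A m n) \<longleftrightarrow>
    (\<forall>p q xs ys. (xs, ys) \<in> cells (Delta2 m n) p q \<longrightarrow>
      (\<exists>i<m. i \<notin> set xs) \<or> (\<exists>j<n. j \<notin> set ys) \<or> m \<notin> set xs \<and> n \<notin> set ys \<longrightarrow>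
      \<theta> p q (xs, ys) = pt p q (replicate (Suc p) 0, replicate (Suc q) 0))"
  (is "?L \<longleftrightarrow> ?R")
proof -
  have c: "(xs, ys) \<in> cells (delta_A m n) p q \<longleftrightarrow> (xs, ys) \<in> cells (Delta2 m n) p q \<and>
     ((\<exists>i<m. i \<notin> set xs) \<or> (\<exists>j<n. j \<notin> set ys) \<or> m \<notin> set xs \<and> n \<notin> set ys)" for xs ys p q
    by (auto simp: delta_A_eq le_less)
  have "?L \<longleftrightarrow> (\<forall>p q xs ys. (xs, ys) \<in> cells (delta_A m n) p q \<longrightarrow>
      \<theta> p q (xs, ys) = pt p q (replicate (Suc p) 0, replicate (Suc q) 0))"
  proof
    assume L: ?L
    show "\<forall>p q xs ys. (xs, ys) \<in> cells (delta_A m n) p q \<longrightarrow>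
      \<theta> p q (xs, ys) = pt p q (replicate (Suc p) 0, replicate (Suc q) 0)"
    proof (intro allI impI)
      fix p q xs ys assume "(xs, ys) \<in> cells (delta_A m n) p q"
      then show "\<theta> p q (xs, ys) = pt p q (replicate (Suc p) 0, replicate (Suc q) 0)"
        using fun_cong[OF fun_cong[OF fun_cong[OF L]], of p q "(xs, ys)"]
        by (simp add: brestr_def const_map_apply del: replicate_Suc)
    qed
  next
    assume R: "\<forall>p q xs ys. (xs, ys) \<in> cells (delta_A m n) p q \<longrightarrow>
      \<theta> p q (xs, ys) = pt p q (replicate (Suc p) 0, replicate (Suc q) 0)"
    show ?L
    proof (intro ext)
      fix p q c
      show "brestr (delta_A m n) \<theta> p q c = const_map pt (delta_A m n) p q c"
        using R by (cases c; cases "c \<in> cells (delta_A m n) p q")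
          (auto simp: brestr_def const_map_apply const_map_undefined simp del: replicate_Suc)
    qed
  qed
  then show ?thesis unfolding c by blast
qed

lemma maps_eq_constI:
  assumes "\<theta> \<in> bihom (Delta2 m n) X"
    "\<And>p q xs ys. (xs, ys) \<in> cells (Delta2 m n) p q \<Longrightarrow> \<theta> p q (xs, ys) = pt p q (replicate (Suc p) 0, replicate (Suc q) 0)"
  shows "\<theta> = const_map pt (Delta2 m n)"
proof (intro ext)
  fix p q c
  show "\<theta> p q c = const_map pt (Delta2 m n) p q c"
    using assms(2) bihomD(2)[OF assms(1)] by (cases c; cases "c \<in> cells (Delta2 m n) p q")
      (auto simp: const_map_apply const_map_undefined simp del: replicate_Suc Delta2_simps)
qed

text \<open>
  The tagged maps into a pointed bisimplicial set \<open>X\<close>, when they admit horn fillers.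
\<close>

locale pointed_maps =
  bikan "tagged_cells X" fst "\<lambda>c. fst (snd c)" tag_d tag_s tag_dbar tag_sbar "tag_pt pt"
  for X :: "'a bisset" and pt :: "(bisimplex, 'a) bmap" +
  assumes pt: "pt \<in> bihom (Delta2 0 0) X"
begin

text \<open>
  A map is rel $\delta_{\mathrm A}\Delta^{m,n}$ iff $d_i\alpha = *$ for $i < m$,
  $\overline d_j\alpha = *$ for $j < n$ and $d_m\overline d_n\alpha = *$.
\<close>

lemma rel_cells_iff:
  "(Suc a, Suc b, \<alpha>) \<in> rel_cells a b \<longleftrightarrow> \<alpha> \<in> aeppli_maps X pt (Suc a) (Suc b)"
proof (cases "\<alpha> \<in> bihom (Delta2 (Suc a) (Suc b)) X")
  case \<alpha>: True
  let ?pt = "\<lambda>p q. pt p q (replicate (Suc p) 0, replicate (Suc q) 0)"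
  let ?rel = "(\<forall>i\<le>a. d_map (Suc a) (Suc b) i \<alpha> = const_map pt (Delta2 a (Suc b))) \<and>
    (\<forall>j\<le>b. dbar_map (Suc a) (Suc b) j \<alpha> = const_map pt (Delta2 (Suc a) b)) \<and>
    d_map (Suc a) b (Suc a) (dbar_map (Suc a) (Suc b) (Suc b) \<alpha>) = const_map pt (Delta2 a b)"
  let ?bd = "\<forall>p q xs ys. (xs, ys) \<in> cells (Delta2 (Suc a) (Suc b)) p q \<longrightarrow>
      (\<exists>i<Suc a. i \<notin> set xs) \<or> (\<exists>j<Suc b. j \<notin> set ys) \<or> Suc a \<notin> set xs \<and> Suc b \<notin> set ys \<longrightarrow>
      \<alpha> p q (xs, ys) = ?pt p q"
  have "?rel \<longleftrightarrow> ?bd"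
  proof
    assume rel: ?rel
    show ?bd
    proof (intro allI impI)
      fix p q xs ys
      assume c: "(xs, ys) \<in> cells (Delta2 (Suc a) (Suc b)) p q"
        and "(\<exists>i<Suc a. i \<notin> set xs) \<or> (\<exists>j<Suc b. j \<notin> set ys) \<or> Suc a \<notin> set xs \<and> Suc b \<notin> set ys"
      then consider i where "i \<le> a" "i \<notin> set xs" | j where "j \<le> b" "j \<notin> set ys"
        | "Suc a \<notin> set xs" "Suc b \<notin> set ys" by (auto simp: less_Suc_eq_le)
      then show "\<alpha> p q (xs, ys) = ?pt p q"
      proof cases
        case 1
        then have "\<alpha> p q (xs, ys) = d_map (Suc a) (Suc b) i \<alpha> p q (map (codegen i) xs, ys)"
          using d_map_omit[OF c, of i \<alpha>] by simp
        also have "\<dots> = ?pt p q"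
          using rel 1 omit_lower(1)[OF c, of i] by (simp add: const_map_apply del: replicate_Suc Delta2_simps)
        finally show ?thesis .
      next
        case 2
        then have "\<alpha> p q (xs, ys) = dbar_map (Suc a) (Suc b) j \<alpha> p q (xs, map (codegen j) ys)"
          using dbar_map_omit[OF c, of j \<alpha>] by simp
        also have "\<dots> = ?pt p q"
          using rel 2 omit_lower_v(1)[OF c, of j] by (simp add: const_map_apply del: replicate_Suc Delta2_simps)
        finally show ?thesis .
      next
        case 3
        note c' = omit_lower_v(1)[OF c 3(2) order_refl, simplified diff_Suc_1]
        have "\<alpha> p q (xs, ys) = dbar_map (Suc a) (Suc b) (Suc b) \<alpha> p q (xs, map (codegen (Suc b)) ys)"
          using dbar_map_omit[OF c 3(2) order_refl, of \<alpha>] by simp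
        also have "\<dots> = d_map (Suc a) b (Suc a) (dbar_map (Suc a) (Suc b) (Suc b) \<alpha>) p q
            (map (codegen (Suc a)) xs, map (codegen (Suc b)) ys)"
          by (rule d_map_omit[OF c' 3(1) order_refl, symmetric])
        also have "\<dots> = ?pt p q"
          using rel omit_lower(1)[OF c' 3(1) order_refl] by (simp add: const_map_apply del: replicate_Suc Delta2_simps)
        finally show ?thesis .
      qed
    qed
  next
    assume bd: ?bd
    have const: "pull m' n' f g \<alpha> = const_map pt (Delta2 m' n')"
      if "mor m' (Suc a) f" "mor n' (Suc b) g"
        "(\<exists>i<Suc a. \<forall>v. f v \<noteq> i) \<or> (\<exists>j<Suc b. \<forall>v. g v \<noteq> j) \<or> (\<forall>v\<le>m'. f v \<noteq> Suc a) \<and> (\<forall>v\<le>n'. g v \<noteq> Suc b)"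
      for m' n' f g
    proof (rule maps_eq_constI[OF pull_in_bihom[OF \<alpha> that(1,2)]])
      fix p q xs ys assume c: "(xs, ys) \<in> cells (Delta2 m' n') p q"
      have "(map f xs, map g ys) \<in> cells (Delta2 (Suc a) (Suc b)) p q"
        by (rule std_map_closed[OF that(1,2) c])
      moreover have "(\<exists>i<Suc a. i \<notin> set (map f xs)) \<or> (\<exists>j<Suc b. j \<notin> set (map g ys)) \<or>
          Suc a \<notin> set (map f xs) \<and> Suc b \<notin> set (map g ys)"
        using that(3)
      proof (elim disjE)
        assume "(\<forall>v\<le>m'. f v \<noteq> Suc a) \<and> (\<forall>v\<le>n'. g v \<noteq> Suc b)"
        moreover have "\<forall>v\<in>set xs. v \<le> m'" "\<forall>v\<in>set ys. v \<le> n'" using c by auto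
        ultimately have "Suc a \<notin> set (map f xs) \<and> Suc b \<notin> set (map g ys)" by auto
        then show ?thesis by blast
      qed auto
      ultimately have "\<alpha> p q (map f xs, map g ys) = ?pt p q" using bd by blast
      then show "pull m' n' f g \<alpha> p q (xs, ys) = ?pt p q"
        using pull_apply[OF c, of f g \<alpha>] by simp
    qed
    have miss: "coface i v \<noteq> i" for i v by (simp add: coface_def)
    show ?rel
    proof (intro conjI allI impI)
      fix i assume "i \<le> a"
      then show "d_map (Suc a) (Suc b) i \<alpha> = const_map pt (Delta2 a (Suc b))"
        unfolding d_map_pull using miss by (simp, intro const) (auto simp: less_Suc_eq_le)
    next
      fix j assume "j \<le> b"
      then show "dbar_map (Suc a) (Suc b) j \<alpha> = const_map pt (Delta2 (Suc a) b)"
        unfolding dbar_map_pull using miss by (simp, intro const) (auto simp: less_Suc_eq_le)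
    next
      show "d_map (Suc a) b (Suc a) (dbar_map (Suc a) (Suc b) (Suc b) \<alpha>) = const_map pt (Delta2 a b)"
        using miss by (auto simp: d_map_pull dbar_map_pull pull_pull intro!: const)
    qed
  qed
  moreover have "(Suc a, Suc b, \<alpha>) \<in> rel_cells a b \<longleftrightarrow> ?rel"
    unfolding rel_cells_def using \<alpha> by (simp add: tag_defs)
  moreover have "\<alpha> \<in> aeppli_maps X pt (Suc a) (Suc b) \<longleftrightarrow> ?bd"
    unfolding aeppli_maps_def rel_maps_def mem_Collect_eq cells_boundary[OF \<alpha>] using \<alpha> by blast
  ultimately show ?thesis by blast
next
  case False
  then show ?thesis
    unfolding rel_cells_def aeppli_maps_def rel_maps_def by (simp add: tag_defs)
qed

lemma rel_cellsE:
  assumes "c \<in> rel_cells a b"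
  obtains \<alpha> where "c = (Suc a, Suc b, \<alpha>)" "\<alpha> \<in> aeppli_maps X pt (Suc a) (Suc b)"
  using assms rel_cells_iff by (cases c) (auto simp: rel_cells_def)

lemma aprod_iff_filler:
  "aprod a b (Suc a, Suc b, \<alpha>) (Suc a, Suc b, \<beta>) \<epsilon> \<longleftrightarrow>
    (\<exists>\<theta>. aeppli_filler X pt (Suc a) (Suc b) \<alpha> \<beta> \<theta> \<and>
      \<epsilon> = (Suc a, Suc b, d_map (Suc a + 1) (Suc b) (Suc a) (dbar_map (Suc a + 1) (Suc b + 1) (Suc b) \<theta>)))"
  unfolding aprod_def aeppli_filler_def by (auto simp: tag_defs)

end

section \<open>Homotopies and fillers\<close>

text \<open>
  A map \<open>h\<close> on a product of two bisimplices composed with the map of $\Delta^{m,n}$ into this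
  product that is induced by the maps \<open>(f, e)\<close> in the first index and \<open>(g, e')\<close> in the
  second.
\<close>

definition chain_pull :: "nat \<Rightarrow> nat \<Rightarrow> (nat \<Rightarrow> nat) \<Rightarrow> (nat \<Rightarrow> nat) \<Rightarrow> (nat \<Rightarrow> nat) \<Rightarrow> (nat \<Rightarrow> nat) \<Rightarrow>
    (bisimplex \<times> bisimplex, 'a) bmap \<Rightarrow> (bisimplex, 'a) bmap" where
  "chain_pull m n f e g e' h = bcomp (Delta2 m n) h
     (\<lambda>p q. \<lambda>x \<in> cells (Delta2 m n) p q. (std_map m n f g p q x, std_map m n e e' p q x))"

lemma cells_bprod [simp]:
  "cells (bprod A B) m n = cells A m n \<times> cells B m n"
  "hface (bprod A B) m n i = map_prod (hface A m n i) (hface B m n i)"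
  "hdegen (bprod A B) m n i = map_prod (hdegen A m n i) (hdegen B m n i)"
  "vface (bprod A B) m n i = map_prod (vface A m n i) (vface B m n i)"
  "vdegen (bprod A B) m n i = map_prod (vdegen A m n i) (vdegen B m n i)"
  by (simp_all add: bprod_def)

lemma pair_in_bihom:
  assumes A: "bisimplicial_set A" and f: "f \<in> bihom A B" and g: "g \<in> bihom A C"
  shows "(\<lambda>p q. \<lambda>x \<in> cells A p q. (f p q x, g p q x)) \<in> bihom A (bprod B C)"
  by (rule bihomI) (auto simp: bihomD[OF f] bihomD[OF g] bisimplicial_closed[OF A])

lemma chain_pull_in_bihom:
  assumes "h \<in> bihom (bprod (Delta2 m n) (Delta2 k l)) X" "mor m' m f" "mor n' n g" "mor m' k e" "mor n' l e'"
  shows "chain_pull m' n' f e g e' h \<in> bihom (Delta2 m' n') X"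
  unfolding chain_pull_def
  by (intro bcomp_in_bihom[OF _ pair_in_bihom assms(1)] bisimplicial_set_Delta2 std_map_in_bihom assms)

lemma chain_pull_apply:
  "(xs, ys) \<in> cells (Delta2 m n) p q \<Longrightarrow>
    chain_pull m n f e g e' h p q (xs, ys) = h p q ((map f xs, map g ys), (map e xs, map e' ys))"
  by (simp add: chain_pull_def bcomp_apply std_map_def)

lemma chain_pull_undefined:
  "x \<notin> cells (Delta2 m n) p q \<Longrightarrow> chain_pull m n f e g e' h p q x = undefined"
  by (simp add: chain_pull_def bcomp_def compose_def)

lemma pull_chain_pull:
  assumes "mor m'' m' f'" "mor n'' n' g'"
  shows "pull m'' n'' f' g' (chain_pull m' n' f e g e' h) = chain_pull m'' n'' (f \<circ> f') (e \<circ> f') (g \<circ> g') (e' \<circ> g') h"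
proof (intro ext)
  fix p q x
  show "pull m'' n'' f' g' (chain_pull m' n' f e g e' h) p q x = chain_pull m'' n'' (f \<circ> f') (e \<circ> f') (g \<circ> g') (e' \<circ> g') h p q x"
  proof (cases "x \<in> cells (Delta2 m'' n'') p q")
    case True
    obtain xs ys where x: "x = (xs, ys)" by (cases x)
    have "(map f' xs, map g' ys) \<in> cells (Delta2 m' n') p q"
      by (rule std_map_closed[OF assms True[unfolded x]])
    then show ?thesis using True unfolding x by (simp only: pull_apply chain_pull_apply map_map)
  qed (simp add: pull_undefined chain_pull_undefined)
qed

lemma chain_pull_cong:
  assumes "\<And>i. i \<le> m \<Longrightarrow> f i = f1 i" "\<And>i. i \<le> m \<Longrightarrow> e i = e1 i"
    "\<And>j. j \<le> n \<Longrightarrow> g j = g1 j" "\<And>j. j \<le> n \<Longrightarrow> e' j = e1' j"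
  shows "chain_pull m n f e g e' h = chain_pull m n f1 e1 g1 e1' h"
proof (intro ext)
  fix p q x
  show "chain_pull m n f e g e' h p q x = chain_pull m n f1 e1 g1 e1' h p q x"
  proof (cases "x \<in> cells (Delta2 m n) p q")
    case True
    obtain xs ys where x: "x = (xs, ys)" by (cases x)
    have "map f xs = map f1 xs" "map e xs = map e1 xs" "map g ys = map g1 ys" "map e' ys = map e1' ys"
      using True assms by (auto simp: x)
    then show ?thesis using True unfolding x by (simp only: chain_pull_apply)
  qed (simp add: chain_pull_undefined)
qed

lemma zero_list: "length xs = Suc p \<Longrightarrow> set xs \<subseteq> {..0::nat} \<Longrightarrow> xs = replicate (Suc p) 0"
  by (rule replicate_eqI) auto

lemma hat_d_apply:
  assumes "(c, (us, vs)) \<in> cells (bprod K (Delta2 (p - 1) q)) r s"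
  shows "hat_d K p q i h r s (c, (us, vs)) = h r s (c, (map (coface i) us, vs))"
  using assms unfolding hat_d_def
  by (subst bcomp_apply) (auto simp: id_times_def std_map_def)

lemma hat_dbar_apply:
  assumes "(c, (us, vs)) \<in> cells (bprod K (Delta2 p (q - 1))) r s"
  shows "hat_dbar K p q j h r s (c, (us, vs)) = h r s (c, (us, map (coface j) vs))"
  using assms unfolding hat_dbar_def
  by (subst bcomp_apply) (auto simp: id_times_def std_map_def)

lemma on_cylinder_apply:
  "x \<in> cells (bprod K (Delta2 p q)) r s \<Longrightarrow> on_cylinder K p q \<alpha> r s x = \<alpha> r s (fst x)"
  unfolding on_cylinder_def by (subst bcomp_apply) auto

lemma map_constant_list: "length xs = Suc p \<Longrightarrow> set xs \<subseteq> {..m} \<Longrightarrow> (\<And>i. i \<le> m \<Longrightarrow> e i = (x :: nat)) \<Longrightarrow> map e xs = replicate (Suc p) x"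
  by (rule replicate_eqI) auto

text \<open>
  On chains that stay at the end $1$ of one of the two intervals, a homotopy restricts to $\alpha$; on
  chains that stay at $0$ in both, it restricts to $\beta$.
\<close>

lemma homotopy_restrictions:
  assumes hom: "is_homotopy X (Delta2 m n) \<alpha> \<beta> h"
  shows "mor m' m f \<Longrightarrow> mor n' n g \<Longrightarrow> mor n' 1 e' \<Longrightarrow> (\<And>i. i \<le> m' \<Longrightarrow> e i = 1) \<Longrightarrow>
      chain_pull m' n' f e g e' h = pull m' n' f g \<alpha>"
    and "mor m' m f \<Longrightarrow> mor n' n g \<Longrightarrow> mor m' 1 e \<Longrightarrow> (\<And>j. j \<le> n' \<Longrightarrow> e' j = 1) \<Longrightarrow>
      chain_pull m' n' f e g e' h = pull m' n' f g \<alpha>"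
    and "mor m' m f \<Longrightarrow> mor n' n g \<Longrightarrow> (\<And>i. i \<le> m' \<Longrightarrow> e i = 0) \<Longrightarrow> (\<And>j. j \<le> n' \<Longrightarrow> e' j = 0) \<Longrightarrow>
      chain_pull m' n' f e g e' h = pull m' n' f g \<beta>"
proof -
  let ?D = "Delta2 m n"
  note E = hom[unfolded is_homotopy_def]
  have 1: "chain_pull m' n' f e g e' h p q c = pull m' n' f g \<gamma> p q c"
    if eq: "\<And>xs ys. (xs, ys) \<in> cells (Delta2 m' n') p q \<Longrightarrow>
      h p q ((map f xs, map g ys), (map e xs, map e' ys)) = \<gamma> p q (map f xs, map g ys)" for f e g e' p q c and \<gamma> :: "(bisimplex, 'a) bmap"
  proof (cases "c \<in> cells (Delta2 m' n') p q")
    case True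
    then show ?thesis
      by (cases c) (simp add: chain_pull_apply pull_apply eq del: Delta2_simps)
  qed (simp add: chain_pull_undefined pull_undefined)
  have one: "replicate k 1 = map (coface 0) (replicate k 0)" for k
    by (simp add: coface_def)
  have zero: "replicate k 0 = map (coface 1) (replicate k 0)" for k
    by (simp add: coface_def)
  show "chain_pull m' n' f e g e' h = pull m' n' f g \<alpha>"
    if "mor m' m f" "mor n' n g" "mor n' 1 e'" and e: "\<And>i. i \<le> m' \<Longrightarrow> e i = 1"
  proof (intro ext 1)
    fix p q xs ys assume c: "(xs, ys) \<in> cells (Delta2 m' n') p q"
    have "(replicate (Suc p) 0, map e' ys) \<in> cells (Delta2 0 1) p q"
      using std_map_closed[OF that(1,3) c] by (auto simp: sorted_replicate simp del: replicate.simps set_map)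
    then have C: "((map f xs, map g ys), (replicate (Suc p) 0, map e' ys)) \<in> cells (bprod ?D (Delta2 (1 - 1) 1)) p q"
      using std_map_closed[OF that(1,2) c] by (simp del: Delta2_simps replicate_Suc)
    have "map e xs = map (coface 0) (replicate (Suc p) 0)"
      using map_constant_list[of xs p m' e 1] c e unfolding one[symmetric] by simp
    then have "h p q ((map f xs, map g ys), (map e xs, map e' ys)) =
        hat_d ?D 1 1 0 h p q ((map f xs, map g ys), (replicate (Suc p) 0, map e' ys))"
      by (simp only: hat_d_apply[OF C])
    also have "\<dots> = \<alpha> p q (map f xs, map g ys)"
      using E on_cylinder_apply[OF C, of \<alpha>] by (simp del: cells_bprod Delta2_simps)
    finally show "h p q ((map f xs, map g ys), (map e xs, map e' ys)) = \<alpha> p q (map f xs, map g ys)" .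
  qed
  show "chain_pull m' n' f e g e' h = pull m' n' f g \<alpha>"
    if "mor m' m f" "mor n' n g" "mor m' 1 e" and e: "\<And>j. j \<le> n' \<Longrightarrow> e' j = 1"
  proof (intro ext 1)
    fix p q xs ys assume c: "(xs, ys) \<in> cells (Delta2 m' n') p q"
    have "(map e xs, replicate (Suc q) 0) \<in> cells (Delta2 1 0) p q"
      using std_map_closed[OF that(3,2) c] by (auto simp: sorted_replicate simp del: replicate.simps set_map)
    then have C: "((map f xs, map g ys), (map e xs, replicate (Suc q) 0)) \<in> cells (bprod ?D (Delta2 1 (1 - 1))) p q"
      using std_map_closed[OF that(1,2) c] by (simp del: Delta2_simps replicate_Suc)
    have "map e' ys = map (coface 0) (replicate (Suc q) 0)"
      using map_constant_list[of ys q n' e' 1] c e unfolding one[symmetric] by simp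
    then have "h p q ((map f xs, map g ys), (map e xs, map e' ys)) =
        hat_dbar ?D 1 1 0 h p q ((map f xs, map g ys), (map e xs, replicate (Suc q) 0))"
      by (simp only: hat_dbar_apply[OF C])
    also have "\<dots> = \<alpha> p q (map f xs, map g ys)"
      using E on_cylinder_apply[OF C, of \<alpha>] by (simp del: cells_bprod Delta2_simps)
    finally show "h p q ((map f xs, map g ys), (map e xs, map e' ys)) = \<alpha> p q (map f xs, map g ys)" .
  qed
  show "chain_pull m' n' f e g e' h = pull m' n' f g \<beta>"
    if "mor m' m f" "mor n' n g" and e: "\<And>i. i \<le> m' \<Longrightarrow> e i = 0" "\<And>j. j \<le> n' \<Longrightarrow> e' j = 0"
  proof (intro ext 1)
    fix p q xs ys assume c: "(xs, ys) \<in> cells (Delta2 m' n') p q"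
    let ?z = "(replicate (Suc p) 0, replicate (Suc q) 0)" and ?c = "(map f xs, map g ys)"
    have z: "?z \<in> cells (Delta2 (1 - 1) 0) p q" "?z \<in> cells (Delta2 1 (1 - 1)) p q"
      by (auto simp: sorted_replicate simp del: replicate_Suc)
    have C: "(?c, ?z) \<in> cells (bprod ?D (Delta2 (1 - 1) 0)) p q" "(?c, ?z) \<in> cells (bprod ?D (Delta2 1 (1 - 1))) p q"
      "(?c, ?z) \<in> cells (bprod ?D (Delta2 0 0)) p q"
      using std_map_closed[OF that(1,2) c] z by (simp_all del: Delta2_simps replicate_Suc)
    have "map e xs = replicate (Suc p) 0" "map e' ys = replicate (Suc q) 0"
      using map_constant_list[of xs p m' e 0] map_constant_list[of ys q n' e' 0] c e by simp_all
    then have "h p q (?c, (map e xs, map e' ys)) = hat_dbar ?D 1 1 1 h p q (?c, ?z)"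
      by (simp only: hat_dbar_apply[OF C(2)] zero[symmetric])
    also have "\<dots> = hat_d ?D 1 0 1 (hat_dbar ?D 1 1 1 h) p q (?c, ?z)"
      by (simp only: hat_d_apply[OF C(1)] zero[symmetric])
    also have "\<dots> = \<beta> p q ?c"
      using E on_cylinder_apply[OF C(3), of \<beta>] by (simp del: cells_bprod Delta2_simps)
    finally show "h p q (?c, (map e xs, map e' ys)) = \<beta> p q ?c" .
  qed
qed

lemma homotopy_rel_trivial:
  assumes h: "h \<in> bihom (bprod (Delta2 m n) (Delta2 1 1)) X"
    and rel: "brestr (bprod (delta_A m n) (Delta2 1 1)) h = const_map pt (bprod (delta_A m n) (Delta2 1 1))"
    and mor: "mor m' m f" "mor n' n g" "mor m' 1 e" "mor n' 1 e'"
    and miss: "(\<exists>i<m. \<forall>v\<le>m'. f v \<noteq> i) \<or> (\<exists>j<n. \<forall>v\<le>n'. g v \<noteq> j) \<or> (\<forall>v\<le>m'. f v \<noteq> m) \<and> (\<forall>v\<le>n'. g v \<noteq> n)"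
  shows "chain_pull m' n' f e g e' h = const_map pt (Delta2 m' n')"
proof (rule maps_eq_constI[OF chain_pull_in_bihom[OF h mor]])
  fix p q xs ys assume c: "(xs, ys) \<in> cells (Delta2 m' n') p q"
  let ?c = "(map f xs, map g ys)" and ?u = "(map e xs, map e' ys)"
  have v: "\<forall>v\<in>set xs. v \<le> m'" "\<forall>v\<in>set ys. v \<le> n'" using c by auto
  have "(\<exists>i<m. i \<notin> set (map f xs)) \<or> (\<exists>j<n. j \<notin> set (map g ys)) \<or> m \<notin> set (map f xs) \<and> n \<notin> set (map g ys)"
    using miss
  proof (elim disjE exE)
    assume "(\<forall>v\<le>m'. f v \<noteq> m) \<and> (\<forall>v\<le>n'. g v \<noteq> n)"
    then have "m \<notin> set (map f xs) \<and> n \<notin> set (map g ys)" using v by auto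
    then show ?thesis by blast
  next
    fix i assume "i < m \<and> (\<forall>v\<le>m'. f v \<noteq> i)"
    then have "i < m" "i \<notin> set (map f xs)" using v by auto
    then show ?thesis by blast
  next
    fix j assume "j < n \<and> (\<forall>v\<le>n'. g v \<noteq> j)"
    then have "j < n" "j \<notin> set (map g ys)" using v by auto
    then show ?thesis by blast
  qed
  then have "?c \<in> cells (delta_A m n) p q"
    using std_map_closed[OF mor(1,2) c] unfolding delta_A_eq by (auto simp del: Delta2_simps set_map simp: le_less)
  then have C: "(?c, ?u) \<in> cells (bprod (delta_A m n) (Delta2 1 1)) p q"
    using std_map_closed[OF mor(3,4) c] by (simp del: Delta2_simps)
  have "h p q (?c, ?u) = brestr (bprod (delta_A m n) (Delta2 1 1)) h p q (?c, ?u)"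
    using C by (simp add: brestr_def del: cells_bprod)
  also have "\<dots> = pt p q (replicate (Suc p) 0, replicate (Suc q) 0)"
    unfolding rel by (rule const_map_apply[OF C])
  finally show "chain_pull m' n' f e g e' h p q (xs, ys) = pt p q (replicate (Suc p) 0, replicate (Suc q) 0)"
    unfolding chain_pull_apply[OF c] .
qed

context pointed_maps
begin

lemma aeq_of_homotopy:
  assumes "(\<alpha>, \<beta>) \<in> aeppli_rel X pt (Suc a) (Suc b)"
  shows "aeq a b (Suc a, Suc b, \<alpha>) (Suc a, Suc b, \<beta>)"
proof -
  obtain h where \<alpha>: "\<alpha> \<in> aeppli_maps X pt (Suc a) (Suc b)" and \<beta>: "\<beta> \<in> aeppli_maps X pt (Suc a) (Suc b)"
    and hom: "is_homotopy X (Delta2 (Suc a) (Suc b)) \<alpha> \<beta> h"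
    and rel: "brestr (bprod (delta_A (Suc a) (Suc b)) (Delta2 1 1)) h =
        const_map pt (bprod (delta_A (Suc a) (Suc b)) (Delta2 1 1))"
    using assms by (auto simp: aeppli_rel_def homotopy_rel_def aeppli_maps_def)
  have h: "h \<in> bihom (bprod (Delta2 (Suc a) (Suc b)) (Delta2 1 1)) X"
    using hom by (simp add: is_homotopy_def)
  have \<alpha>': "\<alpha> \<in> bihom (Delta2 (Suc a) (Suc b)) X" and \<beta>': "\<beta> \<in> bihom (Delta2 (Suc a) (Suc b)) X"
    using \<alpha> \<beta> by (auto simp: aeppli_maps_def rel_maps_def)
  \<comment> \<open>\<open>codegen k\<close> and \<open>step k\<close> are the components of the \<open>k\<close>-th maximal chain of a prism\<close>
  define step :: "nat \<Rightarrow> nat \<Rightarrow> nat" where "step k v = (if v \<le> k then 0 else 1)" for k v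
  define H where "H k l = (Suc (Suc a), Suc (Suc b),
      chain_pull (Suc (Suc a)) (Suc (Suc b)) (codegen k) (step k) (codegen l) (step l) h)" for k l
  have mst: "mor q 1 (step k)" for q k by (auto simp: mor_def step_def)
  have mstc: "mor q 1 (step k \<circ> f)" if "mor q r f" for q k r f
    using that unfolding mor_def by (simp add: step_def) (meson le_trans)
  have mc: "mor q r (f \<circ> f')" if "mor q q' f'" "mor q' r f" for q q' r f f'
    using that by (auto simp: mor_def)
  have MG: "mor c c (codegen k \<circ> coface i)" if "k \<le> c" "i \<le> Suc c" for c k i
    by (rule mc[of _ "Suc c"]) (use that in auto)
  have MS: "mor c 1 (step k \<circ> coface i)" if "i \<le> Suc c" for c k i
    by (rule mstc[of _ "Suc c"]) (use that in auto)
  note mst' = mst[unfolded One_nat_def]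
  note R = homotopy_restrictions[OF hom] and T = homotopy_rel_trivial[OF h rel]
  show ?thesis
  proof (rule aeq_of_prism[where H = H])
    show "(Suc a, Suc b, \<alpha>) \<in> rel_cells a b" using \<alpha> by (simp add: rel_cells_iff)
  next
    fix k l assume kl: "k \<le> Suc a" "l \<le> Suc b"
    have "chain_pull (Suc (Suc a)) (Suc (Suc b)) (codegen k) (step k) (codegen l) (step l) h
        \<in> bihom (Delta2 (Suc (Suc a)) (Suc (Suc b))) X"
      using kl by (intro chain_pull_in_bihom[OF h] mst) auto
    then show "H k l \<in> tagged_cells X \<and> fst (H k l) = Suc (Suc a) \<and> fst (snd (H k l)) = Suc (Suc b)"
      by (simp add: H_def tag_defs)
  next
    fix l assume l: "l \<le> Suc b"
    have "d_map (Suc (Suc a)) (Suc (Suc b)) 0 (snd (snd (H 0 l))) =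
        pull (Suc a) (Suc (Suc b)) (codegen 0 \<circ> coface 0) (codegen l \<circ> id) \<alpha>"
      unfolding H_def d_map_pull snd_conv using l
      by (subst pull_chain_pull) (auto intro!: R(1) mc[of _ "Suc (Suc a)"] mstc mor_coface mor_codegen simp: step_def coface_def mst mst')
    also have "\<dots> = sbar_map (Suc a) (Suc b) l \<alpha>"
      unfolding sbar_map_pull by (rule pull_cong) (auto simp: codegen_def coface_def)
    finally show "tag_d 0 (H 0 l) = tag_sbar l (Suc a, Suc b, \<alpha>)"
      by (simp add: tag_defs H_def)
  next
    fix k assume k: "k \<le> Suc a"
    have "dbar_map (Suc (Suc a)) (Suc (Suc b)) 0 (snd (snd (H k 0))) =
        pull (Suc (Suc a)) (Suc b) (codegen k \<circ> id) (codegen 0 \<circ> coface 0) \<alpha>"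
      unfolding H_def dbar_map_pull snd_conv using k
      by (subst pull_chain_pull) (auto intro!: R(2) mc[of _ "Suc (Suc b)"] mstc mor_coface mor_codegen simp: step_def coface_def mst mst')
    also have "\<dots> = s_map (Suc a) (Suc b) k \<alpha>"
      unfolding s_map_pull by (rule pull_cong) (auto simp: codegen_def coface_def)
    finally show "tag_dbar 0 (H k 0) = tag_s k (Suc a, Suc b, \<alpha>)"
      by (simp add: tag_defs H_def)
  next
    fix k l assume kl: "k \<le> a" "l \<le> Suc b"
    then show "tag_d (Suc k) (H (Suc k) l) = tag_d (Suc k) (H k l)"
      by (auto simp: tag_defs H_def d_map_pull pull_chain_pull mor_coface codegen_def coface_def step_def intro!: chain_pull_cong)
  next
    fix k l assume kl: "k \<le> Suc a" "l \<le> b"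
    then show "tag_dbar (Suc l) (H k (Suc l)) = tag_dbar (Suc l) (H k l)"
      by (auto simp: tag_defs H_def dbar_map_pull pull_chain_pull mor_coface codegen_def coface_def step_def intro!: chain_pull_cong)
  next
    fix i k l assume kl: "k \<le> Suc a" "l \<le> Suc b" and i: "i < k \<or> k + 1 < i \<and> i \<le> Suc a"
    then have "\<exists>i'<Suc a. \<forall>v\<le>Suc a. (codegen k \<circ> coface i) v \<noteq> i'"
      by (intro exI[of _ "if i < k then i else i - 1"]) (auto simp: codegen_def coface_def)
    then have "chain_pull (Suc a) (Suc (Suc b)) (codegen k \<circ> coface i) (step k \<circ> coface i) (codegen l \<circ> id) (step l \<circ> id) h
        = const_map pt (Delta2 (Suc a) (Suc (Suc b)))"
      using kl i by (intro T[OF _ _ _ _ disjI1]) (auto simp: MG MS mst simp del: One_nat_def comp_apply)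
    then show "tag_d i (H k l) = tag_pt pt (Suc a) (Suc (Suc b))"
      using i kl by (auto simp: tag_defs H_def d_map_pull pull_chain_pull mor_coface)
  next
    fix j k l assume kl: "k \<le> Suc a" "l \<le> Suc b" and j: "j < l \<or> l + 1 < j \<and> j \<le> Suc b"
    then have "\<exists>j'<Suc b. \<forall>v\<le>Suc b. (codegen l \<circ> coface j) v \<noteq> j'"
      by (intro exI[of _ "if j < l then j else j - 1"]) (auto simp: codegen_def coface_def)
    then have "chain_pull (Suc (Suc a)) (Suc b) (codegen k \<circ> id) (step k \<circ> id) (codegen l \<circ> coface j) (step l \<circ> coface j) h
        = const_map pt (Delta2 (Suc (Suc a)) (Suc b))"
      using kl j by (intro T[OF _ _ _ _ disjI2[OF disjI1]]) (auto simp: MG MS mst simp del: One_nat_def comp_apply)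
    then show "tag_dbar j (H k l) = tag_pt pt (Suc (Suc a)) (Suc b)"
      using j kl by (auto simp: tag_defs H_def dbar_map_pull pull_chain_pull mor_coface)
  next
    fix k l assume kl: "k \<le> a" "l \<le> b"
    then have "(\<forall>v\<le>Suc a. (codegen k \<circ> coface (Suc (Suc a))) v \<noteq> Suc a) \<and>
        (\<forall>v\<le>Suc b. (codegen l \<circ> coface (Suc (Suc b))) v \<noteq> Suc b)"
      by (auto simp: codegen_def coface_def)
    then have "chain_pull (Suc a) (Suc b) (codegen k \<circ> coface (Suc (Suc a))) (step k \<circ> coface (Suc (Suc a)))
        (codegen l \<circ> coface (Suc (Suc b))) (step l \<circ> coface (Suc (Suc b))) h = const_map pt (Delta2 (Suc a) (Suc b))"
      using kl by (intro T[OF _ _ _ _ disjI2[OF disjI2]]) (auto simp: MG MS simp del: One_nat_def comp_apply)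
    then show "tag_d (Suc (Suc a)) (tag_dbar (Suc (Suc b)) (H k l)) = tag_pt pt (Suc a) (Suc b)"
      by (simp add: tag_defs H_def d_map_pull dbar_map_pull pull_chain_pull mor_coface)
  next
    have "chain_pull (Suc a) (Suc b) (codegen (Suc a) \<circ> coface (Suc (Suc a))) (step (Suc a) \<circ> coface (Suc (Suc a)))
        (codegen (Suc b) \<circ> coface (Suc (Suc b))) (step (Suc b) \<circ> coface (Suc (Suc b))) h =
      pull (Suc a) (Suc b) (codegen (Suc a) \<circ> coface (Suc (Suc a))) (codegen (Suc b) \<circ> coface (Suc (Suc b))) \<beta>"
      by (rule R(3)) (auto simp: MG step_def coface_def)
    also have "\<dots> = \<beta>" by (rule pull_id[OF \<beta>']) (auto simp: coface_def codegen_def)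
    finally show "tag_d (Suc (Suc a)) (tag_dbar (Suc (Suc b)) (H (Suc a) (Suc b))) = (Suc a, Suc b, \<beta>)"
      by (simp add: tag_defs H_def d_map_pull dbar_map_pull pull_chain_pull mor_coface)
  qed
qed

end

lemma map2_del: "length xs = length ys \<Longrightarrow> i < length xs \<Longrightarrow> map2 f (del_nth i xs) (del_nth i ys) = del_nth i (map2 f xs ys)"
  by (intro nth_equalityI) (auto simp: nth_del)

lemma map2_dup: "length xs = length ys \<Longrightarrow> i < length xs \<Longrightarrow> map2 f (dup_nth i xs) (dup_nth i ys) = dup_nth i (map2 f xs ys)"
  by (intro nth_equalityI) (auto simp: nth_dup)

text \<open>
  The monotone map $[a+1] \times [1] \to [a+2]$ that sends $(w, t)$ to $w$ for $w < a$, to $a + t$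
  for $w = a$ and to $a + 2$ for $w = a + 1$.  It restricts to $\delta^a$ at $t = 1$ and to
  $\delta^{a+1}$ at $t = 0$, and $\sigma^a$ composed with it is the projection.
\<close>

definition collapse :: "nat \<Rightarrow> nat \<Rightarrow> nat \<Rightarrow> nat" where
  "collapse a w t = (if w < a then w else if w = a then a + t else Suc w)"

lemma collapse_facts:
  "collapse a w 0 = coface (Suc a) w" "collapse a w (Suc 0) = coface a w"
  "t \<le> 1 \<Longrightarrow> codegen a (collapse a w t) = w"
  by (auto simp: collapse_def coface_def codegen_def)

lemma collapse_mono: "w \<le> w' \<Longrightarrow> t \<le> t' \<Longrightarrow> t' \<le> 1 \<Longrightarrow> collapse a w t \<le> collapse a w' t'"
  by (auto simp: collapse_def)

lemma map2_collapse:
  assumes "length us = length xs" "sorted xs" "sorted us" "set us \<subseteq> {..1}" "set xs \<subseteq> {..Suc a}"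
  shows "sorted (map2 (collapse a) xs us)" "set (map2 (collapse a) xs us) \<subseteq> {..Suc (Suc a)}"
    "map (codegen a) (map2 (collapse a) xs us) = xs"
proof -
  have u: "us ! i \<le> 1" if "i < length xs" for i
    using assms(1,4) that nth_mem[of i us] by (metis atMost_iff subsetD)
  show "sorted (map2 (collapse a) xs us)"
    using assms u by (auto simp: sorted_iff_nth_mono intro!: collapse_mono)
  have "collapse a w t \<le> Suc (Suc a)" if "(w, t) \<in> set (zip xs us)" for w t
    using set_zip_leftD[OF that] set_zip_rightD[OF that] assms(4,5) by (fastforce simp: collapse_def)
  then show "set (map2 (collapse a) xs us) \<subseteq> {..Suc (Suc a)}" by auto
  show "map (codegen a) (map2 (collapse a) xs us) = xs"
    by (intro nth_equalityI) (use assms(1) u in \<open>auto simp: collapse_facts\<close>)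
qed

definition collapse_map :: "nat \<Rightarrow> nat \<Rightarrow> (bisimplex \<times> bisimplex, bisimplex) bmap" where
  "collapse_map a b = (\<lambda>p q. \<lambda>((xs, ys), (us, vs)) \<in> cells (bprod (Delta2 (Suc a) (Suc b)) (Delta2 1 1)) p q.
     (map2 (collapse a) xs us, map2 (collapse b) ys vs))"

lemma collapse_map_in_bihom:
  "collapse_map a b \<in> bihom (bprod (Delta2 (Suc a) (Suc b)) (Delta2 1 1)) (Delta2 (Suc (Suc a)) (Suc (Suc b)))"
proof -
  have del: "set (del_nth i xs) \<subseteq> A" and dup: "set (dup_nth i xs) \<subseteq> A" if "set xs \<subseteq> A" for i A and xs :: "nat list"
    using subset_trans[OF set_del that] subset_trans[OF set_dup that] by simp_all
  show ?thesis
    by (rule bihomI)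
     (auto simp: collapse_map_def map2_collapse(1,2) map2_del map2_dup sorted_del sorted_dup del dup simp del: set_map One_nat_def)
qed

lemma bisimplicial_set_bprod:
  assumes A: "bisimplicial_set A" and B: "bisimplicial_set B"
  shows "bisimplicial_set (bprod A B)"
proof -
  interpret A: bisimplicial_set A by (rule A)
  interpret B: bisimplicial_set B by (rule B)
  show ?thesis
  proof (rule bisimplicial_set.intro)
    fix n
    interpret A': simplicial_set "hrow A n" by (rule A.row)
    interpret B': simplicial_set "hrow B n" by (rule B.row)
    show "simplicial_set (hrow (bprod A B) n)"
      by unfold_locales
        (use A'.face_closed A'.degen_closed A'.face_face A'.face_degen_less A'.face_degen_same
          A'.face_degen_greater A'.degen_degen B'.face_closed B'.degen_closed B'.face_face B'.face_degen_less
          B'.face_degen_same B'.face_degen_greater B'.degen_degen in \<open>auto simp: hrow_def\<close>)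
  next
    fix n
    interpret A': simplicial_set "vcol A n" by (rule A.col)
    interpret B': simplicial_set "vcol B n" by (rule B.col)
    show "simplicial_set (vcol (bprod A B) n)"
      by unfold_locales
        (use A'.face_closed A'.degen_closed A'.face_face A'.face_degen_less A'.face_degen_same
          A'.face_degen_greater A'.degen_degen B'.face_closed B'.degen_closed B'.face_face B'.face_degen_less
          B'.face_degen_same B'.face_degen_greater B'.degen_degen in \<open>auto simp: vcol_def\<close>)
  qed (auto simp: A.hface_vface A.hface_vdegen A.hdegen_vface A.hdegen_vdegen
      B.hface_vface B.hface_vdegen B.hdegen_vface B.hdegen_vdegen)
qed

lemma collapse_omits:
  assumes "length us = length xs" "set us \<subseteq> {..1}"
  shows "i < a \<Longrightarrow> i \<notin> set xs \<Longrightarrow> i \<notin> set (map2 (collapse a) xs us)"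
    "a \<notin> set xs \<Longrightarrow> a \<notin> set (map2 (collapse a) xs us)"
    "Suc a \<notin> set xs \<Longrightarrow> Suc (Suc a) \<notin> set (map2 (collapse a) xs us)"
    "set us \<subseteq> {1} \<Longrightarrow> a \<notin> set (map2 (collapse a) xs us)"
proof -
  have t: "w \<in> set xs" "t \<le> 1" "t \<in> set us" if "(w, t) \<in> set (zip xs us)" for w t
    using set_zip_leftD[OF that] set_zip_rightD[OF that] assms(2) by auto
  show "i < a \<Longrightarrow> i \<notin> set xs \<Longrightarrow> i \<notin> set (map2 (collapse a) xs us)"
    "a \<notin> set xs \<Longrightarrow> a \<notin> set (map2 (collapse a) xs us)"
    using t by (fastforce simp: collapse_def split: if_splits)+
  show "Suc a \<notin> set xs \<Longrightarrow> Suc (Suc a) \<notin> set (map2 (collapse a) xs us)"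
    using t by (fastforce simp: collapse_def split: if_splits)
  show "set us \<subseteq> {1} \<Longrightarrow> a \<notin> set (map2 (collapse a) xs us)"
    using t by (fastforce simp: collapse_def split: if_splits)
qed

context pointed_maps
begin

text \<open>
  If $\theta$ exhibits $\beta$ as a product of $\alpha$ and the base point, then $\theta$ composed
  with the collapse in both directions is a homotopy from $\alpha$ to $\beta$ rel
  $\delta_{\mathrm A}\Delta^{m,n}$.
\<close>

lemma homotopy_of_filler:
  assumes \<alpha>: "\<alpha> \<in> aeppli_maps X pt (Suc a) (Suc b)" and \<beta>: "\<beta> \<in> aeppli_maps X pt (Suc a) (Suc b)"
    and fill: "aeppli_filler X pt (Suc a) (Suc b) \<alpha> (const_map pt (Delta2 (Suc a) (Suc b))) \<theta>"
    and \<beta>_eq: "\<beta> = d_map (Suc a + 1) (Suc b) (Suc a) (dbar_map (Suc a + 1) (Suc b + 1) (Suc b) \<theta>)"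
  shows "(\<alpha>, \<beta>) \<in> aeppli_rel X pt (Suc a) (Suc b)"
proof -
  let ?D = "Delta2 (Suc a) (Suc b)" and ?D' = "Delta2 (Suc (Suc a)) (Suc (Suc b))"
  let ?pt = "\<lambda>p q. pt p q (replicate (Suc p) 0, replicate (Suc q) 0)"
  have \<theta>: "\<theta> \<in> bihom ?D' X"
    and \<theta>1: "\<And>i. i < a \<Longrightarrow> d_map (Suc (Suc a)) (Suc (Suc b)) i \<theta> = const_map pt (Delta2 (Suc a) (Suc (Suc b)))"
    and \<theta>2: "\<And>j. j < b \<Longrightarrow> dbar_map (Suc (Suc a)) (Suc (Suc b)) j \<theta> = const_map pt (Delta2 (Suc (Suc a)) (Suc b))"
    and \<theta>3: "d_map (Suc (Suc a)) (Suc (Suc b)) a \<theta> = sbar_map (Suc a) (Suc b) b \<alpha>"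
    and \<theta>4: "dbar_map (Suc (Suc a)) (Suc (Suc b)) b \<theta> = s_map (Suc a) (Suc b) a \<alpha>"
    and \<theta>5: "d_map (Suc (Suc a)) (Suc b) (Suc (Suc a)) (dbar_map (Suc (Suc a)) (Suc (Suc b)) (Suc (Suc b)) \<theta>) = const_map pt ?D"
    and \<beta>': "\<beta> = d_map (Suc (Suc a)) (Suc b) (Suc a) (dbar_map (Suc (Suc a)) (Suc (Suc b)) (Suc b) \<theta>)"
    using fill \<beta>_eq by (simp_all add: aeppli_filler_def)
  have \<alpha>': "\<alpha> \<in> bihom ?D X" and \<alpha>_rel: "brestr (delta_A (Suc a) (Suc b)) \<alpha> = const_map pt (delta_A (Suc a) (Suc b))"
    using \<alpha> by (auto simp: aeppli_maps_def rel_maps_def)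
  \<comment> \<open>on its faces \<open>a\<close> and \<open>b\<close> the filler is a degenerate copy of \<open>\<alpha>\<close>\<close>
  have \<theta>_low: "\<theta> p q (xs, ys) = \<alpha> p q (map (codegen a) xs, map (codegen b) ys)"
    if c: "(xs, ys) \<in> cells ?D' p q" and o: "a \<notin> set xs \<or> b \<notin> set ys" for p q xs ys
    using o
  proof
    assume o: "a \<notin> set xs"
    have "\<theta> p q (xs, ys) = sbar_map (Suc a) (Suc b) b \<alpha> p q (map (codegen a) xs, ys)"
      using d_map_omit[OF c o, of \<theta>] \<theta>3 by simp
    also have "\<dots> = \<alpha> p q (map (codegen a) xs, map (codegen b) ys)"
      using omit_lower(1)[OF c o] unfolding sbar_map_pull by (subst pull_apply) auto
    finally show ?thesis .
  next
    assume o: "b \<notin> set ys"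
    have "\<theta> p q (xs, ys) = s_map (Suc a) (Suc b) a \<alpha> p q (xs, map (codegen b) ys)"
      using dbar_map_omit[OF c o, of \<theta>] \<theta>4 by simp
    also have "\<dots> = \<alpha> p q (map (codegen a) xs, map (codegen b) ys)"
      using omit_lower_v(1)[OF c o] unfolding s_map_pull by (subst pull_apply) auto
    finally show ?thesis .
  qed
  let ?P = "bprod ?D (Delta2 1 1)"
  define h where "h = bcomp ?P \<theta> (collapse_map a b)"
  have h: "h \<in> bihom ?P X"
    unfolding h_def by (rule bcomp_in_bihom[OF bisimplicial_set_bprod collapse_map_in_bihom \<theta>])
      (rule bisimplicial_set_Delta2)+
  have h_apply: "h p q ((xs, ys), (us, vs)) = \<theta> p q (map2 (collapse a) xs us, map2 (collapse b) ys vs)"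
    and cell: "(map2 (collapse a) xs us, map2 (collapse b) ys vs) \<in> cells ?D' p q"
    if "((xs, ys), (us, vs)) \<in> cells ?P p q" for p q xs ys us vs
    using that bihomD(1)[OF collapse_map_in_bihom that]
    by (simp_all add: h_def bcomp_apply collapse_map_def del: cells_bprod Delta2_simps)
  have low: "h p q ((xs, ys), (us, vs)) = \<alpha> p q (xs, ys)"
    if c: "((xs, ys), (us, vs)) \<in> cells ?P p q"
      and o: "a \<notin> set (map2 (collapse a) xs us) \<or> b \<notin> set (map2 (collapse b) ys vs)" for p q xs ys us vs
  proof -
    have "map (codegen a) (map2 (collapse a) xs us) = xs" "map (codegen b) (map2 (collapse b) ys vs) = ys"
      using c by (auto intro!: map2_collapse(3) simp del: map_map)
    then show ?thesis unfolding h_apply[OF c] \<theta>_low[OF cell[OF c] o] by simp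
  qed
  have ones: "set (map (coface 0) us) \<subseteq> {1}" if "set us \<subseteq> {..0}" for us
    using that by (auto simp: coface_def)
  have "hat_d ?D 1 1 0 h = on_cylinder ?D 0 1 \<alpha>"
  proof (intro ext)
    fix p q c
    show "hat_d ?D 1 1 0 h p q c = on_cylinder ?D 0 1 \<alpha> p q c"
    proof (cases "c \<in> cells (bprod ?D (Delta2 (1 - 1) 1)) p q")
      case True
      obtain xs ys us vs where c: "c = ((xs, ys), (us, vs))" by (metis prod.exhaust)
      note C = True[unfolded c]
      have us: "us = replicate (Suc p) 0" using C by (intro zero_list) auto
      have C': "((xs, ys), (map (coface 0) us, vs)) \<in> cells (bprod ?D (Delta2 1 1)) p q"
        using C unfolding us by (auto simp: coface_def sorted_replicate)
      have "a \<notin> set (map2 (collapse a) xs (map (coface 0) us))"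
        using C C' by (intro collapse_omits(4) ones) auto
      then show ?thesis
        using hat_d_apply[OF C, of 0 h] low[OF C'] on_cylinder_apply[of c ?D 0 1 p q \<alpha>] True
        by (simp add: c del: cells_bprod Delta2_simps set_map)
    qed (simp add: hat_d_def on_cylinder_def bcomp_def compose_def del: cells_bprod)
  qed
  moreover have "hat_dbar ?D 1 1 0 h = on_cylinder ?D 1 0 \<alpha>"
  proof (intro ext)
    fix p q c
    show "hat_dbar ?D 1 1 0 h p q c = on_cylinder ?D 1 0 \<alpha> p q c"
    proof (cases "c \<in> cells (bprod ?D (Delta2 1 (1 - 1))) p q")
      case True
      obtain xs ys us vs where c: "c = ((xs, ys), (us, vs))" by (metis prod.exhaust)
      note C = True[unfolded c]
      have vs: "vs = replicate (Suc q) 0" using C by (intro zero_list) auto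
      have C': "((xs, ys), (us, map (coface 0) vs)) \<in> cells (bprod ?D (Delta2 1 1)) p q"
        using C unfolding vs by (auto simp: coface_def sorted_replicate)
      have "b \<notin> set (map2 (collapse b) ys (map (coface 0) vs))"
        using C C' by (intro collapse_omits(4) ones) auto
      then show ?thesis
        using hat_dbar_apply[OF C, of 0 h] low[OF C'] on_cylinder_apply[of c ?D 1 0 p q \<alpha>] True
        by (simp add: c del: cells_bprod Delta2_simps set_map)
    qed (simp add: hat_dbar_def on_cylinder_def bcomp_def compose_def del: cells_bprod)
  qed
  moreover have "hat_d ?D 1 0 1 (hat_dbar ?D 1 1 1 h) = on_cylinder ?D 0 0 \<beta>"
  proof (intro ext)
    fix p q c
    show "hat_d ?D 1 0 1 (hat_dbar ?D 1 1 1 h) p q c = on_cylinder ?D 0 0 \<beta> p q c"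
    proof (cases "c \<in> cells (bprod ?D (Delta2 (1 - 1) 0)) p q")
      case True
      obtain xs ys us vs where c: "c = ((xs, ys), (us, vs))" by (metis prod.exhaust)
      note C = True[unfolded c]
      have us: "us = replicate (Suc p) 0" using C by (intro zero_list) auto
      have vs: "vs = replicate (Suc q) 0" using C by (intro zero_list) auto
      have z: "map (coface 1) (replicate k 0) = replicate k 0" for k by (simp add: coface_def)
      have C1: "((xs, ys), (us, vs)) \<in> cells (bprod ?D (Delta2 1 (1 - 1))) p q"
        and C2: "((xs, ys), (us, vs)) \<in> cells (bprod ?D (Delta2 1 1)) p q"
        using C unfolding us vs by (auto simp: sorted_replicate)
      have "map2 (collapse a) xs us = map (coface (Suc a)) xs" "map2 (collapse b) ys vs = map (coface (Suc b)) ys"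
        using C by (auto intro!: nth_equalityI simp: us vs collapse_facts simp del: replicate_Suc)
      then have "h p q ((xs, ys), (us, vs)) = \<theta> p q (map (coface (Suc a)) xs, map (coface (Suc b)) ys)"
        unfolding h_apply[OF C2] by simp
      also have "\<dots> = \<beta> p q (xs, ys)"
        unfolding \<beta>' d_map_pull dbar_map_pull using C
        by (subst pull_pull) (auto simp: pull_apply mor_coface)
      finally show ?thesis
        using hat_d_apply[OF C, of 1 "hat_dbar ?D 1 1 1 h"] hat_dbar_apply[OF C1, of 1 h]
          on_cylinder_apply[of c ?D 0 0 p q \<beta>] True
        by (simp add: c us vs z z[unfolded One_nat_def] del: cells_bprod Delta2_simps set_map replicate_Suc map_replicate)
    qed (simp add: hat_d_def on_cylinder_def bcomp_def compose_def del: cells_bprod)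
  qed
  ultimately have hom: "is_homotopy X ?D \<alpha> \<beta> h"
    using h by (simp add: is_homotopy_def)
  have h_rel: "h p q ((xs, ys), (us, vs)) = ?pt p q"
    if c: "((xs, ys), (us, vs)) \<in> cells (bprod (delta_A (Suc a) (Suc b)) (Delta2 1 1)) p q" for p q xs ys us vs
  proof -
    have C: "((xs, ys), (us, vs)) \<in> cells ?P p q"
      and o: "(\<exists>i<Suc a. i \<notin> set xs) \<or> (\<exists>j<Suc b. j \<notin> set ys) \<or> Suc a \<notin> set xs \<and> Suc b \<notin> set ys"
      using c unfolding delta_A_eq by (auto simp: le_less)
    let ?xs = "map2 (collapse a) xs us" and ?ys = "map2 (collapse b) ys vs"
    note c' = cell[OF C]
    have L: "length us = length xs" "set us \<subseteq> {..1}" "length vs = length ys" "set vs \<subseteq> {..1}"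
      using C by auto
    have \<alpha>_pt: "\<alpha> p q (xs, ys) = ?pt p q"
    proof -
      have "(xs, ys) \<in> cells ?D p q" using C by simp
      then show ?thesis using \<alpha>_rel[unfolded cells_boundary[OF \<alpha>']] o by blast
    qed
    consider i where "i < a" "i \<notin> set xs" | j where "j < b" "j \<notin> set ys" | "a \<notin> set xs \<or> b \<notin> set ys"
      | "Suc a \<notin> set xs" "Suc b \<notin> set ys" using o by (auto simp: less_Suc_eq)
    then show ?thesis
    proof cases
      case (1 i)
      have o: "i \<notin> set ?xs" by (rule collapse_omits(1)[OF L(1,2) 1])
      show ?thesis
        using d_map_omit[OF c' o, of \<theta>] \<theta>1[OF 1(1)] 1(1) omit_lower(1)[OF c' o]
        unfolding h_apply[OF C] by (simp add: const_map_apply del: Delta2_simps replicate_Suc map_map)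
    next
      case (2 j)
      have o: "j \<notin> set ?ys" by (rule collapse_omits(1)[OF L(3,4) 2])
      show ?thesis
        using dbar_map_omit[OF c' o, of \<theta>] \<theta>2[OF 2(1)] 2(1) omit_lower_v(1)[OF c' o]
        unfolding h_apply[OF C] by (simp add: const_map_apply del: Delta2_simps replicate_Suc map_map)
    next
      case 3
      then have "a \<notin> set ?xs \<or> b \<notin> set ?ys"
        using collapse_omits(2)[OF L(1,2)] collapse_omits(2)[OF L(3,4)] by blast
      then show ?thesis using low[OF C] \<alpha>_pt by simp
    next
      case 4
      have o: "Suc (Suc a) \<notin> set ?xs" "Suc (Suc b) \<notin> set ?ys"
        by (rule collapse_omits(3)[OF L(1,2) 4(1)], rule collapse_omits(3)[OF L(3,4) 4(2)])
      note c1 = omit_lower_v(1)[OF c' o(2) order_refl, unfolded diff_Suc_1]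
      note c2 = omit_lower(1)[OF c1 o(1) order_refl, unfolded diff_Suc_1]
      have "\<theta> p q (?xs, ?ys) = dbar_map (Suc (Suc a)) (Suc (Suc b)) (Suc (Suc b)) \<theta> p q (?xs, map (codegen (Suc (Suc b))) ?ys)"
        by (rule dbar_map_omit[OF c' o(2) order_refl, symmetric])
      also have "\<dots> = const_map pt ?D p q (map (codegen (Suc (Suc a))) ?xs, map (codegen (Suc (Suc b))) ?ys)"
        unfolding \<theta>5[symmetric] by (rule d_map_omit[OF c1 o(1) order_refl, symmetric])
      also have "\<dots> = ?pt p q" by (rule const_map_apply[OF c2])
      finally show ?thesis unfolding h_apply[OF C] .
    qed
  qed
  have "brestr (bprod (delta_A (Suc a) (Suc b)) (Delta2 1 1)) h = const_map pt (bprod (delta_A (Suc a) (Suc b)) (Delta2 1 1))"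
  proof (intro ext)
    fix p q and c :: "bisimplex \<times> bisimplex"
    obtain xs ys us vs where c: "c = ((xs, ys), (us, vs))" by (metis prod.exhaust)
    show "brestr (bprod (delta_A (Suc a) (Suc b)) (Delta2 1 1)) h p q c =
        const_map pt (bprod (delta_A (Suc a) (Suc b)) (Delta2 1 1)) p q c"
      by (cases "c \<in> cells (bprod (delta_A (Suc a) (Suc b)) (Delta2 1 1)) p q")
        (simp_all add: brestr_def const_map_apply const_map_undefined c h_rel del: cells_bprod replicate_Suc)
  qed
  with hom \<alpha> \<beta> show ?thesis
    unfolding aeppli_rel_def homotopy_rel_def aeppli_maps_def by blast
qed

lemma aeppli_rel_iff:
  "(\<alpha>, \<beta>) \<in> aeppli_rel X pt (Suc a) (Suc b) \<longleftrightarrow> aeq a b (Suc a, Suc b, \<alpha>) (Suc a, Suc b, \<beta>)"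
proof
  assume e: "aeq a b (Suc a, Suc b, \<alpha>) (Suc a, Suc b, \<beta>)"
  then have r: "(Suc a, Suc b, \<alpha>) \<in> rel_cells a b" "(Suc a, Suc b, \<beta>) \<in> rel_cells a b"
    by (auto simp: aeq_def)
  have "aprod a b (Suc a, Suc b, \<alpha>) (tag_pt pt (Suc a) (Suc b)) (Suc a, Suc b, \<beta>)"
    using aprod_unique_iff[OF r(1) pt_rel_cells aprod_pt_right[OF r(1)]] e by blast
  then obtain \<theta> where "aeppli_filler X pt (Suc a) (Suc b) \<alpha> (const_map pt (Delta2 (Suc a) (Suc b))) \<theta>"
    "\<beta> = d_map (Suc a + 1) (Suc b) (Suc a) (dbar_map (Suc a + 1) (Suc b + 1) (Suc b) \<theta>)"
    unfolding tag_pt_def aprod_iff_filler by auto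
  with r show "(\<alpha>, \<beta>) \<in> aeppli_rel X pt (Suc a) (Suc b)"
    unfolding rel_cells_iff by (intro homotopy_of_filler)
qed (rule aeq_of_homotopy)

end

section \<open>The group\<close>

text \<open>
  A multivalued product \<open>P\<close> that is single-valued and associative up to an equivalence relation and
  has a two-sided unit and right inverses makes the quotient a group.
\<close>

lemma quotient_group:
  assumes E: "equiv M E"
    and ex: "\<And>x y. x \<in> M \<Longrightarrow> y \<in> M \<Longrightarrow> \<exists>z. P x y z"
    and closed: "\<And>x y z. x \<in> M \<Longrightarrow> y \<in> M \<Longrightarrow> P x y z \<Longrightarrow> z \<in> M"
    and uniq: "\<And>x y z z'. x \<in> M \<Longrightarrow> y \<in> M \<Longrightarrow> P x y z \<Longrightarrow> P x y z' \<longleftrightarrow> (z, z') \<in> E"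
    and cong: "\<And>x y z x' y'. P x y z \<Longrightarrow> (x, x') \<in> E \<Longrightarrow> (y, y') \<in> E \<Longrightarrow> P x' y' z"
    and assoc: "\<And>x y z. x \<in> M \<Longrightarrow> y \<in> M \<Longrightarrow> z \<in> M \<Longrightarrow> \<exists>xy yz w. P x y xy \<and> P y z yz \<and> P xy z w \<and> P x yz w"
    and e: "e \<in> M" "\<And>x. x \<in> M \<Longrightarrow> P e x x" "\<And>x. x \<in> M \<Longrightarrow> P x e x"
    and inv: "\<And>x. x \<in> M \<Longrightarrow> \<exists>y \<in> M. P x y e"
  shows "group \<lparr>carrier = M // E, mult = (\<lambda>A B. \<Union>x\<in>A. \<Union>y\<in>B. \<Union>z\<in>{z. P x y z}. E `` {z}), one = E `` {e}\<rparr>"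
proof -
  let ?m = "\<lambda>A B. \<Union>x\<in>A. \<Union>y\<in>B. \<Union>z\<in>{z. P x y z}. E `` {z}"
  have sym: "(y, x) \<in> E" if "(x, y) \<in> E" for x y using E that by (meson equivE symE)
  have dom: "x \<in> M" "y \<in> M" if "(x, y) \<in> E" for x y
    using that E unfolding equiv_def refl_on_def by auto
  have m: "?m (E `` {x}) (E `` {y}) = E `` {z}" if xy: "x \<in> M" "y \<in> M" and z: "P x y z" for x y z
  proof -
    have "E `` {z'} = E `` {z}" if "(x, x') \<in> E" "(y, y') \<in> E" "P x' y' z'" for x' y' z'
    proof -
      have "P x' y' z" by (rule cong[OF z that(1,2)])
      then have "(z', z) \<in> E" using uniq[of x' y' z' z] that dom by blast
      then show ?thesis using E by (meson equiv_class_eq)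
    qed
    then have "?m (E `` {x}) (E `` {y}) \<subseteq> E `` {z}" by blast
    moreover have "x \<in> E `` {x}" "y \<in> E `` {y}" using E xy by (auto simp: equiv_def refl_on_def)
    then have "E `` {z} \<subseteq> ?m (E `` {x}) (E `` {y})" using z by blast
    ultimately show ?thesis by (rule subset_antisym)
  qed
  have cls: "E `` {x} \<in> M // E" if "x \<in> M" for x by (rule quotientI[OF that])
  have assoc': "?m (?m (E `` {x}) (E `` {y})) (E `` {z}) = ?m (E `` {x}) (?m (E `` {y}) (E `` {z}))"
    if xyz: "x \<in> M" "y \<in> M" "z \<in> M" for x y z
  proof -
    obtain xy yz w where p: "P x y xy" "P y z yz" "P xy z w" "P x yz w" using assoc[OF xyz] by blast
    have "xy \<in> M" "yz \<in> M" using closed xyz p by blast+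
    then show ?thesis using m xyz p by simp
  qed
  have right_inv: "\<exists>y\<in>M. ?m (E `` {x}) (E `` {y}) = E `` {e}" if "x \<in> M" for x
    using inv[OF that] m that by blast
  show ?thesis
  proof (rule groupI, unfold monoid.simps partial_object.simps)
    fix A B assume "A \<in> M // E" "B \<in> M // E"
    then obtain x y where xy: "A = E `` {x}" "B = E `` {y}" "x \<in> M" "y \<in> M" by (meson quotientE)
    obtain z where "P x y z" using ex xy by blast
    then show "?m A B \<in> M // E" using m[of x y z] closed[of x y z] cls[of z] xy by simp
  next
    show "E `` {e} \<in> M // E" by (rule cls[OF e(1)])
  next
    fix A B C assume "A \<in> M // E" "B \<in> M // E" "C \<in> M // E"
    then show "?m (?m A B) C = ?m A (?m B C)" using assoc' by (elim quotientE) simp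
  next
    fix A assume "A \<in> M // E"
    then show "?m (E `` {e}) A = A" using m[OF e(1) _ e(2)] by (elim quotientE) simp
  next
    fix A assume "A \<in> M // E"
    then obtain x where x: "A = E `` {x}" "x \<in> M" by (meson quotientE)
    obtain y where y: "y \<in> M" "?m (E `` {x}) (E `` {y}) = E `` {e}" using right_inv[OF x(2)] by blast
    obtain z where z: "z \<in> M" "?m (E `` {y}) (E `` {z}) = E `` {e}" using right_inv[OF y(1)] by blast
    \<comment> \<open>\<open>x = x e = x (y z) = (x y) z = e z = z\<close>\<close>
    have "E `` {x} = ?m (E `` {x}) (E `` {e})" using m[OF x(2) e(1) e(3)[OF x(2)]] by simp
    also have "\<dots> = ?m (?m (E `` {x}) (E `` {y})) (E `` {z})"
      unfolding assoc'[OF x(2) y(1) z(1)] z(2) ..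
    also have "\<dots> = E `` {z}" unfolding y(2) by (rule m[OF e(1) z(1) e(2)[OF z(1)]])
    finally show "\<exists>B\<in>M // E. ?m B A = E `` {e}"
      using z(2) cls[OF y(1)] unfolding x(1) by auto
  qed
qed

theorem theorem3p20:
  fixes X :: "'a bisset" and pt :: "(bisimplex, 'a) bmap" and m n :: nat
  assumes "bisimplicial_set X"
    and "pt \<in> bihom (Delta2 0 0) X"
    and "fibrant TYPE('u :: infinite) X"
    and "m \<ge> 1" and "n \<ge> 1"
  shows "\<exists>e. group \<lparr>carrier = aeppli_pi X pt m n, mult = aeppli_prod X pt m n, one = e\<rparr>"
proof -
  obtain a b where mn: "m = Suc a" "n = Suc b"
    using assms(4,5) by (metis Suc_le_D One_nat_def)
  interpret pointed_maps X pt
    by (intro pointed_maps.intro pointed_maps_axioms.intro bikan_tagged[OF assms(2,3)] assms(2))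
  let ?M = "aeppli_maps X pt m n" and ?E = "aeppli_rel X pt m n"
  define P where "P \<alpha> \<beta> \<epsilon> \<longleftrightarrow> (\<exists>\<theta>. aeppli_filler X pt m n \<alpha> \<beta> \<theta> \<and>
      \<epsilon> = d_map (m + 1) n m (dbar_map (m + 1) (n + 1) n \<theta>))" for \<alpha> \<beta> \<epsilon>
  have P: "P \<alpha> \<beta> \<epsilon> \<longleftrightarrow> aprod a b (m, n, \<alpha>) (m, n, \<beta>) (m, n, \<epsilon>)" for \<alpha> \<beta> \<epsilon>
    unfolding P_def mn aprod_iff_filler by auto
  have M: "\<alpha> \<in> ?M \<longleftrightarrow> (m, n, \<alpha>) \<in> rel_cells a b" for \<alpha>
    unfolding mn rel_cells_iff ..
  have E: "(\<alpha>, \<beta>) \<in> ?E \<longleftrightarrow> aeq a b (m, n, \<alpha>) (m, n, \<beta>)" for \<alpha> \<beta>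
    unfolding mn aeppli_rel_iff ..
  have tag: "\<exists>\<gamma>. c = (m, n, \<gamma>)" if "c \<in> rel_cells a b" for c
    using that unfolding mn by (elim rel_cellsE) blast
  define e where "e = const_map pt (Delta2 m n)"
  have e: "(m, n, e) = tag_pt pt (Suc a) (Suc b)" by (simp add: e_def mn tag_pt_def)
  have "group \<lparr>carrier = ?M // ?E, mult = (\<lambda>A B. \<Union>x\<in>A. \<Union>y\<in>B. \<Union>z\<in>{z. P x y z}. ?E `` {z}), one = ?E `` {e}\<rparr>"
  proof (rule quotient_group)
    show "equiv ?M ?E"
    proof (rule equivI)
      show "?E \<subseteq> ?M \<times> ?M" by (auto simp: E M aeq_def)
      show "refl_on ?M ?E" by (auto simp: refl_on_def E M aeq_refl)
      show "sym ?E" by (auto simp: sym_def E aeq_sym)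
      show "trans ?E" by (auto simp: trans_def E intro: aeq_trans)
    qed
  next
    fix x y assume "x \<in> ?M" "y \<in> ?M"
    then show "\<exists>z. P x y z"
      using aprod_exists[of "(m, n, x)" a b "(m, n, y)"] aprod_closed[of a b "(m, n, x)" "(m, n, y)"] tag
      unfolding M P by metis
  next
    fix x y z assume "x \<in> ?M" "y \<in> ?M" "P x y z"
    then show "z \<in> ?M" using aprod_closed unfolding M P by blast
  next
    fix x y z z' assume "x \<in> ?M" "y \<in> ?M" "P x y z"
    then show "P x y z' \<longleftrightarrow> (z, z') \<in> ?E" using aprod_unique_iff unfolding M P E by blast
  next
    fix x y z x' y' assume "P x y z" "(x, x') \<in> ?E" "(y, y') \<in> ?E"
    then show "P x' y' z"
      unfolding P E using aprod_aeq_left aprod_aeq_right unfolding aeq_def by blast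
  next
    fix x y z assume xyz: "x \<in> ?M" "y \<in> ?M" "z \<in> ?M"
    note r = xyz[unfolded M]
    obtain xy yz w where p: "aprod a b (m, n, x) (m, n, y) xy" "aprod a b (m, n, y) (m, n, z) yz"
      "aprod a b xy (m, n, z) w" "aprod a b (m, n, x) yz w"
      by (rule aprod_assoc[OF r])
    have "xy \<in> rel_cells a b" "yz \<in> rel_cells a b" using aprod_closed p r by blast+
    moreover from this have "w \<in> rel_cells a b" using aprod_closed p r by blast
    ultimately show "\<exists>xy yz w. P x y xy \<and> P y z yz \<and> P xy z w \<and> P x yz w"
      using tag[of xy] tag[of yz] tag[of w] p unfolding P by auto
  next
    show "e \<in> ?M" unfolding M e by (rule pt_rel_cells)
  next
    fix x assume "x \<in> ?M"
    then show "P e x x" "P x e x"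
      using aeq_refl aprod_pt_right unfolding M P e by (auto simp: aeq_def)
  next
    fix x assume "x \<in> ?M"
    then obtain y where "y \<in> rel_cells a b" "aprod a b (m, n, x) y (tag_pt pt (Suc a) (Suc b))"
      unfolding M by (rule ex_right_inverse)
    then show "\<exists>y\<in>?M. P x y e" using tag[of y] unfolding Bex_def M P e by auto
  qed
  moreover have "aeppli_prod X pt m n = (\<lambda>A B. \<Union>x\<in>A. \<Union>y\<in>B. \<Union>z\<in>{z. P x y z}. ?E `` {z})"
  proof -
    have "(\<Union>z\<in>{z. P x y z}. ?E `` {z}) = (\<Union>\<theta>\<in>{\<theta>. aeppli_filler X pt m n x y \<theta>}.
        ?E `` {d_map (m + 1) n m (dbar_map (m + 1) (n + 1) n \<theta>)})" for x y
      unfolding P_def by blast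
    then show ?thesis by (simp add: aeppli_prod_def fun_eq_iff)
  qed
  ultimately show ?thesis
    unfolding aeppli_pi_def by auto
qed

end
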